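(* Let $\mathfrak a=(a_1,\dots,a_r)\subseteq \mathbb C\{x,y\}$ be an ideal with given nonzero generators $a_1,\dots,a_r$. The eight-step procedure described in the context, applied to $a_1,\dots,a_r$, computes the weighted cluster of base points of $\mathfrak a$: the weighted cluster $(B,\beta)$ that it returns is equal to $BP(\mathfrak a)$, weighted by its virtual values.
   Context: Infinitely near points. Let $O$ be a smooth point of a complex surface $X$, $\mathcal O_{X,O}\cong\mathbb C\{x,y\}$. $\mathcal N_O$ is the set consisting of $O$ and all points infinitely near to $O$, i.e. points on exceptional divisors of compositions of finitely many point blow-ups above $O$ (a point is identified with its images under blow-ups that are isomorphisms near it). The points on the exceptional divisor $E_p$ of the blow-up of $p$ form the first neighbourhood of $p$. Write $p\le q$ ($p$ precedes $q$ if $p<q$) if $q$ equals or is infinitely near to $p$. For $p<q$, $q$ is proximate to $p$, written $q\to p$, if $q$ lies on $E_p$ as a proper or infinitely near point (i.e. on $E_p$ or on a strict transform of $E_p$). Every $q\ne O$ is proximate to exactly one point ($q$ is free) or exactly two points ($q$ is satellite). For $0\ne f\in\mathbb C\{x,y\}$, $e_p(f)$ is the multiplicity at $p$ of the strict transform of the germ $f=0$, and the value is given recursively by $v_p(f)=e_p(f)+\sum_{p\to q}v_q(f)$ (sum over the points $q$ to which $p$ is proximate). The point $p$ lies on $f=0$ if $e_p(f)>0$. Clusters. A cluster is a finite set $K\subset\mathcal N_O$ containing with each point all points preceding it. A weighted cluster is a cluster with integer virtual multiplicities $e_p$ or, equivalently, virtual values $v_p$, related by $v_p=e_p+\sum_{p\to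 q}v_q$. Singular points. For a reduced germ $\xi:f=0$, a point $p$ lying on $\xi$ is singular if $e_p(f)>1$, or $p$ is satellite, or $p$ precedes a satellite point lying on $\xi$. The singular points of $\xi$ form a cluster. For a germ $\xi$, $\xi_{\rm red}$ is the associated reduced germ. Base points. For an ideal $\mathfrak a\subseteq\mathbb C\{x,y\}$ let $e_O(\mathfrak a)=\min\{e_O(f):f\in\mathfrak a\}$. For $p$ in the first neighbourhood of $O$ let $\varphi_p:\mathcal O_{X,O}\to\mathcal O_{X_p,p}$ be the pull-back of functions, $z$ a local equation of the exceptional divisor $E_O$ near $p$, let $\mathfrak a_p$ be the ideal generated by $z^{-e_O(\mathfrak a)}\varphi_p(\mathfrak a)$, and $e_p(\mathfrak a)$ the multiplicity of $\mathfrak a_p$ at $p$ (minimum of the multiplicities of its elements); repeat recursively to define $\mathfrak a_p$ and $e_p(\mathfrak a)$ for all $p\in\mathcal N_O$. Write $\mathfrak a=(g)\cdot\mathfrak a'$ with $g$ the greatest common divisor of the generators of $\mathfrak a$ (so $\mathfrak a'$ is $\mathfrak m$-primary or the unit ideal), and let $\eta:g=0$. Then $BP(\mathfrak a)$ is the weighted cluster whose points are those $p$ with $0<e_p(\mathfrak a)\neq e_p(g)$ together with the singular points of $\eta_{\rm red}$, weighted by the multiplicities $e_p(\mathfrak a)$ (equivalently by the corresponding virtual values). The procedure. (1) Put $g=\gcd(a_1,\dots,a_r)$, $a_i=gf_i$, and $f=g f_1\cdots f_r$. (2) Find the cluster $\overline K$ of singular points of $\xi_{\rm red}$, $\xi:f=0$,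 and the values $v_p(f_i)$, $v_p(g)$ for $p\in\overline K$. Weight $\overline K$ by the values $v_p=\min_i v_p(f_i)$. (3) Form $K'$ from $\overline K$ by adjoining, repeatedly until there are none left, every free point $q$ not yet in the cluster that is proximate to a point $p$ of the cluster and such that every $f_i$ with $v_p(f_i)=v_p$ satisfies $e_q(f_i)>0$; weight each new point by $v_q=\min_i v_q(f_i)$. (4) Form $K''$ from $K'$ by adjoining, repeatedly until there are none left, every satellite point $q$ not yet in the cluster that is proximate to two points $p,p'$ of the cluster and such that for each $f_i$ either $v_p(f_i)>v_p$ or $v_{p'}(f_i)>v_{p'}$; weight each new point by $v_q=\min_i v_q(f_i)$. (5) Compute recursively $e_p=v_p-\sum_{p\to q}v_q$ for $p\in K''$, and let $K\subset K''$ be the set of points with $e_p\ne0$, with virtual values $v_p$. (6) Set $BP(\mathfrak a')=(K,v)$ where $\mathfrak a'=(f_1,\dots,f_r)$. (7) From $\overline K$ extract the cluster $S$ of singular points of $\eta_{\rm red}$, $\eta:g=0$. (8) Return $(B,\beta)$ with $B=K\cup S$ and $\beta_p=v_p+v_p(g)$ for all $p\in B$. *)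

theory Defs
  imports
    "HOL-Analysis.Infinite_Sum"
    "HOL-Computational_Algebra.Formal_Power_Series"
    "HOL-Computational_Algebra.Squarefree"
    "HOL-Library.Sublist"
begin

unbundle fps_syntax

section \<open>The ring of convergent power series in two variables\<close>

text \<open>
  An element \<open>F\<close> of \<^typ>\<open>complex fps fps\<close> is read as the formal series
  \<open>\<Sum>i j. (F $ i $ j) x^i y^j\<close>: the outer variable is \<open>x\<close>, the inner one is \<open>y\<close>.
\<close>

definition convergent_series :: "complex fps fps \<Rightarrow> bool" where
  "convergent_series F \<longleftrightarrow>
     (\<exists>r>0. (\<lambda>(i, j). norm (F $ i $ j) * r ^ (i + j)) summable_on UNIV)"

lemma convergent_series_iff_bound:
  "convergent_series F \<longleftrightarrow> (\<exists>C R. R \<ge> 1 \<and> (\<forall>i j. norm (F $ i $ j) \<le> C * R ^ (i + j)))"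
proof
  assume "convergent_series F"
  then obtain r where r: "r > 0"
    and s: "(\<lambda>(i, j). norm (F $ i $ j) * r ^ (i + j)) summable_on UNIV"
    unfolding convergent_series_def by blast
  define S where "S = infsum (\<lambda>(i, j). norm (F $ i $ j) * r ^ (i + j)) UNIV"
  define R where "R = max 1 (1 / r)"
  have S0: "S \<ge> 0"
    unfolding S_def by (rule infsum_nonneg) (use r in auto)
  have "norm (F $ i $ j) \<le> S * R ^ (i + j)" for i j
  proof -
    have "(\<Sum>(i, j)\<in>{(i, j)}. norm (F $ i $ j) * r ^ (i + j)) \<le> S"
      unfolding S_def by (rule finite_sum_le_infsum[OF s]) (use r in auto)
    then have "norm (F $ i $ j) \<le> S * (1 / r) ^ (i + j)"
      using r by (simp add: field_simps)
    also have "\<dots> \<le> S * R ^ (i + j)"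
      by (intro mult_left_mono power_mono S0) (use r in \<open>auto simp: R_def\<close>)
    finally show ?thesis .
  qed
  moreover have "R \<ge> 1" by (simp add: R_def)
  ultimately show "\<exists>C R. R \<ge> 1 \<and> (\<forall>i j. norm (F $ i $ j) \<le> C * R ^ (i + j))" by blast
next
  assume "\<exists>C R. R \<ge> 1 \<and> (\<forall>i j. norm (F $ i $ j) \<le> C * R ^ (i + j))"
  then obtain C R where R: "R \<ge> 1" and b: "\<And>i j. norm (F $ i $ j) \<le> C * R ^ (i + j)"
    by blast
  define r where "r = 1 / (2 * R)"
  have r: "r > 0" using R by (simp add: r_def)
  have geo: "((\<lambda>n. (1 / 2 :: real) ^ n) has_sum 2) UNIV"
    by (rule norm_summable_imp_has_sum) (auto intro: geometric_sums[of "1 / 2 :: real", simplified])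
  have s: "(\<lambda>(i, j). C * ((1 / 2) ^ i * (1 / 2) ^ j)) summable_on (UNIV \<times> UNIV :: (nat \<times> nat) set)"
  proof -
    have "(\<lambda>(i, j). (1 / 2 :: real) ^ i * (1 / 2) ^ j) summable_on (UNIV \<times> UNIV)"
    proof (rule summable_on_SigmaI)
      show "((\<lambda>j. case (i, j) of (i, j) \<Rightarrow> (1 / 2 :: real) ^ i * (1 / 2) ^ j)
              has_sum ((1 / 2) ^ i * 2)) UNIV" for i :: nat
        using has_sum_cmult_right[OF geo, of "(1 / 2) ^ i"] by simp
      show "(\<lambda>i. (1 / 2 :: real) ^ i * 2) summable_on UNIV"
        using summable_on_cmult_left[OF has_sum_imp_summable[OF geo], of 2] by simp
    qed auto
    from summable_on_cmult_right[OF this, of C] show ?thesis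
      by (simp add: case_prod_unfold)
  qed
  have "(\<lambda>(i, j). norm (F $ i $ j) * r ^ (i + j)) summable_on UNIV \<times> UNIV"
  proof (rule summable_on_comparison_test[OF s])
    fix p :: "nat \<times> nat"
    obtain i j where p: "p = (i, j)" by (cases p)
    have "norm (F $ i $ j) * r ^ (i + j) \<le> C * R ^ (i + j) * r ^ (i + j)"
      using b r by (intro mult_right_mono) auto
    also have "\<dots> = C * (R * r) ^ (i + j)" by (simp only: power_mult_distrib mult.assoc)
    also have "R * r = 1 / 2" using R by (simp add: r_def)
    finally show "(case p of (i, j) \<Rightarrow> norm (F $ i $ j) * r ^ (i + j))
        \<le> (case p of (i, j) \<Rightarrow> C * ((1 / 2) ^ i * (1 / 2) ^ j))"
      by (simp add: p power_add)
  qed (use r in auto)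
  then show "convergent_series F" using r by (auto simp: convergent_series_def)
qed

lemma convergent_seriesI:
  assumes "R \<ge> 1" "\<And>i j. norm (F $ i $ j) \<le> C * R ^ (i + j)"
  shows "convergent_series F"
  using assms convergent_series_iff_bound by blast

lemma convergent_seriesE:
  assumes "convergent_series F"
  obtains C R where "C \<ge> 0" "R \<ge> 1" "\<And>i j. norm (F $ i $ j) \<le> C * R ^ (i + j)"
proof -
  from assms obtain C R where *: "R \<ge> 1" "\<And>i j. norm (F $ i $ j) \<le> C * R ^ (i + j)"
    using convergent_series_iff_bound by blast
  have "C \<ge> 0" using *(2)[of 0 0] by (simp add: order_trans[OF norm_ge_zero])
  with * show ?thesis using that by blast
qed

lemma Suc_le_power2: "real (Suc n) \<le> 2 ^ n"
  by (induction n) auto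

lemma convergent_series_add:
  assumes "convergent_series F" "convergent_series G"
  shows "convergent_series (F + G)"
proof -
  obtain C R where 1: "C \<ge> 0" "R \<ge> 1" "\<And>i j. norm (F $ i $ j) \<le> C * R ^ (i + j)"
    using convergent_seriesE[OF assms(1)] by metis
  obtain D T where 2: "D \<ge> 0" "T \<ge> 1" "\<And>i j. norm (G $ i $ j) \<le> D * T ^ (i + j)"
    using convergent_seriesE[OF assms(2)] by metis
  show ?thesis
  proof (rule convergent_seriesI[of "max R T" _ "C + D"])
    fix i j
    have "norm ((F + G) $ i $ j) \<le> norm (F $ i $ j) + norm (G $ i $ j)"
      by (simp add: norm_triangle_ineq)
    also have "\<dots> \<le> C * R ^ (i + j) + D * T ^ (i + j)" using 1 2 by (intro add_mono) auto
    also have "\<dots> \<le> C * max R T ^ (i + j) + D * max R T ^ (i + j)"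
      using 1 2 by (intro add_mono mult_left_mono power_mono) auto
    finally show "norm ((F + G) $ i $ j) \<le> (C + D) * max R T ^ (i + j)"
      by (simp add: algebra_simps)
  qed (use 1 in auto)
qed

lemma convergent_series_uminus: "convergent_series F \<Longrightarrow> convergent_series (- F)"
  by (simp add: convergent_series_def)

lemma convergent_series_finite_support:
  assumes "\<And>i j. i + j > N \<Longrightarrow> F $ i $ j = 0"
  shows "convergent_series F"
proof -
  define C where "C = (\<Sum>i\<le>N. \<Sum>j\<le>N. norm (F $ i $ j))"
  have C: "C \<ge> 0" unfolding C_def by (intro sum_nonneg) auto
  have "norm (F $ i $ j) \<le> C" for i j
  proof (cases "i + j > N")
    case True
    then show ?thesis using assms C by simp
  next
    case False
    have "norm (F $ i $ j) \<le> (\<Sum>j\<le>N. norm (F $ i $ j))"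
      using False by (intro member_le_sum[where f = "\<lambda>j. norm (F $ i $ j)"]) auto
    also have "\<dots> \<le> C" unfolding C_def
      using False by (intro member_le_sum[where f = "\<lambda>i. \<Sum>j\<le>N. norm (F $ i $ j)"])
                     (auto intro: sum_nonneg)
    finally show ?thesis .
  qed
  then show ?thesis by (intro convergent_seriesI[of 1 _ C]) auto
qed

lemma convergent_series_mult:
  assumes "convergent_series F" "convergent_series G"
  shows "convergent_series (F * G)"
proof -
  obtain C R where 1: "C \<ge> 0" "R \<ge> 1" "\<And>i j. norm (F $ i $ j) \<le> C * R ^ (i + j)"
    using convergent_seriesE[OF assms(1)] by metis
  obtain D T where 2: "D \<ge> 0" "T \<ge> 1" "\<And>i j. norm (G $ i $ j) \<le> D * T ^ (i + j)"
    using convergent_seriesE[OF assms(2)] by metis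
  define U where "U = max R T"
  have U: "U \<ge> 1" using 1 by (simp add: U_def)
  show ?thesis
  proof (rule convergent_seriesI[of "2 * U" _ "C * D"])
    fix i j
    have term_le: "norm (F $ a $ b * G $ (i - a) $ (j - b)) \<le> C * D * U ^ (i + j)"
      if "a \<le> i" "b \<le> j" for a b
    proof -
      have "norm (F $ a $ b * G $ (i - a) $ (j - b))
          \<le> (C * R ^ (a + b)) * (D * T ^ (i - a + (j - b)))"
        unfolding norm_mult using 1 2 by (intro mult_mono) auto
      also have "\<dots> \<le> (C * U ^ (a + b)) * (D * U ^ (i - a + (j - b)))"
        using 1 2 U by (intro mult_mono mult_left_mono power_mono) (auto simp: U_def)
      also have "\<dots> = C * D * U ^ (a + b + (i - a + (j - b)))"
        by (simp only: power_add ac_simps)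
      also have "a + b + (i - a + (j - b)) = i + j" using that by simp
      finally show ?thesis .
    qed
    have "(F * G) $ i $ j = (\<Sum>a\<le>i. \<Sum>b\<le>j. F $ a $ b * G $ (i - a) $ (j - b))"
      by (simp add: fps_mult_nth fps_sum_nth atLeast0AtMost)
    also have "norm \<dots> \<le> (\<Sum>a\<le>i. \<Sum>b\<le>j. C * D * U ^ (i + j))"
      by (intro sum_norm_le) (use term_le in auto)
    also have "\<dots> = (real (Suc i) * real (Suc j)) * (C * D * U ^ (i + j))" by simp
    also have "\<dots> \<le> (2 ^ i * 2 ^ j) * (C * D * U ^ (i + j))"
      using 1 2 U Suc_le_power2 by (intro mult_right_mono mult_mono) auto
    also have "\<dots> = C * D * (2 * U) ^ (i + j)"
      by (simp add: power_mult_distrib power_add)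
    finally show "norm ((F * G) $ i $ j) \<le> C * D * (2 * U) ^ (i + j)" .
  qed (use U in auto)
qed

lemma convergent_series_0: "convergent_series 0"
  by (rule convergent_series_finite_support[of 0]) simp

lemma convergent_series_1: "convergent_series 1"
  by (rule convergent_series_finite_support[of 0]) (auto simp: fps_one_nth)

lemma convergent_series_X: "convergent_series fps_X"
  by (rule convergent_series_finite_support[of 1]) (auto simp: fps_X_def)

lemma convergent_series_Y: "convergent_series (fps_const fps_X)"
  by (rule convergent_series_finite_support[of 1]) (auto simp: fps_X_def fps_const_def)

typedef cps = "{F. convergent_series F}"
  morphisms series_of cps_of
  using convergent_series_0 by blast

setup_lifting type_definition_cps

instantiation cps :: idom
begin

lift_definition zero_cps :: cps is 0 by (rule convergent_series_0)
lift_definition one_cps :: cps is 1 by (rule convergent_series_1)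
lift_definition plus_cps :: "cps \<Rightarrow> cps \<Rightarrow> cps" is "(+)" by (rule convergent_series_add)
lift_definition uminus_cps :: "cps \<Rightarrow> cps" is uminus by (rule convergent_series_uminus)
lift_definition minus_cps :: "cps \<Rightarrow> cps \<Rightarrow> cps" is "(-)"
  by (metis convergent_series_add convergent_series_uminus diff_conv_add_uminus)
lift_definition times_cps :: "cps \<Rightarrow> cps \<Rightarrow> cps" is "(*)" by (rule convergent_series_mult)

instance
proof
  fix a b c :: cps
  show "a * b * c = a * (b * c)" by transfer (simp add: mult.assoc)
  show "a * b = b * a" by transfer (simp add: mult.commute)
  show "1 * a = a" by transfer simp
  show "a + b + c = a + (b + c)" by transfer (simp add: add.assoc)
  show "a + b = b + a" by transfer (simp add: add.commute)
  show "0 + a = a" by transfer simp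
  show "- a + a = 0" by transfer simp
  show "a - b = a + - b" by transfer simp
  show "(a + b) * c = a * c + b * c" by transfer (simp add: distrib_right)
  show "a * (b + c) = a * b + a * c" by transfer (simp add: distrib_left)
  show "0 * a = 0" by transfer simp
  show "a * 0 = 0" by transfer simp
  show "(0 :: cps) \<noteq> 1" by transfer simp
  show "a * b \<noteq> 0" if "a \<noteq> 0" "b \<noteq> 0"
    using that by transfer simp
qed

end

instantiation cps :: idom_divide
begin

definition divide_cps :: "cps \<Rightarrow> cps \<Rightarrow> cps" where
  "divide_cps f g = (if g \<noteq> 0 \<and> g dvd f then THE h. f = h * g else 0)"

instance
proof
  fix a b :: cps
  show "a div 0 = 0" by (simp add: divide_cps_def)
  show "a * b div b = a" if "b \<noteq> 0"
    using that by (simp add: divide_cps_def)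
qed

end

lift_definition cps_coeff :: "cps \<Rightarrow> nat \<Rightarrow> nat \<Rightarrow> complex" is "\<lambda>F i j. F $ i $ j" .

lift_definition cps_X :: cps is fps_X by (rule convergent_series_X)
lift_definition cps_Y :: cps is "fps_const fps_X" by (rule convergent_series_Y)

interpretation ideal: module "(*) :: cps \<Rightarrow> cps \<Rightarrow> cps"
  by unfold_locales (simp_all add: algebra_simps)


section \<open>Infinitely near points\<close>

text \<open>
  Coordinates \<open>x, y\<close> at \<open>O\<close> are fixed. The first neighbourhood of a point with local coordinates
  \<open>x, y\<close> is the projective line of tangent directions: \<open>Slope c\<close> is the direction \<open>y = c x\<close>, and
  the coordinates at this point are \<open>x\<close> and \<open>y / x - c\<close>; \<open>Vertical\<close> is the direction \<open>x = 0\<close>, with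
  coordinates \<open>x / y\<close> and \<open>y\<close>. A point infinitely near to \<open>O\<close> is determined by the successive
  directions, nearest to \<open>O\<close> first, and \<open>[]\<close> is \<open>O\<close> itself.
\<close>

datatype direction = Slope complex | Vertical

type_synonym point = "direction list"

text \<open>
  The pull-backs \<open>f(x, x (y + c)) = \<Sum>m. x^m (\<Sum>j\<le>m. f_{m-j,j} (y + c)^j)\<close> and
  \<open>f(x y, y) = \<Sum>m. x^m (y^m \<Sum>j. f_{m,j} y^j)\<close>.
\<close>

fun pullback_series :: "direction \<Rightarrow> complex fps fps \<Rightarrow> complex fps fps" where
  "pullback_series (Slope c) F =
     Abs_fps (\<lambda>m. \<Sum>j\<le>m. fps_const (F $ (m - j) $ j) * (fps_X + fps_const c) ^ j)"
| "pullback_series Vertical F = Abs_fps (\<lambda>m. fps_X ^ m * F $ m)"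

lemma norm_linear_power_nth_le:
  "norm (((fps_X + fps_const c) ^ j :: complex fps) $ n) \<le> (1 + norm c) ^ j"
proof (induction j arbitrary: n)
  case 0
  then show ?case by (simp add: fps_one_nth)
next
  case (Suc j)
  let ?L = "fps_X + fps_const c :: complex fps"
  have "(?L ^ Suc j) $ n = (if n = 0 then 0 else (?L ^ j) $ (n - 1)) + c * (?L ^ j) $ n"
    by (simp add: distrib_right)
  also have "norm \<dots> \<le> (1 + norm c) ^ j + norm c * (1 + norm c) ^ j"
    using Suc.IH[of n] Suc.IH[of "n - 1"]
    by (intro order_trans[OF norm_triangle_ineq] add_mono)
       (auto simp: norm_mult intro: mult_left_mono)
  finally show ?case by (simp add: algebra_simps)
qed

lemma convergent_series_pullback:
  assumes "convergent_series F"
  shows "convergent_series (pullback_series d F)"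
proof -
  obtain C R where F: "C \<ge> 0" "R \<ge> 1" "\<And>i j. norm (F $ i $ j) \<le> C * R ^ (i + j)"
    using convergent_seriesE[OF assms] by metis
  show ?thesis
  proof (cases d)
    case (Slope c)
    define U where "U = 1 + norm c"
    have U: "U \<ge> 1" by (simp add: U_def)
    show ?thesis
    proof (rule convergent_seriesI[of "2 * R * U" _ C])
      fix m n
      have "pullback_series d F $ m $ n
          = (\<Sum>j\<le>m. F $ (m - j) $ j * ((fps_X + fps_const c) ^ j) $ n)"
        by (simp add: Slope fps_sum_nth)
      also have "norm \<dots> \<le> (\<Sum>j\<le>m. C * R ^ m * U ^ m)"
      proof (rule sum_norm_le)
        fix j assume j: "j \<in> {..m}"
        have "norm (F $ (m - j) $ j * ((fps_X + fps_const c) ^ j) $ n) \<le> (C * R ^ m) * U ^ j"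
          unfolding norm_mult using j F(1,2) F(3)[of "m - j" j] norm_linear_power_nth_le
          by (intro mult_mono) (auto simp: U_def)
        also have "\<dots> \<le> (C * R ^ m) * U ^ m"
          using j F U by (intro mult_left_mono power_increasing) auto
        finally show "norm (F $ (m - j) $ j * ((fps_X + fps_const c) ^ j) $ n)
            \<le> C * R ^ m * U ^ m" .
      qed
      also have "\<dots> = real (Suc m) * (C * (R * U) ^ m)" by (simp add: power_mult_distrib)
      also have "\<dots> \<le> 2 ^ m * (C * (R * U) ^ m)"
        using F U Suc_le_power2 by (intro mult_right_mono) auto
      also have "\<dots> = C * (2 * R * U) ^ m" by (simp add: power_mult_distrib)
      also have "\<dots> \<le> C * (2 * R * U) ^ (m + n)"
      proof (intro mult_left_mono power_increasing F(1))
        show "1 \<le> 2 * R * U" using F(2) U mult_mono[of 1 "2 * R" 1 U] by simp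
      qed simp
      finally show "norm (pullback_series d F $ m $ n) \<le> C * (2 * R * U) ^ (m + n)" .
    next
      show "1 \<le> 2 * R * U" using F(2) U mult_mono[of 1 "2 * R" 1 U] by simp
    qed
  next
    case Vertical
    show ?thesis
    proof (rule convergent_seriesI[of R _ C])
      fix m n
      show "norm (pullback_series d F $ m $ n) \<le> C * R ^ (m + n)"
      proof (cases "n < m")
        case True
        then show ?thesis using F by (simp add: Vertical fps_X_power_mult_nth)
      next
        case False
        then have "norm (pullback_series d F $ m $ n) \<le> C * R ^ n"
          using F(3)[of m "n - m"] by (simp add: Vertical fps_X_power_mult_nth)
        also have "\<dots> \<le> C * R ^ (m + n)"
          using F by (intro mult_left_mono power_increasing) auto
        finally show ?thesis .
      qed
    qed (use F in auto)
  qed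
qed

lift_definition pullback :: "direction \<Rightarrow> cps \<Rightarrow> cps" is pullback_series
  by (rule convergent_series_pullback)

fun exceptional :: "direction \<Rightarrow> cps" where
  "exceptional (Slope c) = cps_X"
| "exceptional Vertical = cps_Y"

text \<open>The multiplicity at \<open>O\<close> of a nonzero series (a junk value at \<open>0\<close>).\<close>

definition multiplicity_O :: "cps \<Rightarrow> nat" where
  "multiplicity_O f = (LEAST n. \<exists>i j. i + j = n \<and> cps_coeff f i j \<noteq> 0)"

fun strict_transform :: "cps \<Rightarrow> point \<Rightarrow> cps" where
  "strict_transform f [] = f"
| "strict_transform f (d # p) =
     strict_transform (pullback d f div exceptional d ^ multiplicity_O f) p"

definition mult_at :: "cps \<Rightarrow> point \<Rightarrow> nat" where
  "mult_at f p = multiplicity_O (strict_transform f p)"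

text \<open>
  \<open>proximate q p\<close> means that \<open>q\<close> is proximate to \<open>p\<close>: for \<open>q = p @ d # s\<close>, the germ at \<open>p @ [d]\<close>
  of the exceptional divisor of \<open>p\<close> has its strict transform passing through \<open>q\<close>.
\<close>

definition proximate :: "point \<Rightarrow> point \<Rightarrow> bool" where
  "proximate q p \<longleftrightarrow> (\<exists>d s. q = p @ d # s \<and> mult_at (exceptional d) s > 0)"

definition free_point :: "point \<Rightarrow> bool" where
  "free_point q \<longleftrightarrow> card {p. proximate q p} = 1"

definition satellite_point :: "point \<Rightarrow> bool" where
  "satellite_point q \<longleftrightarrow> card {p. proximate q p} = 2"

text \<open>The recursion \<open>v_p = e_p + \<Sum> v_q\<close>, over the points \<open>q\<close> to which \<open>p\<close> is proximate.\<close>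

function value_of :: "(point \<Rightarrow> int) \<Rightarrow> point \<Rightarrow> int" where
  "value_of e p = e p + (\<Sum>q\<in>{q. proximate p q}. value_of e q)"
  by auto
termination
  by (relation "measure (\<lambda>(e, p). length p)") (auto simp: proximate_def)

declare value_of.simps [simp del]

abbreviation value_at :: "cps \<Rightarrow> point \<Rightarrow> int" where
  "value_at f \<equiv> value_of (\<lambda>q. int (mult_at f q))"

definition is_cluster :: "point set \<Rightarrow> bool" where
  "is_cluster K \<longleftrightarrow> finite K \<and> (\<forall>q\<in>K. \<forall>p. prefix p q \<longrightarrow> p \<in> K)"


section \<open>Singular points and base points\<close>

text \<open>The singular points of the germ \<open>f = 0\<close>, which is assumed to be reduced.\<close>

definition singular_points :: "cps \<Rightarrow> point set" where
  "singular_points f =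
     {p. mult_at f p > 0 \<and>
         (mult_at f p > 1 \<or> satellite_point p \<or>
          (\<exists>q. strict_prefix p q \<and> satellite_point q \<and> mult_at f q > 0))}"

text \<open>
  An equation of the reduced germ of \<open>f = 0\<close>: the same irreducible factors, each of them with
  exponent one. It is unique up to a unit.
\<close>

definition reduced_equation :: "cps \<Rightarrow> cps" where
  "reduced_equation f = (SOME h. squarefree h \<and> (\<forall>p. irreducible p \<longrightarrow> (p dvd h \<longleftrightarrow> p dvd f)))"

text \<open>A greatest common divisor in the ring of convergent series, unique up to a unit.\<close>

definition gcd_of :: "cps set \<Rightarrow> cps" where
  "gcd_of A = (SOME g. (\<forall>a\<in>A. g dvd a) \<and> (\<forall>d. (\<forall>a\<in>A. d dvd a) \<longrightarrow> d dvd g))"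

definition ideal_mult_O :: "cps set \<Rightarrow> nat" where
  "ideal_mult_O A = Inf (multiplicity_O ` (A - {0}))"

fun ideal_transform :: "cps set \<Rightarrow> point \<Rightarrow> cps set" where
  "ideal_transform A [] = A"
| "ideal_transform A (d # p) =
     ideal_transform
       (ideal.span ((\<lambda>f. pullback d f div exceptional d ^ ideal_mult_O A) ` A)) p"

definition ideal_mult_at :: "cps set \<Rightarrow> point \<Rightarrow> nat" where
  "ideal_mult_at A p = ideal_mult_O (ideal_transform A p)"

text \<open>
  The points of \<open>BP(A)\<close>, and the virtual values corresponding to its virtual multiplicities
  \<open>ideal_mult_at A\<close>. The ideal \<open>A\<close> being a set of generators of itself, \<open>gcd_of A\<close> is the greatest
  common divisor of any set of generators of \<open>A\<close>.
\<close>

definition BP_points :: "cps set \<Rightarrow> point set" where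
  "BP_points A =
     {p. 0 < ideal_mult_at A p \<and> ideal_mult_at A p \<noteq> mult_at (gcd_of A) p}
     \<union> singular_points (reduced_equation (gcd_of A))"

definition BP_value :: "cps set \<Rightarrow> point \<Rightarrow> int" where
  "BP_value A = value_of (\<lambda>p. int (ideal_mult_at A p))"


section \<open>The procedure\<close>

definition common_factor :: "cps list \<Rightarrow> cps" where
  "common_factor as = gcd_of (set as)"

definition cofactors :: "cps list \<Rightarrow> cps list" where
  "cofactors as = map (\<lambda>a. a div common_factor as) as"

definition min_value :: "cps list \<Rightarrow> point \<Rightarrow> int" where
  "min_value fs p = Min ((\<lambda>f. value_at f p) ` set fs)"

definition step2_points :: "cps list \<Rightarrow> point set" where
  "step2_points as = singular_points (reduced_equation (common_factor as * prod_list (cofactors as)))"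

text \<open>
  Since every point, old or new, is weighted by \<^const>\<open>min_value\<close>, adjoining points until there
  are none left yields the least set closed under the rule of adjunction.
\<close>

inductive_set adjoin_free :: "cps list \<Rightarrow> point set \<Rightarrow> point set"
  for fs :: "cps list" and K :: "point set" where
  old: "p \<in> K \<Longrightarrow> p \<in> adjoin_free fs K"
| new: "p \<in> adjoin_free fs K \<Longrightarrow> free_point q \<Longrightarrow> proximate q p \<Longrightarrow>
        (\<And>f. f \<in> set fs \<Longrightarrow> value_at f p = min_value fs p \<Longrightarrow> mult_at f q > 0) \<Longrightarrow>
        q \<in> adjoin_free fs K"

inductive_set adjoin_satellite :: "cps list \<Rightarrow> point set \<Rightarrow> point set"
  for fs :: "cps list" and K :: "point set" where
  old: "p \<in> K \<Longrightarrow> p \<in> adjoin_satellite fs K"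
| new: "p \<in> adjoin_satellite fs K \<Longrightarrow> p' \<in> adjoin_satellite fs K \<Longrightarrow> p \<noteq> p' \<Longrightarrow>
        satellite_point q \<Longrightarrow> proximate q p \<Longrightarrow> proximate q p' \<Longrightarrow>
        (\<And>f. f \<in> set fs \<Longrightarrow> value_at f p > min_value fs p \<or> value_at f p' > min_value fs p') \<Longrightarrow>
        q \<in> adjoin_satellite fs K"

definition step3_points :: "cps list \<Rightarrow> point set" where
  "step3_points as = adjoin_free (cofactors as) (step2_points as)"

definition step4_points :: "cps list \<Rightarrow> point set" where
  "step4_points as = adjoin_satellite (cofactors as) (step3_points as)"

definition step5_points :: "cps list \<Rightarrow> point set" where
  "step5_points as = {p \<in> step4_points as.
     min_value (cofactors as) p - (\<Sum>q\<in>{q. proximate p q}. min_value (cofactors as) q) \<noteq> 0}"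

definition step7_points :: "cps list \<Rightarrow> point set" where
  "step7_points as = {p \<in> step2_points as. p \<in> singular_points (reduced_equation (common_factor as))}"

definition procedure_points :: "cps list \<Rightarrow> point set" where
  "procedure_points as = step5_points as \<union> step7_points as"

definition procedure_value :: "cps list \<Rightarrow> point \<Rightarrow> int" where
  "procedure_value as p = min_value (cofactors as) p + value_at (common_factor as) p"

end

theory Submission
  imports Defs "HOL-Computational_Algebra.Polynomial_FPS"
begin

text \<open>
  The values in the procedure have a direct meaning: the value of \<open>f\<close> at \<open>p\<close> is the multiplicity
  at \<open>p\<close> of the total transform of \<open>f\<close>, which is the strict transform times a monomial in the
  germs at \<open>p\<close> of the exceptional divisors. The same holds for the transforms of an ideal, and
  the multiplicity of an ideal is the least among those of its generators. Hence the values
  attached to the multiplicities of an ideal are the least values of its generators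
  (\<open>ideal_value\<close>), and the multiplicity at \<open>q\<close> is positive exactly if every generator has a
  value at \<open>q\<close> larger than the sum of the least values at the points to which \<open>q\<close> is proximate
  (\<open>ideal_mult_at_pos_iff\<close>). As multiplicities are determined by values, the multiplicity of \<open>\<aa>
  = (g) \<aa>'\<close> is the sum of those of \<open>g\<close> and \<open>\<aa>'\<close>. So the theorem amounts to this: the procedure
  does not miss a base point of \<open>\<aa>'\<close>, and it stops.

  No base point is missed, by induction along \<open>p \<le> q\<close> (\<open>base_point_in_step4\<close>). The criterion
  above is the rule of adjunction, with two exceptions. At a satellite base point \<open>q\<close> some \<open>f\<^sub>i\<close>
  may have the least value at both points to which \<open>q\<close> is proximate; then \<open>q\<close> lies on \<open>f\<^sub>i = 0\<close>,
  so it is a singular point of the reduced product and was there from the start. The procedure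
  tests no free point \<open>q\<close> that follows a point \<open>p\<close> adjoined by the satellite rule; but such a
  \<open>p\<close> lies on no \<open>f\<^sub>i = 0\<close>, hence no value changes from \<open>p\<close> to \<open>q\<close>, and \<open>q\<close> is not a base point.
  At \<open>O\<close> the claim holds because the \<open>f\<^sub>i\<close> are non-units without common factor, which forces two
  branches through \<open>O\<close>.

  The procedure stops because it adjoins base points only (\<open>step4_points_subset\<close>), and because
  base points and singular points are finite in number. An ideal without common factor has
  finite colength; if its multiplicity \<open>e\<close> is positive, division of pull-backs by the \<open>e\<close>-th
  power of the exceptional divisor maps the elements of order at least \<open>e\<close>, which do not include
  \<open>1\<close>, onto the local ring at a point of the first neighbourhood modulo the transformed ideal.
  So the colength drops (\<open>blow_up_ideal_colength\<close>), whence \<open>finite_base_points\<close>. The same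
  induction, for the Jacobian ideal \<open>(f, f\<^sub>x, f\<^sub>y)\<close> of a reduced \<open>f\<close>, whose transform is
  contained in the Jacobian ideal of the strict transform, shows that \<open>f = 0\<close> has finitely many
  multiple points. Satellite points on \<open>f = 0\<close> are then finite in number too: each is proximate
  to a multiple point that it does not immediately follow, and an exceptional divisor and a
  strict transform have finitely many common points.

  All this presupposes that greatest common divisors and reduced equations exist, that is, that
  the ring of convergent series is factorial. The proof given here avoids preparation theorems:
  an ideal \<open>M\<close> such that \<open>x h \<in> M\<close> implies \<open>h \<in> M\<close> is principal (\<open>saturated_ideal_principal\<close>),
  and the generator of \<open>{h. \<exists>n. x\<^sup>n h \<in> I}\<close> is, up to a power of \<open>x\<close>, the greatest common
  divisor of \<open>I\<close>.
\<close>

unbundle fps_syntax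

text \<open>
  As a module over itself, \<^typ>\<open>cps\<close> has an associative law that is oriented against
  \<open>mult.assoc\<close>.
\<close>

declare ideal.scale_scale [simp del]

section \<open>Coefficients\<close>

lemma cps_eqI: "(\<And>i j. cps_coeff f i j = cps_coeff g i j) \<Longrightarrow> f = g"
  by transfer (auto simp: fps_eq_iff)

lemma cps_coeff_0 [simp]: "cps_coeff 0 i j = 0"
  by transfer simp

lemma cps_coeff_1: "cps_coeff 1 i j = (if i = 0 \<and> j = 0 then 1 else 0)"
  by transfer (simp add: fps_one_nth)

lemma cps_coeff_add [simp]: "cps_coeff (f + g) i j = cps_coeff f i j + cps_coeff g i j"
  by transfer simp

lemma cps_coeff_diff [simp]: "cps_coeff (f - g) i j = cps_coeff f i j - cps_coeff g i j"
  by transfer simp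

lemma cps_coeff_mult:
  "cps_coeff (f * g) i j = (\<Sum>a\<le>i. \<Sum>b\<le>j. cps_coeff f a b * cps_coeff g (i - a) (j - b))"
  by transfer (simp add: fps_mult_nth fps_sum_nth atLeast0AtMost)

lemma cps_coeff_X: "cps_coeff cps_X i j = (if i = 1 \<and> j = 0 then 1 else 0)"
  by transfer (simp add: fps_X_def)

lemma cps_coeff_Y: "cps_coeff cps_Y i j = (if i = 0 \<and> j = 1 then 1 else 0)"
  by transfer (auto simp: fps_X_def)

lemma series_of_simps [simp]:
  "series_of 0 = 0" "series_of 1 = 1" "series_of (f + g) = series_of f + series_of g"
  "series_of (f - g) = series_of f - series_of g" "series_of (f * g) = series_of f * series_of g"
  "series_of (- f) = - series_of f" "series_of cps_X = fps_X" "series_of cps_Y = fps_const fps_X"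
  by (simp_all add: zero_cps.rep_eq one_cps.rep_eq plus_cps.rep_eq minus_cps.rep_eq
      times_cps.rep_eq uminus_cps.rep_eq cps_X.rep_eq cps_Y.rep_eq)

lemma series_of_power [simp]: "series_of (f ^ n) = series_of f ^ n"
  by (induction n) auto

lemma series_of_eq_0_iff [simp]: "series_of f = 0 \<longleftrightarrow> f = 0"
  by (metis series_of_inject series_of_simps(1))

lemma convergent_series_of [simp]: "convergent_series (series_of f)"
  using series_of by blast

lemma cps_X_neq_0 [simp]: "cps_X \<noteq> 0" and cps_Y_neq_0 [simp]: "cps_Y \<noteq> 0"
  by (metis cps_coeff_0 cps_coeff_X zero_neq_one) (metis cps_coeff_0 cps_coeff_Y zero_neq_one)

lift_definition cps_const :: "complex \<Rightarrow> cps" is "\<lambda>c. fps_const (fps_const c)"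
  by (rule convergent_series_finite_support[of 0]) (auto simp: fps_const_def)

section \<open>Convergence of quotients\<close>

lemma convergent_series_shift:
  assumes "convergent_series F"
  shows "convergent_series (fps_shift k F)"
proof -
  obtain C R where 1: "C \<ge> 0" "R \<ge> 1" "\<And>i j. norm (F $ i $ j) \<le> C * R ^ (i + j)"
    using convergent_seriesE[OF assms] by metis
  show ?thesis
  proof (rule convergent_seriesI[OF 1(2), of _ "C * R ^ k"])
    fix i j show "norm (fps_shift k F $ i $ j) \<le> C * R ^ k * R ^ (i + j)"
      using 1(3)[of "i + k" j] by (simp add: power_add ac_simps)
  qed
qed

lemma geometric_sum_le:
  fixes r :: real
  assumes "0 \<le> r" "r \<le> 1 / 2"
  shows "(\<Sum>k\<le>n. r ^ k) \<le> 2"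
proof -
  have "(\<Sum>k\<le>n. r ^ k) \<le> (\<Sum>k\<le>n. (1 / 2) ^ k)"
    using assms by (intro sum_mono power_mono) auto
  also have "\<dots> = 2 - (1 / 2) ^ n" by (induction n) (auto simp: field_simps)
  finally show ?thesis by (smt (verit) zero_le_power divide_nonneg_nonneg)
qed

lemma sum_power_Suc_le:
  fixes r :: real
  assumes "0 \<le> r" "r \<le> 1 / 2"
  shows "(\<Sum>k=1..n. r ^ k) \<le> 2 * r"
proof (cases n)
  case (Suc m)
  have "(\<Sum>k=1..n. r ^ k) = r * (\<Sum>k\<le>m. r ^ k)"
    unfolding Suc sum_distrib_left
    by (intro sum.reindex_bij_witness[of _ Suc "\<lambda>k. k - 1"])
       (auto simp flip: power_Suc)
  also have "\<dots> \<le> r * 2" using geometric_sum_le assms by (intro mult_left_mono) auto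
  finally show ?thesis by simp
qed (use assms in auto)

text \<open>
  Let \<open>n\<close> be the order of \<open>G(0, y)\<close>. The coefficient of \<open>x^i y^(j + n)\<close> in \<open>Q G\<close> expresses that
  of \<open>x^i y^j\<close> in \<open>Q\<close> by lexicographically earlier ones. This recursion preserves a bound \<open>D S^i
  T^j\<close> if \<open>T\<close> is large compared to the rate \<open>R\<close> of the given series, and \<open>S\<close> is large compared
  to \<open>T\<close>: the earlier coefficients include some with a larger exponent of \<open>y\<close>, but only with a
  smaller one of \<open>x\<close>.
\<close>

lemma convergent_quotient_aux:
  fixes Q G :: "complex fps fps"
  assumes "convergent_series (Q * G)" "convergent_series G" "G $ 0 \<noteq> 0"
  shows "convergent_series Q"
proof -
  define n where "n = subdegree (G $ 0)"
  define b where "b = G $ 0 $ n"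
  have b: "b \<noteq> 0" using assms(3) by (simp add: b_def n_def)
  have low: "G $ 0 $ k = 0" if "k < n" for k using that by (auto simp: n_def)
  obtain C1 R1 where 1: "C1 \<ge> 0" "R1 \<ge> 1" "\<And>i j. norm ((Q * G) $ i $ j) \<le> C1 * R1 ^ (i + j)"
    using convergent_seriesE[OF assms(1)] by metis
  obtain C2 R2 where 2: "C2 \<ge> 0" "R2 \<ge> 1" "\<And>i j. norm (G $ i $ j) \<le> C2 * R2 ^ (i + j)"
    using convergent_seriesE[OF assms(2)] by metis
  define R where "R = max R1 R2"
  define K where "K = max C1 C2 / norm b"
  have R: "R \<ge> 1" using 1 by (simp add: R_def)
  have K: "K \<ge> 0" using 1 by (simp add: K_def)
  have bound: "C * R' ^ m / norm b \<le> K * R ^ m"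
    if "C \<le> max C1 C2" "0 \<le> C" "0 \<le> R'" "R' \<le> R" for C R' m
  proof -
    have "C * R' ^ m \<le> max C1 C2 * R ^ m" using that by (intro mult_mono power_mono) auto
    then show ?thesis by (simp add: K_def divide_right_mono)
  qed
  have M: "norm ((Q * G) $ i $ j) / norm b \<le> K * R ^ (i + j)" for i j
    using divide_right_mono[OF 1(3)[of i j], of "norm b"] bound[of C1 R1 "i + j"] 1(1,2)
    by (simp add: R_def)
  have G: "norm (G $ i $ j) / norm b \<le> K * R ^ (i + j)" for i j
    using divide_right_mono[OF 2(3)[of i j], of "norm b"] bound[of C2 R2 "i + j"] 2(1,2)
    by (simp add: R_def)
  define T where "T = max (2 * R) (8 * K * R ^ (n + 1))"
  define S where "S = max T (16 * K * T ^ n * R)"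
  define D where "D = 2 * K * R ^ n"
  have T: "T \<ge> 2 * R" "T \<ge> 8 * K * R ^ (n + 1)" by (auto simp: T_def)
  have S: "S \<ge> T" "S \<ge> 16 * K * T ^ n * R" by (auto simp: S_def)
  have pos: "T > 0" "S > 0" "D \<ge> 0" using T S R K by (auto simp: D_def)
  \<comment> \<open>The two rates leave room for the two kinds of remaining terms: those with
      \<open>a = 0\<close> and \<open>b > n\<close>, and those with \<open>a \<ge> 1\<close>.\<close>
  have rT: "0 \<le> R / T" "R / T \<le> 1 / 2" and rS: "0 \<le> R / S" "R / S \<le> 1 / 2"
    using T S R pos by (auto simp: field_simps)
  have t1: "K * R ^ n * (2 * (R / T)) \<le> 1 / 4" using T pos by (simp add: field_simps)
  have t2: "K * T ^ n * (2 * (R / S)) * 2 \<le> 1 / 4" using S pos by (simp add: field_simps)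
  have "\<forall>j. norm (Q $ i $ j) \<le> D * S ^ i * T ^ j" for i
  proof (induction i rule: less_induct)
    case (less i)
    show ?case
    proof
      fix j show "norm (Q $ i $ j) \<le> D * S ^ i * T ^ j"
      proof (induction j rule: less_induct)
        case less': (less j)
        define g where "g = (\<lambda>a b. G $ a $ b * Q $ (i - a) $ (j + n - b))"
        define E where "E = D * S ^ i * T ^ j"
        have E: "E \<ge> 0" using pos by (simp add: E_def)
        have "(Q * G) $ i $ (j + n) = (\<Sum>a\<le>i. \<Sum>b\<le>j + n. g a b)"
          unfolding mult.commute[of Q]
          by (simp add: fps_mult_nth fps_sum_nth atLeast0AtMost g_def)
        also have "\<dots> = (\<Sum>b\<le>j + n. g 0 b) + (\<Sum>a=1..i. \<Sum>b\<le>j + n. g a b)"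
          by (simp add: atMost_atLeast0 sum.atLeast_Suc_atMost)
        also have "(\<Sum>b\<le>j + n. g 0 b) = (\<Sum>b\<in>{n..j + n}. g 0 b)"
          by (rule sum.mono_neutral_right) (auto simp: g_def low)
        also have "\<dots> = b * Q $ i $ j + (\<Sum>b=Suc n..j + n. g 0 b)"
          by (simp add: sum.atLeast_Suc_atMost g_def b_def)
        also have "(\<Sum>b=Suc n..j + n. g 0 b) = (\<Sum>k=1..j. g 0 (k + n))"
          by (intro sum.reindex_bij_witness[of _ "\<lambda>k. k + n" "\<lambda>k. k - n"]) auto
        finally have eq: "b * Q $ i $ j = (Q * G) $ i $ (j + n) - (\<Sum>k=1..j. g 0 (k + n))
            - (\<Sum>a=1..i. \<Sum>b\<le>j + n. g a b)" by simp
        have A: "norm (g 0 (k + n)) / norm b \<le> E * K * R ^ n * (R / T) ^ k" if "k \<in> {1..j}" for k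
        proof -
          have "norm (g 0 (k + n)) / norm b = norm (G $ 0 $ (k + n)) / norm b * norm (Q $ i $ (j - k))"
            by (simp add: g_def norm_mult)
          also have "\<dots> \<le> (K * R ^ (k + n)) * (D * S ^ i * T ^ (j - k))"
            using that G[of 0 "k + n"] less'[of "j - k"] K R by (intro mult_mono) auto
          also have "T ^ (j - k) = T ^ j / T ^ k"
            using that pos by (simp add: power_diff)
          finally show ?thesis by (simp add: E_def power_add power_divide ac_simps)
        qed
        have B: "norm (g a b') / norm b \<le> E * K * T ^ n * ((R / S) ^ a * (R / T) ^ b')"
          if "a \<in> {1..i}" "b' \<le> j + n" for a b'
        proof -
          have "norm (g a b') / norm b = norm (G $ a $ b') / norm b * norm (Q $ (i - a) $ (j + n - b'))"
            by (simp add: g_def norm_mult)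
          also have "\<dots> \<le> (K * R ^ (a + b')) * (D * S ^ (i - a) * T ^ (j + n - b'))"
            using that G[of a b'] less[of "i - a"] K R by (intro mult_mono) auto
          also have "T ^ (j + n - b') = T ^ j * T ^ n / T ^ b'"
            using that pos by (simp add: power_diff power_add)
          also have "S ^ (i - a) = S ^ i / S ^ a"
            using that pos by (simp add: power_diff)
          finally show ?thesis by (simp add: E_def power_add power_divide ac_simps)
        qed
        have "norm (Q $ i $ j) = norm (b * Q $ i $ j) / norm b" using b by (simp add: norm_mult)
        also have "\<dots> \<le> (norm ((Q * G) $ i $ (j + n)) + (\<Sum>k=1..j. norm (g 0 (k + n)))
            + (\<Sum>a=1..i. \<Sum>b\<le>j + n. norm (g a b))) / norm b"
          unfolding eq
          by (intro divide_right_mono order_trans[OF norm_triangle_ineq4] add_mono order_refl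
              sum_norm_le norm_sum) auto
        also have "\<dots> = norm ((Q * G) $ i $ (j + n)) / norm b + (\<Sum>k=1..j. norm (g 0 (k + n)) / norm b)
            + (\<Sum>a=1..i. \<Sum>b'\<le>j + n. norm (g a b') / norm b)"
          by (simp add: add_divide_distrib sum_divide_distrib)
        also have "\<dots> \<le> E / 2 + E / 4 + E / 4"
        proof (intro add_mono)
          have "norm ((Q * G) $ i $ (j + n)) / norm b \<le> K * R ^ (i + (j + n))" by (rule M)
          also have "\<dots> = K * R ^ n * (R ^ i * R ^ j)" by (simp add: power_add)
          also have "\<dots> \<le> K * R ^ n * (S ^ i * T ^ j)"
            using K R T S pos by (intro mult_left_mono mult_mono power_mono) auto
          finally show "norm ((Q * G) $ i $ (j + n)) / norm b \<le> E / 2" by (simp add: E_def D_def)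
        next
          have "(\<Sum>k=1..j. norm (g 0 (k + n)) / norm b) \<le> (\<Sum>k=1..j. E * K * R ^ n * (R / T) ^ k)"
            by (intro sum_mono A)
          also have "\<dots> = E * K * R ^ n * (\<Sum>k=1..j. (R / T) ^ k)" by (simp add: sum_distrib_left)
          also have "\<dots> \<le> E * K * R ^ n * (2 * (R / T))"
            using E K R sum_power_Suc_le[OF rT] by (intro mult_left_mono) auto
          also have "\<dots> = E * (K * R ^ n * (2 * (R / T)))" by (simp add: ac_simps)
          also have "\<dots> \<le> E * (1 / 4)" using E t1 by (intro mult_left_mono) auto
          finally show "(\<Sum>k=1..j. norm (g 0 (k + n)) / norm b) \<le> E / 4" by simp
        next
          have "(\<Sum>a=1..i. \<Sum>b'\<le>j + n. norm (g a b') / norm b)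
              \<le> (\<Sum>a=1..i. \<Sum>b'\<le>j + n. E * K * T ^ n * ((R / S) ^ a * (R / T) ^ b'))"
            by (intro sum_mono B) auto
          also have "\<dots> = E * K * T ^ n * ((\<Sum>a=1..i. (R / S) ^ a) * (\<Sum>b'\<le>j + n. (R / T) ^ b'))"
            unfolding sum_product by (simp only: sum_distrib_left)
          also have "\<dots> \<le> E * K * T ^ n * ((2 * (R / S)) * 2)"
            using E K pos sum_power_Suc_le[OF rS] geometric_sum_le[OF rT] rS rT
            by (intro mult_left_mono mult_mono) (auto intro: sum_nonneg)
          also have "\<dots> = E * (K * T ^ n * (2 * (R / S)) * 2)" by (simp add: ac_simps)
          also have "\<dots> \<le> E * (1 / 4)" using E t2 by (intro mult_left_mono) auto
          finally show "(\<Sum>a=1..i. \<Sum>b'\<le>j + n. norm (g a b') / norm b) \<le> E / 4" by simp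
        qed
        finally show ?case by (simp add: E_def)
      qed
    qed
  qed
  note bnd = this
  show ?thesis
  proof (rule convergent_seriesI[of S _ D])
    show "S \<ge> 1" using S T R by linarith
    fix i j
    have "norm (Q $ i $ j) \<le> D * S ^ i * T ^ j" using bnd by blast
    also have "\<dots> \<le> D * S ^ i * S ^ j"
      using pos S by (intro mult_left_mono power_mono) auto
    finally show "norm (Q $ i $ j) \<le> D * S ^ (i + j)" by (simp add: power_add ac_simps)
  qed
qed

text \<open>With this, divisibility and invertibility of convergent series are questions on formal series.\<close>

lemma convergent_quotient:
  fixes Q G :: "complex fps fps"
  assumes "convergent_series (Q * G)" "convergent_series G" "G \<noteq> 0"
  shows "convergent_series Q"
proof -
  define k where "k = subdegree G"
  define H where "H = fps_shift k G"
  have G: "G = H * fps_X ^ k" by (simp add: H_def k_def subdegree_decompose[symmetric])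
  have "Q * G = Q * H * fps_X ^ k" by (simp add: G mult.assoc)
  then have "fps_shift k (Q * G) = Q * H" by (simp add: fps_eq_iff fps_X_power_mult_right_nth)
  moreover have "H $ 0 \<noteq> 0" using assms(3) by (simp add: H_def k_def)
  ultimately show ?thesis
    using convergent_quotient_aux[of Q H] convergent_series_shift[of _ k] assms
    unfolding H_def by metis
qed

section \<open>Homogeneous parts and multiplicity\<close>

text \<open>
  Since \<open>f(x, t x) = \<Sum>m. x^m (forms f $ m)(t)\<close>, these are the homogeneous parts of \<open>f\<close> in the
  variable \<open>t = y / x\<close>; polynomials in \<open>t\<close> rather than series, in order to be expanded at any
  slope.
\<close>

definition forms :: "cps \<Rightarrow> complex poly fps" where
  "forms f = Abs_fps (\<lambda>m. \<Sum>j\<le>m. monom (cps_coeff f (m - j) j) j)"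

lemma coeff_forms: "coeff (forms f $ m) j = (if j \<le> m then cps_coeff f (m - j) j else 0)"
  by (simp add: forms_def coeff_sum if_distrib[of "\<lambda>x. x = _"] cong: if_cong)

lemma degree_forms_le: "degree (forms f $ m) \<le> m"
  by (rule degree_le) (auto simp: coeff_forms)

lemma forms_0 [simp]: "forms 0 = 0"
  and forms_add: "forms (f + g) = forms f + forms g"
  and forms_diff: "forms (f - g) = forms f - forms g"
  by (simp_all add: fps_eq_iff poly_eq_iff coeff_forms)

lemma forms_1 [simp]: "forms 1 = 1"
  by (auto simp: fps_eq_iff poly_eq_iff coeff_forms fps_one_nth cps_coeff_1)

lemma forms_mult: "forms (f * g) = forms f * forms g"
proof (intro fps_ext poly_eqI)
  fix m j
  define F where "F = (\<lambda>i a. cps_coeff f i a * cps_coeff g (m - j - i) (j - a))"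
  have "coeff ((forms f * forms g) $ m) j
      = (\<Sum>k\<le>m. \<Sum>a\<le>j. coeff (forms f $ k) a * coeff (forms g $ (m - k)) (j - a))"
    by (simp add: fps_mult_nth coeff_sum coeff_mult atLeast0AtMost)
  also have "\<dots> = (\<Sum>a\<le>j. \<Sum>k\<le>m. coeff (forms f $ k) a * coeff (forms g $ (m - k)) (j - a))"
    by (rule sum.swap)
  also have "\<dots> = (if j \<le> m then \<Sum>a\<le>j. \<Sum>i\<le>m - j. F i a else 0)"
  proof (cases "j \<le> m")
    case True
    have "(\<Sum>k\<le>m. coeff (forms f $ k) a * coeff (forms g $ (m - k)) (j - a)) = (\<Sum>i\<le>m - j. F i a)"
      if a: "a \<le> j" for a
    proof -
      have "(\<Sum>k\<le>m. coeff (forms f $ k) a * coeff (forms g $ (m - k)) (j - a))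
          = (\<Sum>k\<in>{a..m - j + a}. coeff (forms f $ k) a * coeff (forms g $ (m - k)) (j - a))"
        using a True by (intro sum.mono_neutral_right) (auto simp: coeff_forms)
      also have "\<dots> = (\<Sum>i\<le>m - j. F i a)"
        using a True
        by (intro sum.reindex_bij_witness[of _ "\<lambda>i. i + a" "\<lambda>k. k - a"])
           (auto simp: coeff_forms F_def intro!: arg_cong2[of _ _ _ _ "cps_coeff g"])
      finally show ?thesis .
    qed
    then show ?thesis using True by simp
  next
    case False
    have "(\<Sum>a\<le>j. \<Sum>k\<le>m. coeff (forms f $ k) a * coeff (forms g $ (m - k)) (j - a)) = 0"
      using False by (intro sum.neutral ballI) (auto simp: coeff_forms)
    then show ?thesis using False by simp
  qed
  also have "\<dots> = coeff (forms (f * g) $ m) j"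
    by (auto simp: coeff_forms cps_coeff_mult F_def intro: sum.swap)
  finally show "coeff (forms (f * g) $ m) j = coeff ((forms f * forms g) $ m) j" ..
qed

lemma forms_nth_eq_0_iff: "forms f $ m = 0 \<longleftrightarrow> (\<forall>i j. i + j = m \<longrightarrow> cps_coeff f i j = 0)"
  by (auto simp: poly_eq_iff coeff_forms) (metis le_add2 diff_add_inverse2)

lemma forms_eq_0_iff [simp]: "forms f = 0 \<longleftrightarrow> f = 0"
proof
  assume "forms f = 0"
  then have "cps_coeff f i j = 0" for i j
    using forms_nth_eq_0_iff[of f "i + j"] by simp
  then show "f = 0" by (intro cps_eqI) simp
qed simp

lemma multiplicity_O_conv_forms: "f \<noteq> 0 \<Longrightarrow> multiplicity_O f = subdegree (forms f)"
  unfolding multiplicity_O_def subdegree_def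
  by (simp add: forms_nth_eq_0_iff)

lemma multiplicity_O_mult:
  "f \<noteq> 0 \<Longrightarrow> g \<noteq> 0 \<Longrightarrow> multiplicity_O (f * g) = multiplicity_O f + multiplicity_O g"
  by (simp add: multiplicity_O_conv_forms forms_mult)

lemma multiplicity_O_1 [simp]: "multiplicity_O 1 = 0"
  by (simp add: multiplicity_O_conv_forms)

lemma multiplicity_O_power: "f \<noteq> 0 \<Longrightarrow> multiplicity_O (f ^ n) = n * multiplicity_O f"
  by (induction n) (auto simp: multiplicity_O_mult)

lemma multiplicity_O_prod:
  "finite A \<Longrightarrow> (\<And>a. a \<in> A \<Longrightarrow> f a \<noteq> 0) \<Longrightarrow>
     multiplicity_O (prod f A) = (\<Sum>a\<in>A. multiplicity_O (f a))"
  by (induction A rule: finite_induct) (auto simp: multiplicity_O_mult)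

lemma multiplicity_O_dvd_le: "f dvd g \<Longrightarrow> g \<noteq> 0 \<Longrightarrow> multiplicity_O f \<le> multiplicity_O g"
  by (elim dvdE) (auto simp: multiplicity_O_mult)

lemma multiplicity_O_eq_0_iff: "f \<noteq> 0 \<Longrightarrow> multiplicity_O f = 0 \<longleftrightarrow> cps_coeff f 0 0 \<noteq> 0"
  by (auto simp: multiplicity_O_conv_forms subdegree_eq_0_iff forms_nth_eq_0_iff)

lemma multiplicity_O_X [simp]: "multiplicity_O cps_X = 1"
  unfolding multiplicity_O_def by (rule Least_equality) (auto simp: cps_coeff_X split: if_splits)

lemma multiplicity_O_Y [simp]: "multiplicity_O cps_Y = 1"
  unfolding multiplicity_O_def by (rule Least_equality) (auto simp: cps_coeff_Y split: if_splits)

text \<open>Multiplicity at least \<open>e\<close>, in a form that covers \<open>f = 0\<close> and defines an ideal.\<close>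

definition order_ge :: "nat \<Rightarrow> cps \<Rightarrow> bool" where
  "order_ge e f \<longleftrightarrow> (\<forall>i j. i + j < e \<longrightarrow> cps_coeff f i j = 0)"

lemma order_ge_conv_forms: "order_ge e f \<longleftrightarrow> (\<forall>m<e. forms f $ m = 0)"
  by (auto simp: order_ge_def forms_nth_eq_0_iff)

lemma order_ge_iff: "f \<noteq> 0 \<Longrightarrow> order_ge e f \<longleftrightarrow> e \<le> multiplicity_O f"
  unfolding order_ge_conv_forms multiplicity_O_conv_forms
  by (metis forms_eq_0_iff nth_less_subdegree_zero order_less_le_trans subdegree_geI
      not_le nth_subdegree_nonzero)

lemma order_ge_multiplicity: "order_ge (multiplicity_O f) f"
  by (cases "f = 0") (auto simp: order_ge_iff, simp add: order_ge_def)

lemma order_ge_0 [simp]: "order_ge e 0" and order_ge_zero [simp]: "order_ge 0 f"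
  by (simp_all add: order_ge_def)

lemma order_ge_add: "order_ge e f \<Longrightarrow> order_ge e g \<Longrightarrow> order_ge e (f + g)"
  by (simp add: order_ge_def)

lemma order_ge_mult: "order_ge d f \<Longrightarrow> order_ge e g \<Longrightarrow> order_ge (d + e) (f * g)"
  by (cases "f = 0"; cases "g = 0") (auto simp: order_ge_iff multiplicity_O_mult)

lemma subspace_order_ge: "ideal.subspace {f. order_ge e f}"
  unfolding ideal.subspace_def using order_ge_mult[of 0] by (auto simp: order_ge_add)

instance cps :: algebraic_semidom ..

lemma is_unit_iff_coeff: "is_unit (f :: cps) \<longleftrightarrow> cps_coeff f 0 0 \<noteq> 0"
proof
  assume "is_unit f"
  then obtain g where "1 = f * g" by (auto elim: dvdE)
  then have "cps_coeff f 0 0 * cps_coeff g 0 0 = 1"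
    by (metis (no_types, lifting) atMost_0 cps_coeff_1 cps_coeff_mult diff_zero sum.empty finite.emptyI sum.insert
        empty_iff add_0_right)
  then show "cps_coeff f 0 0 \<noteq> 0" by auto
next
  assume f: "cps_coeff f 0 0 \<noteq> 0"
  let ?F = "series_of f"
  have F: "?F $ 0 $ 0 \<noteq> 0" using f by transfer
  define Q where "Q = fps_left_inverse ?F (inverse (?F $ 0))"
  have Q: "Q * ?F = 1"
    unfolding Q_def by (rule fps_left_inverse) (use F in \<open>simp add: inverse_mult_eq_1\<close>)
  then have "convergent_series Q"
    using F by (intro convergent_quotient[of Q ?F]) (auto simp: convergent_series_1)
  then have "series_of (cps_of Q * f) = series_of 1"
    using Q by (simp add: cps_of_inverse)
  then have "cps_of Q * f = 1" by (simp only: series_of_inject)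
  then show "is_unit f" by (metis dvdI mult.commute)
qed

lemma is_unit_iff_multiplicity: "is_unit (f :: cps) \<longleftrightarrow> f \<noteq> 0 \<and> multiplicity_O f = 0"
  by (cases "f = 0") (simp_all add: is_unit_iff_coeff multiplicity_O_eq_0_iff)

section \<open>Restriction to the line x = 0\<close>

definition at_x0 :: "cps \<Rightarrow> complex fps" where
  "at_x0 f = series_of f $ 0"

lemma at_x0_nth: "at_x0 f $ j = cps_coeff f 0 j"
  unfolding at_x0_def by transfer simp

lemma at_x0_simps [simp]:
  "at_x0 0 = 0" "at_x0 1 = 1" "at_x0 (f + g) = at_x0 f + at_x0 g" "at_x0 (f - g) = at_x0 f - at_x0 g"
  "at_x0 (f * g) = at_x0 f * at_x0 g" "at_x0 cps_X = 0" "at_x0 cps_Y = fps_X"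
  by (simp_all add: at_x0_def)

lemma at_x0_power [simp]: "at_x0 (f ^ n) = at_x0 f ^ n"
  by (induction n) auto

lemma at_x0_sum: "at_x0 (sum f A) = (\<Sum>a\<in>A. at_x0 (f a))"
  by (induction A rule: infinite_finite_induct) auto

lemma at_x0_const [simp]: "at_x0 (cps_const c) = fps_const c"
  by (simp add: at_x0_def cps_const.rep_eq)

lemma X_power_dvd_iff: "cps_X ^ k dvd f \<longleftrightarrow> (\<forall>i<k. series_of f $ i = 0)"
proof
  assume "cps_X ^ k dvd f"
  then show "\<forall>i<k. series_of f $ i = 0" by (auto elim!: dvdE simp: fps_X_power_mult_nth)
next
  assume *: "\<forall>i<k. series_of f $ i = 0"
  let ?q = "cps_of (fps_shift k (series_of f))"
  have "series_of f = series_of (cps_X ^ k * ?q)"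
    using * by (auto simp: fps_eq_iff fps_X_power_mult_nth cps_of_inverse convergent_series_shift)
  then show "cps_X ^ k dvd f" by (simp only: series_of_inject dvdI)
qed

lemma X_dvd_iff: "cps_X dvd f \<longleftrightarrow> at_x0 f = 0"
  using X_power_dvd_iff[of 1 f] by (simp add: at_x0_def)

lemma not_is_unit_X [simp]: "\<not> is_unit cps_X"
  by (simp add: is_unit_iff_multiplicity)

lemma X_prime: "cps_X dvd f * g \<Longrightarrow> cps_X dvd f \<or> cps_X dvd g"
  by (simp add: X_dvd_iff)

lemma X_power_cancel:
  assumes "d dvd cps_X ^ n * f" "\<not> cps_X dvd d"
  shows "d dvd f"
  using assms(1)
proof (induction n)
  case (Suc n)
  then obtain t where t: "cps_X ^ Suc n * f = d * t" by (auto elim: dvdE)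
  then have "cps_X dvd d * t" by (metis dvd_triv_left power_Suc mult.assoc)
  from X_prime[OF this] obtain s where "t = cps_X * s" using assms(2) by (auto elim: dvdE)
  then have "cps_X * (cps_X ^ n * f) = cps_X * (d * s)" using t by (simp add: ac_simps)
  then have "cps_X ^ n * f = d * s" by simp
  then show ?case using Suc.IH by simp
qed simp

lemma split_off_X_power:
  assumes "f \<noteq> 0"
  obtains k g where "f = cps_X ^ k * g" "\<not> cps_X dvd g"
proof -
  define k where "k = subdegree (series_of f)"
  have "cps_X ^ k dvd f" unfolding X_power_dvd_iff by (auto simp: k_def)
  then obtain g where g: "f = cps_X ^ k * g" by (auto elim: dvdE)
  have "\<not> cps_X ^ Suc k dvd f" unfolding X_power_dvd_iff k_def using assms by auto
  then have "\<not> cps_X dvd g" unfolding g by (metis mult_dvd_mono dvd_refl power_Suc2)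
  with g that show thesis by blast
qed

text \<open>
  The quotient is a series in \<open>y\<close> alone: it becomes one coefficient of a series in \<open>x\<close> when the
  division is iterated on the remainder \<open>r\<close>.
\<close>

lemma divide_by_order:
  assumes g: "at_x0 g \<noteq> 0" and f: "at_x0 f = 0 \<or> subdegree (at_x0 g) \<le> subdegree (at_x0 f)"
  obtains c q r where "f = q * g + cps_X * r" "series_of q = fps_const c"
proof -
  have "at_x0 g dvd at_x0 f" using assms by (cases "at_x0 f = 0") (auto simp: fps_dvd_iff)
  then obtain c where c: "at_x0 f = c * at_x0 g" by (metis dvdE mult.commute)
  have conv: "convergent_series (fps_const (at_x0 h))" for h
  proof -
    obtain C R where 1: "C \<ge> 0" "R \<ge> 1" "\<And>i j. norm (series_of h $ i $ j) \<le> C * R ^ (i + j)"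
      using convergent_seriesE[OF convergent_series_of] by metis
    have "norm (fps_const (at_x0 h) $ i $ j) \<le> C * R ^ (i + j)" for i j
      using 1(1,2) 1(3)[of 0 j] by (simp add: at_x0_def)
    then show ?thesis by (rule convergent_seriesI[OF 1(2)])
  qed
  have "convergent_series (fps_const c * fps_const (at_x0 g))"
    using conv[of f] by (simp only: c fps_const_mult)
  then have "convergent_series (fps_const c)"
    using conv[of g] by (rule convergent_quotient) (simp add: g)
  then have q: "series_of (cps_of (fps_const c)) = fps_const c" by (simp add: cps_of_inverse)
  have "at_x0 (f - cps_of (fps_const c) * g) = 0"
    using c by (simp add: at_x0_def q)
  then obtain r where "f - cps_of (fps_const c) * g = cps_X * r" unfolding X_dvd_iff[symmetric] by (auto elim: dvdE)
  then have "f = cps_of (fps_const c) * g + cps_X * r" by (simp add: algebra_simps)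
  with q show thesis using that by blast
qed

section \<open>Greatest common divisors\<close>

lemma subspaceD:
  assumes "ideal.subspace M"
  shows "0 \<in> M" "f \<in> M \<Longrightarrow> g \<in> M \<Longrightarrow> f + g \<in> M" "f \<in> M \<Longrightarrow> g \<in> M \<Longrightarrow> f - g \<in> M"
    "f \<in> M \<Longrightarrow> c * f \<in> M" "f \<in> M \<Longrightarrow> f * c \<in> M"
  using assms ideal.subspace_diff[OF assms] unfolding ideal.subspace_def by (auto simp: mult.commute)

text \<open>
  The generator is an \<open>m\<close> for which \<open>m(0, y)\<close> has the least order. Dividing \<open>f \<in> M\<close> by \<open>m\<close>
  leaves \<open>x r\<close>, where \<open>r\<close> lies again in \<open>M\<close> and can be divided further. The successive quotients
  are the coefficients of a formal series \<open>Q\<close> with \<open>f = Q m\<close>, and \<open>Q\<close> converges.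
\<close>

lemma saturated_ideal_principal:
  assumes M: "ideal.subspace M" and sat: "\<And>h. cps_X * h \<in> M \<Longrightarrow> h \<in> M"
    and nz: "\<exists>f\<in>M. f \<noteq> 0"
  obtains m where "m \<in> M" "\<And>f. f \<in> M \<Longrightarrow> m dvd f"
proof -
  note M' = subspaceD[OF M]
  have sat': "h \<in> M" if "cps_X ^ k * h \<in> M" for k h
    using that
  proof (induction k)
    case (Suc k)
    have "cps_X * (cps_X ^ k * h) \<in> M" using Suc.prems by (simp only: power_Suc mult.assoc)
    then show ?case by (rule Suc.IH[OF sat])
  qed simp
  obtain f0 where "f0 \<in> M" "f0 \<noteq> 0" using nz by blast
  then obtain k g where "f0 = cps_X ^ k * g" "\<not> cps_X dvd g" using split_off_X_power by blast
  then have "g \<in> M \<and> at_x0 g \<noteq> 0" using sat' \<open>f0 \<in> M\<close> X_dvd_iff by blast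
  then obtain m where m: "m \<in> M" "at_x0 m \<noteq> 0"
    and least: "\<And>f. f \<in> M \<Longrightarrow> at_x0 f \<noteq> 0 \<Longrightarrow> subdegree (at_x0 m) \<le> subdegree (at_x0 f)"
    using ex_has_least_nat[of "\<lambda>f. f \<in> M \<and> at_x0 f \<noteq> 0" g "\<lambda>f. subdegree (at_x0 f)"] by blast
  have "\<forall>f. \<exists>q r c. f \<in> M \<longrightarrow> r \<in> M \<and> f = q * m + cps_X * r \<and> series_of q = fps_const c"
  proof
    fix f show "\<exists>q r c. f \<in> M \<longrightarrow> r \<in> M \<and> f = q * m + cps_X * r \<and> series_of q = fps_const c"
    proof (cases "f \<in> M")
      case True
      obtain c q r where *: "f = q * m + cps_X * r" "series_of q = fps_const c"
        using divide_by_order[OF m(2), of f] least[OF True] by blast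
      have "cps_X * r = f - q * m" using *(1) by simp
      then have "cps_X * r \<in> M" using True m(1) M' by simp
      then show ?thesis using * sat by blast
    qed auto
  qed
  then obtain q r c where qr: "\<And>f. f \<in> M \<Longrightarrow>
      r f \<in> M \<and> f = q f * m + cps_X * r f \<and> series_of (q f) = fps_const (c f)"
    by metis
  \<comment> \<open>The formal quotient of \<open>f\<close> by \<open>m\<close>, coefficient by coefficient.\<close>
  define Q where "Q = (\<lambda>f. Abs_fps (\<lambda>k. c ((r ^^ k) f)))"
  have Q: "Q f = fps_const (c f) + fps_X * Q (r f)" for f
  proof (rule fps_ext)
    fix k show "Q f $ k = (fps_const (c f) + fps_X * Q (r f)) $ k"
      by (cases k) (simp_all add: Q_def funpow_Suc_right del: funpow.simps(2))
  qed
  have zero: "(series_of f - Q f * series_of m) $ k = 0" if "f \<in> M" for f k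
    using that
  proof (induction k arbitrary: f rule: less_induct)
    case (less k)
    have "series_of f = fps_const (c f) * series_of m + fps_X * series_of (r f)"
    proof -
      have *: "f = q f * m + cps_X * r f" "series_of (q f) = fps_const (c f)"
        using qr[OF less.prems] by auto
      show ?thesis by (subst *(1)) (simp only: series_of_simps *(2))
    qed
    then have "series_of f - Q f * series_of m = fps_X * (series_of (r f) - Q (r f) * series_of m)"
      by (subst Q) (simp add: algebra_simps)
    then show ?case using less.IH[of "k - 1" "r f"] qr[OF less.prems] by (cases k) auto
  qed
  show thesis
  proof
    show "m \<in> M" by fact
    fix f assume "f \<in> M"
    then have "series_of f = Q f * series_of m"
      using zero by (metis fps_ext right_minus_eq fps_zero_nth)
    moreover have "series_of m \<noteq> 0" using m by (auto simp: at_x0_def)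
    ultimately have "convergent_series (Q f)"
      using convergent_quotient[of "Q f" "series_of m"] by (metis convergent_series_of)
    then have "series_of f = series_of (m * cps_of (Q f))"
      using \<open>series_of f = _\<close> by (simp add: cps_of_inverse mult.commute)
    then show "m dvd f" by (simp only: series_of_inject dvdI)
  qed
qed

text \<open>The ideal quotient \<open>(M : x^\<infinity>)\<close>.\<close>

definition saturation :: "cps set \<Rightarrow> cps set" where
  "saturation M = {h. \<exists>n. cps_X ^ n * h \<in> M}"

lemma subset_saturation: "M \<subseteq> saturation M"
  unfolding saturation_def by (auto intro: exI[of _ 0])

lemma subspace_saturation:
  assumes "ideal.subspace M"
  shows "ideal.subspace (saturation M)"
  unfolding ideal.subspace_def
proof (intro conjI ballI allI)
  note M = subspaceD[OF assms]
  show "0 \<in> saturation M" using M(1) by (auto simp: saturation_def)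
  fix f assume "f \<in> saturation M"
  then obtain m where f: "cps_X ^ m * f \<in> M" by (auto simp: saturation_def)
  show "c * f \<in> saturation M" for c
  proof -
    have "cps_X ^ m * (c * f) \<in> M" using M(4)[OF f, of c] by (simp add: mult.left_commute)
    then show ?thesis unfolding saturation_def by blast
  qed
  fix g assume "g \<in> saturation M"
  then obtain n where g: "cps_X ^ n * g \<in> M" by (auto simp: saturation_def)
  have "cps_X ^ (m + n) * (f + g) = cps_X ^ n * (cps_X ^ m * f) + cps_X ^ m * (cps_X ^ n * g)"
    by (simp add: power_add algebra_simps)
  then show "f + g \<in> saturation M"
    using M(2)[OF M(4)[OF f] M(4)[OF g]] unfolding saturation_def by (auto intro: exI[of _ "m + n"])
qed

text \<open>
  The saturated ideal \<open>saturation M\<close> is generated by one of its elements \<open>m\<close>; if \<open>x\<close> divided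
  \<open>m\<close>, then \<open>m / x\<close> would lie in the saturation as well and \<open>m\<close> would divide it.
\<close>

lemma saturation_principal:
  assumes "ideal.subspace M" "\<exists>f\<in>M. f \<noteq> 0"
  obtains m n where "cps_X ^ n * m \<in> M" "\<not> cps_X dvd m" "\<And>f. f \<in> M \<Longrightarrow> m dvd f"
proof -
  have sat: "h \<in> saturation M" if "cps_X * h \<in> saturation M" for h
  proof -
    from that obtain n where "cps_X ^ n * (cps_X * h) \<in> M" by (auto simp: saturation_def)
    then have "cps_X ^ Suc n * h \<in> M" by (simp add: ac_simps)
    then show ?thesis unfolding saturation_def by blast
  qed
  obtain m where m: "m \<in> saturation M" "\<And>f. f \<in> saturation M \<Longrightarrow> m dvd f"
    using saturated_ideal_principal[OF subspace_saturation[OF assms(1)] sat]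
      assms(2) subset_saturation[of M] by (metis subsetD)
  have "m \<noteq> 0" using m(2) subset_saturation assms(2) by fastforce
  have "\<not> cps_X dvd m"
  proof
    assume "cps_X dvd m"
    then obtain m' where m': "m = cps_X * m'" by (auto elim: dvdE)
    then have "m dvd m'" using m sat by blast
    then have "m' * cps_X dvd m' * 1" using m' by (simp add: ac_simps)
    moreover have "m' \<noteq> 0" using \<open>m \<noteq> 0\<close> m' by auto
    ultimately have "is_unit cps_X" using dvd_times_left_cancel_iff by blast
    then show False by simp
  qed
  moreover obtain n where "cps_X ^ n * m \<in> M" using m(1) by (auto simp: saturation_def)
  ultimately show thesis using that m(2) subset_saturation by blast
qed

lemma dvd_span:
  assumes "\<And>a. a \<in> A \<Longrightarrow> d dvd a" "f \<in> ideal.span A"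
  shows "d dvd (f :: cps)"
  using assms(2)
  by (induction rule: ideal.span_induct_alt) (use assms(1) in auto)

text \<open>
  The generator \<open>m\<close> of the saturation of the ideal spanned by \<open>A\<close> is the part prime to \<open>x\<close> of
  the greatest common divisor: a common divisor of \<open>A\<close> divides some \<open>x^n m\<close>. The power of \<open>x\<close> is
  found separately.
\<close>

lemma gcd_exists:
  "\<exists>g. (\<forall>a\<in>A. g dvd a) \<and> (\<forall>d. (\<forall>a\<in>A. d dvd a) \<longrightarrow> d dvd (g :: cps))"
proof (cases "A \<subseteq> {0}")
  case True
  then show ?thesis by (intro exI[of _ 0]) auto
next
  case False
  then obtain a0 where a0: "a0 \<in> A" "a0 \<noteq> 0" by blast
  then have nz: "\<exists>f\<in>ideal.span A. f \<noteq> 0" using ideal.span_base by blast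
  obtain m n where m: "cps_X ^ n * m \<in> ideal.span A" "\<not> cps_X dvd m"
      "\<And>f. f \<in> ideal.span A \<Longrightarrow> m dvd f"
    using saturation_principal[OF ideal.subspace_span nz] by metis
  define P where "P = (\<lambda>k. \<forall>a\<in>A. cps_X ^ k dvd a)"
  have bound: "k \<le> multiplicity_O a0" if "P k" for k
  proof -
    have "cps_X ^ k dvd a0" using that a0 by (auto simp: P_def)
    from multiplicity_O_dvd_le[OF this a0(2)] show ?thesis by (simp add: multiplicity_O_power)
  qed
  have "P 0" by (simp add: P_def)
  define k where "k = Greatest P"
  have k: "P k" "\<And>j. P j \<Longrightarrow> j \<le> k"
    unfolding k_def using GreatestI_nat[of P 0] Greatest_le_nat[of P] bound \<open>P 0\<close> by blast+
  show ?thesis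
  proof (intro exI[of _ "cps_X ^ k * m"] conjI ballI allI impI)
    fix a assume a: "a \<in> A"
    then obtain b where b: "a = m * b" using m(3) ideal.span_base by (metis dvdE)
    have "cps_X ^ k dvd b"
    proof (cases "b = 0")
      case False
      then obtain j c where c: "b = cps_X ^ j * c" "\<not> cps_X dvd c" using split_off_X_power by blast
      have "cps_X ^ k dvd cps_X ^ j * (m * c)"
        using k(1) a b c unfolding P_def by (metis mult.left_commute)
      moreover have "at_x0 (m * c) \<noteq> 0" using m(2) c(2) by (simp add: X_dvd_iff)
      ultimately have "k \<le> j"
        unfolding X_power_dvd_iff
        by (metis at_x0_def cancel_comm_monoid_add_class.diff_cancel fps_X_power_mult_nth
            linorder_not_less series_of_power series_of_simps(5,7) less_irrefl)
      then show ?thesis unfolding c(1) by (simp add: le_imp_power_dvd)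
    qed simp
    then show "cps_X ^ k * m dvd a" unfolding b by (metis mult.commute mult_dvd_mono dvd_refl)
  next
    fix d assume d: "\<forall>a\<in>A. d dvd a"
    then have "d \<noteq> 0" using a0 by auto
    then obtain j e where e: "d = cps_X ^ j * e" "\<not> cps_X dvd e" using split_off_X_power by blast
    have "P j" using d unfolding P_def e(1) by (metis dvd_mult_left)
    have "d dvd cps_X ^ n * m" using dvd_span[of A d] d m(1) by blast
    then have "e dvd cps_X ^ n * m" unfolding e(1) using dvd_mult_right by blast
    then have "e dvd m" using X_power_cancel e(2) by blast
    then show "d dvd cps_X ^ k * m"
      unfolding e(1) using k(2)[OF \<open>P j\<close>] by (intro mult_dvd_mono le_imp_power_dvd)
  qed
qed

lemma gcd_of_dvd: "a \<in> A \<Longrightarrow> gcd_of A dvd a"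
  and dvd_gcd_of: "(\<And>a. a \<in> A \<Longrightarrow> d dvd a) \<Longrightarrow> d dvd gcd_of A"
  using someI_ex[OF gcd_exists[of A]] unfolding gcd_of_def by blast+

definition no_common_factor :: "cps set \<Rightarrow> bool" where
  "no_common_factor A \<longleftrightarrow> (\<forall>d. (\<forall>a\<in>A. d dvd a) \<longrightarrow> is_unit d)"

lemma no_common_factor_mono: "no_common_factor A \<Longrightarrow> A \<subseteq> B \<Longrightarrow> no_common_factor B"
  unfolding no_common_factor_def by blast

lemma no_common_factor_nonzero: "no_common_factor A \<Longrightarrow> \<exists>f\<in>A. f \<noteq> 0"
  unfolding no_common_factor_def using dvd_0_right not_is_unit_X by metis

text \<open>
  A case of the Nullstellensatz: the saturation contains \<open>1\<close>, since its generator is a common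
  factor.
\<close>

lemma no_common_factor_X_power:
  assumes "ideal.subspace I" "no_common_factor I"
  obtains n where "cps_X ^ n \<in> I"
proof -
  obtain m n where m: "cps_X ^ n * m \<in> I" "\<And>f. f \<in> I \<Longrightarrow> m dvd f"
    using saturation_principal[OF assms(1) no_common_factor_nonzero[OF assms(2)]] by metis
  then have "is_unit m" using assms(2) by (auto simp: no_common_factor_def)
  then obtain u where "1 = m * u" by (auto elim: dvdE)
  then have "cps_X ^ n = cps_X ^ n * m * u" by (metis mult.assoc mult.right_neutral)
  also have "\<dots> \<in> I" using subspaceD(5)[OF assms(1) m(1)] .
  finally show thesis using that by blast
qed

section \<open>Unique factorization\<close>

text \<open>
  If \<open>p\<close> divides \<open>a b\<close>, the greatest common divisor of \<open>p b\<close> and \<open>a b\<close> is \<open>b c\<close> with \<open>c\<close>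
  dividing \<open>p\<close> and \<open>a\<close>; irreducibility leaves the cases that \<open>c\<close> is a unit or associated to \<open>p\<close>.
\<close>

lemma irreducible_imp_prime_elem_cps:
  assumes "irreducible (p :: cps)"
  shows "prime_elem p"
proof (rule prime_elemI)
  show "p \<noteq> 0" "\<not> p dvd 1" using assms by (auto simp: irreducible_def)
  fix a b assume ab: "p dvd a * b"
  let ?g = "gcd_of {p * b, a * b}"
  have "b dvd ?g" by (rule dvd_gcd_of) auto
  then obtain c where c: "?g = b * c" by (auto elim: dvdE)
  have "p dvd ?g" by (rule dvd_gcd_of) (use ab in auto)
  have g: "b * c dvd p * b" "b * c dvd a * b" unfolding c[symmetric] by (auto intro: gcd_of_dvd)
  show "p dvd a \<or> p dvd b"
  proof (cases "b = 0")
    case False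
    then have "c dvd p" "c dvd a" using g by (metis dvd_times_left_cancel_iff mult.commute)+
    then consider "is_unit c" | "p dvd c" using assms irreducibleD' by blast
    then show ?thesis
    proof cases
      case 1
      then show ?thesis using \<open>p dvd ?g\<close> by (simp add: c dvd_mult_unit_iff)
    next
      case 2
      then show ?thesis using \<open>c dvd a\<close> dvd_trans by blast
    qed
  qed simp
qed

instantiation cps :: normalization_semidom
begin

text \<open>
  There is no canonical choice among associated series, so a representative is chosen; for units
  it has to be \<open>1\<close>.
\<close>

definition normalize_cps :: "cps \<Rightarrow> cps" where
  "normalize_cps f = (if is_unit f then 1 else SOME h. f dvd h \<and> h dvd f)"

definition unit_factor_cps :: "cps \<Rightarrow> cps" where
  "unit_factor_cps f = f div normalize f"

instance
proof
  have ass: "f dvd normalize f \<and> normalize f dvd f" for f :: cps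
  proof (cases "is_unit f")
    case False
    have "f dvd f \<and> f dvd f" by simp
    from someI[of "\<lambda>h. f dvd h \<and> h dvd f", OF this] show ?thesis
      using False by (simp only: normalize_cps_def if_False)
  qed (simp add: normalize_cps_def)
  have n0: "normalize f = 0 \<longleftrightarrow> f = 0" for f :: cps
    using ass[of f] by auto
  fix f g :: cps
  show "normalize (0 :: cps) = 0" using n0 by simp
  show "unit_factor (0 :: cps) = 0" by (simp add: unit_factor_cps_def)
  show "unit_factor f * normalize f = f" using ass unfolding unit_factor_cps_def by simp
  show "unit_factor f = f" if "is_unit f" using that by (simp add: unit_factor_cps_def normalize_cps_def)
  show "is_unit (unit_factor f)" if "f \<noteq> 0"
    using that ass[of f] n0[of f] unfolding unit_factor_cps_def
    by (metis dvd_div_mult_self dvd_times_right_cancel_iff mult_1)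
  show "unit_factor (f * g) = f * unit_factor g" if "is_unit f"
  proof -
    have "normalize (f * g) = normalize g"
      using that by (simp add: normalize_cps_def is_unit_mult_iff mult_unit_dvd_iff' dvd_mult_unit_iff')
    then show ?thesis unfolding unit_factor_cps_def using ass[of g] by (simp add: div_mult_swap)
  qed
qed

end

instance cps :: factorial_semiring
proof
  fix f :: cps assume "f \<noteq> 0"
  then show "\<exists>A. (\<forall>x. x \<in># A \<longrightarrow> prime_elem x) \<and> normalize (prod_mset A) = normalize f"
  proof (induction "multiplicity_O f" arbitrary: f rule: less_induct)
    case less
    show ?case
    proof (cases "is_unit f \<or> irreducible f")
      case True
      then show ?thesis
      proof
        assume "is_unit f"
        then show ?thesis by (intro exI[of _ "{#}"]) (simp add: normalize_cps_def)
      next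
        assume "irreducible f"
        then show ?thesis
          by (intro exI[of _ "{#f#}"]) (simp add: irreducible_imp_prime_elem_cps)
      qed
    next
      case False
      then obtain a b where ab: "f = a * b" "\<not> is_unit a" "\<not> is_unit b"
        using less.prems by (auto simp: irreducible_def)
      then have nz: "a \<noteq> 0" "b \<noteq> 0" using less.prems by auto
      then have "multiplicity_O a < multiplicity_O f" "multiplicity_O b < multiplicity_O f"
        using ab by (auto simp: multiplicity_O_mult is_unit_iff_multiplicity)
      then obtain A B where "\<forall>x. x \<in># A \<longrightarrow> prime_elem x" "normalize (prod_mset A) = normalize a"
          "\<forall>x. x \<in># B \<longrightarrow> prime_elem x" "normalize (prod_mset B) = normalize b"
        using less.hyps nz by metis
      moreover from this have "normalize (prod_mset (A + B)) = normalize f"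
        unfolding ab(1) by (simp add: associated_iff_dvd mult_dvd_mono)
      ultimately show ?thesis by (intro exI[of _ "A + B"]) auto
    qed
  qed
qed

section \<open>Blowing up\<close>

lemma cps_const_0 [simp]: "cps_const 0 = 0"
  by transfer simp

lift_definition swap_xy :: "cps \<Rightarrow> cps" is "\<lambda>F. Abs_fps (\<lambda>i. Abs_fps (\<lambda>j. F $ j $ i))"
proof -
  fix F assume "convergent_series F"
  then obtain C R where 1: "R \<ge> 1" "\<And>i j. norm (F $ i $ j) \<le> C * R ^ (i + j)"
    using convergent_seriesE by metis
  have "norm (Abs_fps (\<lambda>i. Abs_fps (\<lambda>j. F $ j $ i)) $ i $ j) \<le> C * R ^ (i + j)" for i j
    using 1(2)[of j i] by (simp add: add.commute)
  then show "convergent_series (Abs_fps (\<lambda>i. Abs_fps (\<lambda>j. F $ j $ i)))"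
    by (rule convergent_seriesI[OF 1(1)])
qed

lemma cps_coeff_swap [simp]: "cps_coeff (swap_xy f) i j = cps_coeff f j i"
  by transfer simp

lemma swap_xy_simps [simp]:
  "swap_xy (swap_xy f) = f" "swap_xy 0 = 0" "swap_xy 1 = 1"
  "swap_xy (f + g) = swap_xy f + swap_xy g" "swap_xy (f - g) = swap_xy f - swap_xy g"
  "swap_xy cps_X = cps_Y" "swap_xy cps_Y = cps_X"
  by (auto intro!: cps_eqI simp: cps_coeff_1 cps_coeff_X cps_coeff_Y)

lemma swap_xy_mult [simp]: "swap_xy (f * g) = swap_xy f * swap_xy g"
  by (intro cps_eqI) (auto simp: cps_coeff_mult intro: sum.swap)

lemma swap_xy_power [simp]: "swap_xy (f ^ n) = swap_xy f ^ n"
  by (induction n) auto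

lemma swap_xy_eq_iff [simp]: "swap_xy f = swap_xy g \<longleftrightarrow> f = g"
  by (metis swap_xy_simps(1))

lemma multiplicity_O_swap [simp]: "multiplicity_O (swap_xy f) = multiplicity_O f"
  unfolding multiplicity_O_def cps_coeff_swap by (metis add.commute)

lemma order_ge_swap [simp]: "order_ge e (swap_xy f) \<longleftrightarrow> order_ge e f"
  unfolding order_ge_def cps_coeff_swap by (metis add.commute)

text \<open>
  The vertical direction is the direction of slope \<open>0\<close> after exchange of the coordinates.
\<close>

fun flip :: "direction \<Rightarrow> cps \<Rightarrow> cps" where
  "flip (Slope c) f = f"
| "flip Vertical f = swap_xy f"

fun slope_of :: "direction \<Rightarrow> complex" where
  "slope_of (Slope c) = c"
| "slope_of Vertical = 0"

lemma flip_simps [simp]: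
  "flip d (flip d f) = f" "flip d 0 = 0" "flip d 1 = 1" "flip d (f * g) = flip d f * flip d g"
  "flip d (f + g) = flip d f + flip d g" "flip d (f - g) = flip d f - flip d g"
  "flip d (f ^ n) = flip d f ^ n" "flip d f = flip d g \<longleftrightarrow> f = g"
  "multiplicity_O (flip d f) = multiplicity_O f" "order_ge e (flip d f) \<longleftrightarrow> order_ge e f"
  by (cases d; simp)+

lemma flip_eq_0_iff [simp]: "flip d f = 0 \<longleftrightarrow> f = 0"
  by (metis flip_simps(1,2))

lemma flip_dvd_iff [simp]: "flip d f dvd flip d g \<longleftrightarrow> f dvd g"
  unfolding dvd_def by (metis flip_simps(1,4))

lemma exceptional_conv_flip: "exceptional d = flip d cps_X"
  by (cases d) auto

text \<open>A polynomial in \<open>t = y / x\<close>, expanded in the coordinate \<open>t - c\<close> at the direction of slope \<open>c\<close>.\<close>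

definition affine_part :: "complex \<Rightarrow> complex poly \<Rightarrow> complex fps" where
  "affine_part c p = fps_of_poly (p \<circ>\<^sub>p [:c, 1:])"

lemma affine_part_simps [simp]:
  "affine_part c 0 = 0" "affine_part c 1 = 1" "affine_part c (p + q) = affine_part c p + affine_part c q"
  "affine_part c (p - q) = affine_part c p - affine_part c q"
  "affine_part c (p * q) = affine_part c p * affine_part c q"
  by (simp_all add: affine_part_def pcompose_1 pcompose_add pcompose_diff pcompose_mult fps_of_poly_add
      fps_of_poly_diff fps_of_poly_mult)

lemma affine_part_sum: "affine_part c (sum f A) = (\<Sum>a\<in>A. affine_part c (f a))"
  by (induction A rule: infinite_finite_induct) auto

lemma affine_part_monom: "affine_part c (monom a n) = fps_const a * (fps_X + fps_const c) ^ n"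
proof -
  have "monom a n \<circ>\<^sub>p [:c, 1:] = smult a ([:c, 1:] ^ n)"
    by (induction n) (auto simp: monom_0 monom_Suc pcompose_pCons)
  then show ?thesis
    by (simp add: affine_part_def fps_of_poly_smult fps_of_poly_power fps_of_poly_linear)
qed

lemma affine_part_eq_0_iff [simp]: "affine_part c p = 0 \<longleftrightarrow> p = 0"
proof
  assume "affine_part c p = 0"
  then have "p \<circ>\<^sub>p [:c, 1:] = 0"
    unfolding affine_part_def by (metis fps_of_poly_0 fps_of_poly_eq_iff)
  then show "p = 0" by (rule pcompose_eq_0) simp
qed simp

lemma affine_part_nth_0: "affine_part c p $ 0 = poly p c"
  unfolding affine_part_def by (simp add: poly_0_coeff_0[symmetric] poly_pcompose)

lemma subdegree_affine_part_le:
  assumes "p \<noteq> 0"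
  shows "subdegree (affine_part c p) \<le> degree p"
proof -
  have "p \<circ>\<^sub>p [:c, 1:] \<noteq> 0" using assms affine_part_eq_0_iff[of c p] by (auto simp: affine_part_def)
  moreover have "degree (p \<circ>\<^sub>p [:c, 1:]) = degree p" by (simp add: degree_pcompose)
  ultimately have "affine_part c p $ degree p \<noteq> 0"
    unfolding affine_part_def by (metis fps_of_poly_nth leading_coeff_0_iff)
  then show ?thesis by (rule subdegree_leI)
qed

lemma series_of_pullback_Slope:
  "series_of (pullback (Slope c) f) $ m = affine_part c (forms f $ m)"
  by (simp add: pullback.rep_eq forms_def affine_part_sum affine_part_monom cps_coeff.rep_eq)

lemma pullback_conv_flip: "pullback d f = flip d (pullback (Slope (slope_of d)) (flip d f))"
proof (cases d)
  case Vertical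
  have S: "cps_coeff (pullback (Slope 0) g) m n = (if n \<le> m then cps_coeff g (m - n) n else 0)" for g m n
    by (simp add: cps_coeff.rep_eq[of "pullback (Slope 0) g"] series_of_pullback_Slope affine_part_def
        coeff_forms pcompose_idR flip: One_nat_def)
  have V: "cps_coeff (pullback Vertical f) m n = (if m \<le> n then cps_coeff f m (n - m) else 0)" for m n
    by (simp add: cps_coeff.rep_eq pullback.rep_eq fps_X_power_mult_nth)
  show ?thesis unfolding Vertical by (intro cps_eqI) (simp add: S V)
qed simp

lemma pullback_Slope_hom:
  "pullback (Slope c) 0 = 0" "pullback (Slope c) 1 = 1"
  "pullback (Slope c) (f + g) = pullback (Slope c) f + pullback (Slope c) g"
  "pullback (Slope c) (f - g) = pullback (Slope c) f - pullback (Slope c) g"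
  "pullback (Slope c) (f * g) = pullback (Slope c) f * pullback (Slope c) g"
  unfolding series_of_inject[symmetric]
  by (rule fps_ext, simp add: series_of_pullback_Slope forms_add forms_diff forms_mult
      fps_mult_nth affine_part_sum fps_one_nth)+

lemma pullback_hom [simp]:
  "pullback d 0 = 0" "pullback d 1 = 1" "pullback d (f + g) = pullback d f + pullback d g"
  "pullback d (f - g) = pullback d f - pullback d g" "pullback d (f * g) = pullback d f * pullback d g"
  unfolding pullback_conv_flip[of d] by (simp_all add: pullback_Slope_hom)

lemma pullback_power [simp]: "pullback d (f ^ n) = pullback d f ^ n"
  by (induction n) auto

lemma pullback_prod: "pullback d (prod f A) = (\<Prod>a\<in>A. pullback d (f a))"
  by (induction A rule: infinite_finite_induct) auto

lemma pullback_eq_0_iff [simp]: "pullback d f = 0 \<longleftrightarrow> f = 0"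
proof -
  have "f = 0" if "pullback (Slope c) f = 0" for c f
  proof -
    have "forms f $ m = 0" for m
      using that series_of_pullback_Slope[of c f m] by simp
    then have "forms f = 0" by (intro fps_ext) simp
    then show ?thesis by simp
  qed
  from this[of "slope_of d" "flip d f"] show ?thesis
    unfolding pullback_conv_flip[of d] by (auto simp: pullback_Slope_hom)
qed

lemma pullback_Slope_coordinates:
  "pullback (Slope c) cps_X = cps_X" "pullback (Slope c) cps_Y = cps_X * (cps_Y + cps_const c)"
proof -
  have X: "forms cps_X $ m = (if m = 1 then 1 else 0)" for m
    by (rule poly_eqI) (auto simp: coeff_forms cps_coeff_X)
  have Y: "forms cps_Y $ m = (if m = 1 then monom 1 1 else 0)" for m
    by (rule poly_eqI) (auto simp: coeff_forms cps_coeff_Y)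
  show "pullback (Slope c) cps_X = cps_X"
    unfolding series_of_inject[symmetric]
    by (rule fps_ext) (simp add: series_of_pullback_Slope X fps_X_def)
  show "pullback (Slope c) cps_Y = cps_X * (cps_Y + cps_const c)"
    unfolding series_of_inject[symmetric]
    by (rule fps_ext) (auto simp: series_of_pullback_Slope Y cps_const.rep_eq affine_part_monom)
qed

subsection \<open>Dividing by the exceptional divisor\<close>

text \<open>
  The exponent is a parameter, because the transform of an ideal divides each of its elements by
  the same power of the exceptional divisor.
\<close>

definition divided_transform :: "direction \<Rightarrow> nat \<Rightarrow> cps \<Rightarrow> cps" where
  "divided_transform d e f = pullback d f div exceptional d ^ e"

lemma exceptional_nonzero [simp]: "exceptional d \<noteq> 0"
  by (cases d) auto

lemma multiplicity_O_exceptional [simp]: "multiplicity_O (exceptional d) = 1"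
  by (cases d) auto

lemma pullback_conv_divided_transform:
  assumes "order_ge e f"
  shows "pullback d f = exceptional d ^ e * divided_transform d e f"
proof -
  have "cps_X ^ e dvd pullback (Slope (slope_of d)) (flip d f)"
    unfolding X_power_dvd_iff series_of_pullback_Slope
    using assms by (simp flip: order_ge_conv_forms add: order_ge_conv_forms[THEN iffD1, rule_format])
  then have "flip d (cps_X ^ e) dvd flip d (pullback (Slope (slope_of d)) (flip d f))"
    by (simp only: flip_dvd_iff)
  then have "exceptional d ^ e dvd pullback d f"
    by (simp add: exceptional_conv_flip flip: pullback_conv_flip)
  then show ?thesis by (simp add: divided_transform_def)
qed

lemma divided_transformI:
  "pullback d f = exceptional d ^ e * h \<Longrightarrow> divided_transform d e f = h"
  by (simp add: divided_transform_def)

lemma divided_transform_conv_flip: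
  assumes "order_ge e f"
  shows "divided_transform d e f = flip d (divided_transform (Slope (slope_of d)) e (flip d f))"
proof (rule divided_transformI)
  have "pullback (Slope (slope_of d)) (flip d f)
      = cps_X ^ e * divided_transform (Slope (slope_of d)) e (flip d f)"
    using pullback_conv_divided_transform[of e "flip d f"] assms by simp
  then show "pullback d f = exceptional d ^ e * flip d (divided_transform (Slope (slope_of d)) e (flip d f))"
    unfolding pullback_conv_flip[of d f] exceptional_conv_flip by simp
qed

lemma divided_transform_0 [simp]: "divided_transform d e 0 = 0"
  by (simp add: divided_transform_def)

lemma divided_transform_add:
  assumes "order_ge e f" "order_ge e g"
  shows "divided_transform d e (f + g) = divided_transform d e f + divided_transform d e g"
  by (rule divided_transformI) (use assms in \<open>simp add: pullback_conv_divided_transform distrib_left\<close>)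

lemma divided_transform_diff:
  assumes "order_ge e f" "order_ge e g"
  shows "divided_transform d e (f - g) = divided_transform d e f - divided_transform d e g"
  by (rule divided_transformI) (use assms in \<open>simp add: pullback_conv_divided_transform right_diff_distrib\<close>)

lemma divided_transform_mult:
  assumes "order_ge e f" "order_ge e' g"
  shows "divided_transform d (e + e') (f * g) = divided_transform d e f * divided_transform d e' g"
  by (rule divided_transformI) (use assms in \<open>simp add: pullback_conv_divided_transform power_add ac_simps\<close>)

lemma divided_transform_scale:
  assumes "order_ge e f"
  shows "divided_transform d e (h * f) = pullback d h * divided_transform d e f"
  by (rule divided_transformI) (use assms in \<open>simp add: pullback_conv_divided_transform ac_simps\<close>)

lemma divided_transform_eq_0_iff:
  assumes "order_ge e f"
  shows "divided_transform d e f = 0 \<longleftrightarrow> f = 0"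
  using pullback_conv_divided_transform[OF assms, of d] pullback_eq_0_iff[of d f] by auto

lemma at_x0_divided_transform:
  assumes "order_ge e f"
  shows "at_x0 (divided_transform (Slope c) e f) = affine_part c (forms f $ e)"
proof -
  have "series_of (pullback (Slope c) f) = fps_X ^ e * series_of (divided_transform (Slope c) e f)"
    using pullback_conv_divided_transform[OF assms] by simp
  then have "series_of (pullback (Slope c) f) $ e = series_of (divided_transform (Slope c) e f) $ 0"
    by (simp add: fps_X_power_mult_nth)
  then show ?thesis by (simp add: at_x0_def series_of_pullback_Slope)
qed

subsection \<open>Strict transforms\<close>

lemma strict_transform_Cons:
  "strict_transform f (d # p) = strict_transform (divided_transform d (multiplicity_O f) f) p"
  by (simp add: divided_transform_def)

declare strict_transform.simps(2) [simp del]

lemma strict_transform_append: "strict_transform f (p @ q) = strict_transform (strict_transform f p) q"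
  by (induction p arbitrary: f) (auto simp: strict_transform_Cons)

lemma strict_transform_nonzero [simp]: "strict_transform f p = 0 \<longleftrightarrow> f = 0"
  by (induction p arbitrary: f)
     (auto simp: strict_transform_Cons divided_transform_eq_0_iff order_ge_multiplicity)

lemma strict_transform_mult:
  "f \<noteq> 0 \<Longrightarrow> g \<noteq> 0 \<Longrightarrow> strict_transform (f * g) p = strict_transform f p * strict_transform g p"
  by (induction p arbitrary: f g)
     (auto simp: strict_transform_Cons multiplicity_O_mult divided_transform_mult order_ge_multiplicity
        divided_transform_eq_0_iff)

lemma pullback_conv_strict_transform:
  "pullback d f = exceptional d ^ multiplicity_O f * strict_transform f [d]"
  by (simp add: strict_transform_Cons pullback_conv_divided_transform order_ge_multiplicity)

lemma at_x0_strict_transform: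
  "at_x0 (strict_transform f [Slope c]) = affine_part c (forms f $ multiplicity_O f)"
  by (simp add: strict_transform_Cons at_x0_divided_transform order_ge_multiplicity)

lemma strict_transform_conv_flip:
  "strict_transform f [d] = flip d (strict_transform (flip d f) [Slope (slope_of d)])"
  using divided_transform_conv_flip[OF order_ge_multiplicity, of d f] by (simp add: strict_transform_Cons)

lemma initial_form_nonzero: "f \<noteq> 0 \<Longrightarrow> forms f $ multiplicity_O f \<noteq> 0"
  by (simp add: multiplicity_O_conv_forms)

text \<open>
  In suitable coordinates the restriction to the exceptional divisor is the initial form of \<open>f\<close>,
  which is a nonzero polynomial of degree at most the multiplicity.
\<close>

lemma subdegree_at_x0_strict_transform:
  assumes "f \<noteq> 0"
  shows "at_x0 (strict_transform f [Slope c]) \<noteq> 0"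
    "subdegree (at_x0 (strict_transform f [Slope c])) \<le> multiplicity_O f"
  using initial_form_nonzero[OF assms] subdegree_affine_part_le[of "forms f $ multiplicity_O f" c]
    degree_forms_le[of f "multiplicity_O f"]
  by (auto simp: at_x0_strict_transform)

lemma not_exceptional_dvd_strict_transform:
  assumes "f \<noteq> 0"
  shows "\<not> exceptional d dvd strict_transform f [d]"
proof -
  have "\<not> cps_X dvd strict_transform (flip d f) [Slope (slope_of d)]"
    using subdegree_at_x0_strict_transform(1)[of "flip d f"] assms by (simp add: X_dvd_iff)
  then show ?thesis
    unfolding strict_transform_conv_flip[of f d] exceptional_conv_flip by simp
qed

lemma multiplicity_O_le_subdegree:
  assumes "at_x0 f \<noteq> 0"
  shows "multiplicity_O f \<le> subdegree (at_x0 f)"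
proof -
  have "cps_coeff f 0 (subdegree (at_x0 f)) \<noteq> 0" using assms by (simp flip: at_x0_nth)
  then show ?thesis unfolding multiplicity_O_def by (intro Least_le) (auto intro: exI[of _ 0])
qed

lemma multiplicity_O_strict_transform_le:
  assumes "f \<noteq> 0"
  shows "multiplicity_O (strict_transform f [d]) \<le> multiplicity_O f"
proof -
  have "multiplicity_O (strict_transform (flip d f) [Slope (slope_of d)]) \<le> multiplicity_O (flip d f)"
    using subdegree_at_x0_strict_transform[of "flip d f" "slope_of d"] assms
    by (intro order_trans[OF multiplicity_O_le_subdegree]) auto
  then show ?thesis unfolding strict_transform_conv_flip[of f d] by simp
qed

text \<open>Except possibly the vertical one, these are the roots of the initial form.\<close>

lemma finite_tangent_directions:
  assumes "f \<noteq> 0"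
  shows "finite {d. multiplicity_O (strict_transform f [d]) > 0}"
proof (rule finite_subset)
  let ?Z = "{c. poly (forms f $ multiplicity_O f) c = 0}"
  show "finite (insert Vertical (Slope ` ?Z))"
    using initial_form_nonzero[OF assms] by (simp add: poly_roots_finite)
  have "c \<in> ?Z" if "multiplicity_O (strict_transform f [Slope c]) > 0" for c
  proof -
    have "cps_coeff (strict_transform f [Slope c]) 0 0 = 0"
      using that assms by (metis multiplicity_O_eq_0_iff not_gr0 strict_transform_nonzero)
    then show ?thesis by (simp flip: at_x0_nth add: at_x0_strict_transform affine_part_nth_0)
  qed
  then show "{d. multiplicity_O (strict_transform f [d]) > 0} \<subseteq> insert Vertical (Slope ` ?Z)"
    by (auto, metis direction.exhaust image_eqI mem_Collect_eq)
qed

lemma mult_at_Nil [simp]: "mult_at f [] = multiplicity_O f"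
  by (simp add: mult_at_def)

lemma mult_at_append: "mult_at f (p @ q) = mult_at (strict_transform f p) q"
  by (simp add: mult_at_def strict_transform_append)

lemma mult_at_append_le: "f \<noteq> 0 \<Longrightarrow> mult_at f (p @ q) \<le> mult_at f p"
proof (induction q rule: rev_induct)
  case (snoc d q)
  have "mult_at f (p @ q @ [d]) \<le> mult_at f (p @ q)"
    using multiplicity_O_strict_transform_le[of "strict_transform f (p @ q)" d] snoc.prems
    by (simp add: mult_at_def flip: strict_transform_append)
  with snoc show ?case by simp
qed simp

lemma mult_at_prefix_le: "f \<noteq> 0 \<Longrightarrow> prefix p q \<Longrightarrow> mult_at f q \<le> mult_at f p"
  by (auto simp: prefix_def mult_at_append_le)

lemma mult_at_mult: "f \<noteq> 0 \<Longrightarrow> g \<noteq> 0 \<Longrightarrow> mult_at (f * g) p = mult_at f p + mult_at g p"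
  by (simp add: mult_at_def strict_transform_mult multiplicity_O_mult)

lemma mult_at_unit: "is_unit f \<Longrightarrow> mult_at f p = 0"
  using mult_at_append_le[of f "[]" p] by (auto simp: is_unit_iff_multiplicity)

lemma mult_at_power: "f \<noteq> 0 \<Longrightarrow> mult_at (f ^ n) p = n * mult_at f p"
  by (induction n) (auto simp: mult_at_mult mult_at_unit)

lemma mult_at_dvd_le: "f dvd g \<Longrightarrow> g \<noteq> 0 \<Longrightarrow> mult_at f p \<le> mult_at g p"
  by (auto elim!: dvdE simp: mult_at_mult)

section \<open>Proximity\<close>

text \<open>The direction, at the point \<open>d\<close> of the first neighbourhood, of the exceptional divisor itself.\<close>

fun along :: "direction \<Rightarrow> direction" where
  "along (Slope c) = Vertical"
| "along Vertical = Slope 0"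

lemma strict_transform_exceptional_along: "strict_transform (exceptional d) [along d] = exceptional d"
  unfolding strict_transform_Cons
  by (cases d; simp; intro divided_transformI;
      simp add: pullback_Slope_coordinates pullback_conv_flip[of Vertical])
lemma strict_transform_exceptional_off:
  assumes "d' \<noteq> along d"
  shows "is_unit (strict_transform (exceptional d) [d'])"
proof -
  have "pullback d' (exceptional d) = exceptional d' * flip d' 1 \<and> cps_coeff 1 0 0 \<noteq> 0
      \<or> (\<exists>c. c \<noteq> 0 \<and> pullback d' (exceptional d) = exceptional d' * (cps_Y + cps_const c))"
    using assms
    by (cases d; cases d'; simp add: pullback_Slope_coordinates cps_coeff_1
          pullback_conv_flip[of Vertical]) blast?
  then obtain u where "pullback d' (exceptional d) = exceptional d' ^ 1 * u" "cps_coeff u 0 0 \<noteq> 0"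
    by (auto simp: cps_coeff_Y cps_coeff_1 cps_const.rep_eq cps_coeff.rep_eq)
  then show ?thesis
    unfolding strict_transform_Cons by (simp add: divided_transformI is_unit_iff_coeff)
qed

lemma mult_at_exceptional_pos_iff:
  "mult_at (exceptional d) s > 0 \<longleftrightarrow> s = replicate (length s) (along d)"
proof (induction s)
  case (Cons d' s)
  have "mult_at (exceptional d) (d' # s) = mult_at (strict_transform (exceptional d) [d']) s"
    using mult_at_append[of _ "[d']" s] by simp
  then show ?case
    using Cons strict_transform_exceptional_along[of d] strict_transform_exceptional_off[of d' d]
    by (cases "d' = along d") (auto simp: mult_at_unit)
qed simp

lemma mult_at_exceptional_le: "mult_at (exceptional d) s \<le> 1"
  using mult_at_append_le[of "exceptional d" "[]" s] by simp

text \<open>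
  The strict transforms of an exceptional divisor keep the direction \<open>along d\<close> in the chosen
  coordinates.
\<close>

lemma proximate_iff: "proximate q p \<longleftrightarrow> (\<exists>d n. q = p @ d # replicate n (along d))"
  unfolding proximate_def mult_at_exceptional_pos_iff by (metis length_replicate)

lemma proximate_imp_strict_prefix: "proximate q p \<Longrightarrow> strict_prefix p q"
  by (auto simp: proximate_iff strict_prefix_def)

lemma proximate_snoc: "proximate (p @ [d]) p"
  unfolding proximate_iff by (metis replicate_0)

text \<open>
  A point that is proximate to \<open>p\<close> without following it immediately ends in a run of equal directions;
  removing this run and the one direction before it yields \<open>p\<close>.
\<close>

lemma proximate_unique:
  assumes "proximate (q @ [d]) p" "proximate (q @ [d]) p'" "p \<noteq> q" "p' \<noteq> q"
  shows "p = p'"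
proof -
  have *: "\<exists>d0 n. q @ [d] = r @ d0 # replicate n d @ [d] \<and> d = along d0"
    if "proximate (q @ [d]) r" "r \<noteq> q" for r
  proof -
    from that(1) obtain d0 n where eq: "q @ [d] = r @ d0 # replicate n (along d0)"
      unfolding proximate_iff by blast
    with that(2) obtain m where m: "n = Suc m" by (cases n) auto
    have "replicate n (along d0) = replicate m (along d0) @ [along d0]"
      unfolding m by (simp add: replicate_append_same)
    with eq have "q @ [d] = (r @ d0 # replicate m (along d0)) @ [along d0]" by simp
    then have "d = along d0" "q = r @ d0 # replicate m (along d0)" by simp_all
    then show ?thesis by auto
  qed
  obtain d1 m where 1: "q @ [d] = p @ d1 # replicate m d @ [d]" "d = along d1"
    using *[OF assms(1,3)] by blast
  obtain d2 n where 2: "q @ [d] = p' @ d2 # replicate n d @ [d]" "d = along d2"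
    using *[OF assms(2,4)] by blast
  have neq: "along d0 \<noteq> d0" for d0 by (cases d0) auto
  have eq: "p @ d1 # replicate m d = p' @ d2 # replicate n d" using 1(1) 2(1) by auto
  have run: "takeWhile (\<lambda>x. x = d) (rev (r @ d0 # replicate k d)) = replicate k d" if "d = along d0" for r d0 k
    using that neq[of d0] by (simp add: takeWhile_append)
  from run[OF 1(2), of p m] run[OF 2(2), of p' n] eq have "m = n" by (metis length_replicate)
  with eq show ?thesis by simp
qed

lemma proximate_set_cases:
  assumes "q \<noteq> []"
  obtains "{p. proximate q p} = {butlast q}"
    | p where "p \<noteq> butlast q" "{p. proximate q p} = {butlast q, p}"
proof -
  have q: "q = butlast q @ [last q]" using assms by simp
  have "proximate q (butlast q)" using proximate_snoc q by metis
  moreover have "p = p'" if "proximate q p" "proximate q p'" "p \<noteq> butlast q" "p' \<noteq> butlast q" for p p'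
    using proximate_unique[of "butlast q" "last q" p p'] that q by simp
  ultimately show thesis using that by blast
qed

section \<open>Values\<close>

text \<open>
  The germ at \<open>p\<close> of the exceptional divisor of the point \<open>take k p\<close>; a unit unless \<open>p\<close> is
  proximate to that point.
\<close>

definition exceptional_germ :: "point \<Rightarrow> nat \<Rightarrow> cps" where
  "exceptional_germ p k = strict_transform (exceptional (p ! k)) (drop (Suc k) p)"

lemma exceptional_germ_nonzero [simp]: "exceptional_germ p k \<noteq> 0"
  by (simp add: exceptional_germ_def)

lemma exceptional_germ_snoc:
  "k < length p \<Longrightarrow> exceptional_germ (p @ [d]) k = strict_transform (exceptional_germ p k) [d]"
  "exceptional_germ (p @ [d]) (length p) = exceptional d"
  by (simp_all add: exceptional_germ_def nth_append strict_transform_append)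

lemma proximate_conv_germ:
  "proximate p q \<longleftrightarrow> (\<exists>k<length p. q = take k p \<and> multiplicity_O (exceptional_germ p k) > 0)"
proof
  assume "proximate p q"
  then obtain d s where "p = q @ d # s" "mult_at (exceptional d) s > 0"
    by (auto simp: proximate_def)
  then show "\<exists>k<length p. q = take k p \<and> multiplicity_O (exceptional_germ p k) > 0"
    by (intro exI[of _ "length q"]) (simp add: exceptional_germ_def mult_at_def)
next
  assume "\<exists>k<length p. q = take k p \<and> multiplicity_O (exceptional_germ p k) > 0"
  then obtain k where "k < length p" "q = take k p" "multiplicity_O (exceptional_germ p k) > 0" by blast
  then show "proximate p q"
    unfolding proximate_def
    by (intro exI[of _ "p ! k"] exI[of _ "drop (Suc k) p"])
       (simp add: exceptional_germ_def mult_at_def id_take_nth_drop)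
qed

lemma finite_proximate: "finite {q. proximate p q}"
proof -
  have "{q. proximate p q} \<subseteq> (\<lambda>k. take k p) ` {..<length p}"
    by (auto simp: proximate_conv_germ)
  then show ?thesis using finite_surj by blast
qed

text \<open>
  Exceptional germs have multiplicity at most one, so sums over the points to which \<open>p\<close> is
  proximate become sums over all points before \<open>p\<close>, the form in which they occur as exponents.
\<close>

lemma sum_proximate:
  "(\<Sum>q\<in>{q. proximate p q}. w q)
     = (\<Sum>k<length p. w (take k p) * int (multiplicity_O (exceptional_germ p k)))"
proof -
  let ?K = "{k\<in>{..<length p}. multiplicity_O (exceptional_germ p k) > 0}"
  have one: "multiplicity_O (exceptional_germ p k) = 1" if "k \<in> ?K" for k
  proof -
    have "multiplicity_O (exceptional_germ p k) \<le> 1"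
      using mult_at_exceptional_le[of "p ! k" "drop (Suc k) p"]
      by (simp only: exceptional_germ_def mult_at_def)
    then show ?thesis using that by simp
  qed
  have "inj_on (\<lambda>k. take k p) ?K"
    by (rule inj_onI) (auto dest: arg_cong[of _ _ length])
  moreover have "{q. proximate p q} = (\<lambda>k. take k p) ` ?K" by (auto simp: proximate_conv_germ)
  ultimately have "(\<Sum>q\<in>{q. proximate p q}. w q) = (\<Sum>k\<in>?K. w (take k p))"
    by (simp only: sum.reindex o_def)
  also have "\<dots> = (\<Sum>k\<in>?K. w (take k p) * int (multiplicity_O (exceptional_germ p k)))"
    by (intro sum.cong refl) (simp only: one of_nat_1 mult_1_right)
  also have "\<dots> = (\<Sum>k<length p. w (take k p) * int (multiplicity_O (exceptional_germ p k)))"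
    by (intro sum.mono_neutral_left) auto
  finally show ?thesis .
qed

lemma value_of_nonneg: "value_of (\<lambda>q. int (e q)) p \<ge> 0"
proof (induction p rule: length_induct)
  case (1 p)
  have "value_of (\<lambda>q. int (e q)) q \<ge> 0" if "proximate p q" for q
    using 1 that proximate_imp_strict_prefix prefix_length_less by blast
  then show ?case by (subst value_of.simps) (auto intro!: add_nonneg_nonneg sum_nonneg)
qed

text \<open>Values of multiplicities in natural numbers, to serve as exponents.\<close>

definition nat_value :: "(point \<Rightarrow> nat) \<Rightarrow> point \<Rightarrow> nat" where
  "nat_value e p = nat (value_of (\<lambda>q. int (e q)) p)"

lemma int_nat_value: "int (nat_value e p) = value_of (\<lambda>q. int (e q)) p"
  using value_of_nonneg by (simp add: nat_value_def)

lemma nat_value_rec: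
  "nat_value e p = e p + (\<Sum>k<length p. nat_value e (take k p) * multiplicity_O (exceptional_germ p k))"
proof -
  have "int (nat_value e p)
      = int (e p + (\<Sum>k<length p. nat_value e (take k p) * multiplicity_O (exceptional_germ p k)))"
    unfolding int_nat_value
    by (subst value_of.simps) (simp add: sum_proximate flip: int_nat_value)
  then show ?thesis by linarith
qed

definition exceptional_monomial :: "(point \<Rightarrow> nat) \<Rightarrow> point \<Rightarrow> cps" where
  "exceptional_monomial w p = (\<Prod>k<length p. exceptional_germ p k ^ w (take k p))"

lemma exceptional_monomial_nonzero [simp]: "exceptional_monomial w p \<noteq> 0"
  by (simp add: exceptional_monomial_def)

lemma exceptional_monomial_Nil [simp]: "exceptional_monomial w [] = 1"
  by (simp add: exceptional_monomial_def)

lemma multiplicity_O_exceptional_monomial: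
  "multiplicity_O (exceptional_monomial w p)
     = (\<Sum>k<length p. w (take k p) * multiplicity_O (exceptional_germ p k))"
  unfolding exceptional_monomial_def
  by (subst multiplicity_O_prod) (auto simp: multiplicity_O_power)

text \<open>
  The recursion of values is the bookkeeping of exponents under blowing up: the new exceptional
  divisor occurs in the pull-back of an older one with the multiplicity of that one at \<open>p\<close>.
\<close>

lemma pullback_exceptional_monomial:
  "pullback d (exceptional_monomial (nat_value e) p) * exceptional d ^ e p
     = exceptional_monomial (nat_value e) (p @ [d])"
proof -
  let ?w = "nat_value e"
  have "pullback d (exceptional_monomial ?w p)
      = (\<Prod>k<length p. pullback d (exceptional_germ p k) ^ ?w (take k p))"
    by (simp add: exceptional_monomial_def pullback_prod)
  also have "\<dots> = (\<Prod>k<length p. exceptional d ^ (?w (take k p) * multiplicity_O (exceptional_germ p k))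
      * exceptional_germ (p @ [d]) k ^ ?w (take k p))"
    by (intro prod.cong)
       (auto simp: pullback_conv_strict_transform[of d] exceptional_germ_snoc power_mult_distrib
         mult.commute simp flip: power_mult)
  also have "\<dots> = exceptional d ^ (\<Sum>k<length p. ?w (take k p) * multiplicity_O (exceptional_germ p k))
      * (\<Prod>k<length p. exceptional_germ (p @ [d]) k ^ ?w (take k p))"
    by (simp add: prod.distrib power_sum)
  finally show ?thesis
    by (simp add: exceptional_monomial_def exceptional_germ_snoc nat_value_rec[of e p] power_add ac_simps)
qed

fun total_transform :: "cps \<Rightarrow> point \<Rightarrow> cps" where
  "total_transform f [] = f"
| "total_transform f (d # p) = total_transform (pullback d f) p"

lemma total_transform_snoc: "total_transform f (p @ [d]) = pullback d (total_transform f p)"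
  by (induction p arbitrary: f) auto

lemma total_transform_eq_0_iff [simp]: "total_transform f p = 0 \<longleftrightarrow> f = 0"
  by (induction p arbitrary: f) auto

lemma total_transform_mult: "total_transform (f * g) p = total_transform f p * total_transform g p"
  by (induction p arbitrary: f g) auto

lemma total_transform_conv_strict_transform:
  "total_transform f p = exceptional_monomial (nat_value (mult_at f)) p * strict_transform f p"
proof (induction p rule: rev_induct)
  case (snoc d p)
  have "total_transform f (p @ [d])
      = pullback d (exceptional_monomial (nat_value (mult_at f)) p) * pullback d (strict_transform f p)"
    by (simp add: total_transform_snoc snoc)
  also have "pullback d (strict_transform f p) = exceptional d ^ mult_at f p * strict_transform f (p @ [d])"
    by (simp add: pullback_conv_strict_transform[of d] mult_at_def strict_transform_append)
  finally show ?case by (simp flip: pullback_exceptional_monomial add: ac_simps)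
qed simp

text \<open>
  In other words, the value at \<open>p\<close> is the order of vanishing along the exceptional divisor of
  \<open>p\<close>.
\<close>

lemma value_at_conv_total_transform:
  assumes "f \<noteq> 0"
  shows "value_at f p = int (multiplicity_O (total_transform f p))"
  unfolding total_transform_conv_strict_transform int_nat_value[symmetric]
  by (subst multiplicity_O_mult)
     (use assms in \<open>auto simp: multiplicity_O_exceptional_monomial nat_value_rec[of _ p] mult_at_def\<close>)

lemma value_at_mult: "f \<noteq> 0 \<Longrightarrow> g \<noteq> 0 \<Longrightarrow> value_at (f * g) p = value_at f p + value_at g p"
  by (simp add: value_at_conv_total_transform total_transform_mult multiplicity_O_mult)

section \<open>Values of ideals\<close>

lemma ideal_mult_O_le: "f \<in> A \<Longrightarrow> f \<noteq> 0 \<Longrightarrow> ideal_mult_O A \<le> multiplicity_O f"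
  unfolding ideal_mult_O_def by (intro cInf_lower) auto

lemma ideal_mult_O_attained:
  assumes "\<exists>f\<in>A. f \<noteq> 0"
  obtains f where "f \<in> A" "f \<noteq> 0" "multiplicity_O f = ideal_mult_O A"
proof -
  have "ideal_mult_O A \<in> multiplicity_O ` (A - {0})"
    unfolding ideal_mult_O_def by (intro Inf_nat_def1) (use assms in auto)
  with that show thesis by fastforce
qed

lemma ideal_mult_O_eqI:
  assumes "f \<in> A" "f \<noteq> 0" "multiplicity_O f = n" "\<And>g. g \<in> A \<Longrightarrow> g \<noteq> 0 \<Longrightarrow> n \<le> multiplicity_O g"
  shows "ideal_mult_O A = n"
  using assms ideal_mult_O_le[of f A] ideal_mult_O_attained[of A] by (metis le_antisym)

lemma order_ge_ideal_mult_O: "f \<in> A \<Longrightarrow> order_ge (ideal_mult_O A) f"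
  by (cases "f = 0") (auto simp: order_ge_iff ideal_mult_O_le)

lemma ideal_mult_O_span:
  assumes "\<exists>f\<in>A. f \<noteq> 0"
  shows "ideal_mult_O (ideal.span A) = ideal_mult_O A"
proof -
  obtain f where f: "f \<in> A" "f \<noteq> 0" "multiplicity_O f = ideal_mult_O A"
    using ideal_mult_O_attained[OF assms] .
  have "ideal.span A \<subseteq> {f. order_ge (ideal_mult_O A) f}"
    by (rule ideal.span_minimal) (auto simp: order_ge_ideal_mult_O subspace_order_ge)
  then show ?thesis
    using f by (intro ideal_mult_O_eqI[of f]) (auto simp: ideal.span_base order_ge_iff)
qed

lemma ideal_mult_O_times:
  assumes "m \<noteq> 0" "\<exists>f\<in>A. f \<noteq> 0"
  shows "ideal_mult_O ((*) m ` A) = multiplicity_O m + ideal_mult_O A"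
proof -
  obtain f where f: "f \<in> A" "f \<noteq> 0" "multiplicity_O f = ideal_mult_O A"
    using ideal_mult_O_attained[OF assms(2)] .
  then show ?thesis
    using assms(1)
    by (intro ideal_mult_O_eqI[of "m * f"]) (auto simp: multiplicity_O_mult ideal_mult_O_le)
qed

text \<open>
  Transforms of a set of generators; they generate the transforms of the ideal, and do not require
  the formation of an ideal at each step.
\<close>

fun generator_transform :: "cps set \<Rightarrow> point \<Rightarrow> cps set" where
  "generator_transform A [] = A"
| "generator_transform A (d # p) = generator_transform (divided_transform d (ideal_mult_O A) ` A) p"

lemma generator_transform_append:
  "generator_transform A (p @ q) = generator_transform (generator_transform A p) q"
  by (induction p arbitrary: A) auto

lemma divided_transform_nonzero_image:
  "\<exists>f\<in>A. f \<noteq> 0 \<Longrightarrow> \<exists>f\<in>divided_transform d (ideal_mult_O A) ` A. f \<noteq> 0"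
  by (auto simp: divided_transform_eq_0_iff order_ge_ideal_mult_O)

lemma generator_transform_nonzero: "\<exists>f\<in>A. f \<noteq> 0 \<Longrightarrow> \<exists>f\<in>generator_transform A p. f \<noteq> 0"
proof (induction p arbitrary: A)
  case (Cons d p)
  then show ?case using divided_transform_nonzero_image[of A d] by simp
qed simp

lemma ideal_transform_Cons:
  "ideal_transform A (d # p) = ideal_transform (ideal.span (divided_transform d (ideal_mult_O A) ` A)) p"
  by (simp add: divided_transform_def)

text \<open>
  Pull-back is a ring homomorphism, so a linear combination of generators transforms into one of
  their transforms.
\<close>

lemma span_divided_transform_span:
  assumes "\<And>f. f \<in> A \<Longrightarrow> order_ge e f"
  shows "ideal.span (divided_transform d e ` ideal.span A) = ideal.span (divided_transform d e ` A)"
    (is "?L = ?R")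
proof
  have "f \<in> {f. order_ge e f \<and> divided_transform d e f \<in> ?R}" if "f \<in> ideal.span A" for f
    using that
  proof (induction rule: ideal.span_induct_alt)
    case base
    show ?case by (simp add: ideal.span_zero)
  next
    case (step c x y)
    have o: "order_ge e x" "order_ge e (c * x)" "order_ge e y"
      using step assms subspaceD(4)[OF subspace_order_ge, of x e c] by auto
    then have "divided_transform d e (c * x + y)
        = pullback d c * divided_transform d e x + divided_transform d e y"
      by (simp add: divided_transform_add divided_transform_scale)
    also have "\<dots> \<in> ?R"
      using step by (intro ideal.span_add ideal.span_scale) (auto intro: ideal.span_base)
    finally show ?case using o by (auto intro: order_ge_add)
  qed
  then show "?L \<subseteq> ?R" by (intro ideal.span_minimal) (auto simp: ideal.subspace_span)
  show "?R \<subseteq> ?L" by (intro ideal.span_mono image_mono) (auto intro: ideal.span_base)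
qed

lemma ideal_transform_span:
  "\<exists>f\<in>A. f \<noteq> 0 \<Longrightarrow> ideal_transform (ideal.span A) p = ideal.span (generator_transform A p)"
proof (induction p arbitrary: A)
  case (Cons d p)
  have "ideal_transform (ideal.span A) (d # p)
      = ideal_transform (ideal.span (divided_transform d (ideal_mult_O A) ` A)) p"
    unfolding ideal_transform_Cons ideal_mult_O_span[OF Cons.prems]
    by (simp add: span_divided_transform_span order_ge_ideal_mult_O)
  also have "\<dots> = ideal.span (generator_transform A (d # p))"
    using Cons.IH[OF divided_transform_nonzero_image[OF Cons.prems]] by simp
  finally show ?case .
qed simp

lemma ideal_mult_at_span:
  "\<exists>f\<in>A. f \<noteq> 0 \<Longrightarrow> ideal_mult_at (ideal.span A) p = ideal_mult_O (generator_transform A p)"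
  unfolding ideal_mult_at_def
  by (simp add: ideal_transform_span ideal_mult_O_span generator_transform_nonzero)

text \<open>
  All generators are divided by the same exceptional monomial, whose exponents are the values
  attached to the multiplicities of the ideal.
\<close>

lemma total_transform_image:
  assumes "\<exists>f\<in>A. f \<noteq> 0"
  shows "(\<lambda>f. total_transform f p) ` A
    = (*) (exceptional_monomial (nat_value (ideal_mult_at (ideal.span A))) p) ` generator_transform A p"
proof (induction p rule: rev_induct)
  case (snoc d p)
  let ?w = "nat_value (ideal_mult_at (ideal.span A))"
  let ?B = "generator_transform A p"
  have "(\<lambda>f. total_transform f (p @ [d])) ` A = pullback d ` (\<lambda>f. total_transform f p) ` A"
    by (simp add: total_transform_snoc image_image)
  also have "\<dots> = (\<lambda>h. pullback d (exceptional_monomial ?w p) * pullback d h) ` ?B"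
    by (simp add: snoc image_image)
  also have "\<dots> = (\<lambda>h. exceptional_monomial ?w (p @ [d]) * divided_transform d (ideal_mult_O ?B) h) ` ?B"
  proof (intro image_cong refl)
    fix h assume "h \<in> ?B"
    then have "pullback d h = exceptional d ^ ideal_mult_O ?B * divided_transform d (ideal_mult_O ?B) h"
      by (intro pullback_conv_divided_transform order_ge_ideal_mult_O)
    moreover have "pullback d (exceptional_monomial ?w p) * exceptional d ^ ideal_mult_O ?B
        = exceptional_monomial ?w (p @ [d])"
      using pullback_exceptional_monomial[of d "ideal_mult_at (ideal.span A)" p]
      by (simp only: ideal_mult_at_span[OF assms])
    ultimately show "pullback d (exceptional_monomial ?w p) * pullback d h
        = exceptional_monomial ?w (p @ [d]) * divided_transform d (ideal_mult_O ?B) h"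
      by (metis mult.assoc)
  qed
  finally show ?case by (simp add: generator_transform_append image_image)
qed (auto)

lemma ideal_value_conv_total_transform:
  assumes "\<exists>f\<in>A. f \<noteq> 0"
  shows "nat_value (ideal_mult_at (ideal.span A)) p = ideal_mult_O ((\<lambda>f. total_transform f p) ` A)"
  unfolding total_transform_image[OF assms]
  by (subst ideal_mult_O_times)
     (auto simp: generator_transform_nonzero assms multiplicity_O_exceptional_monomial
       nat_value_rec[of _ p] ideal_mult_at_span)

lemma ideal_value:
  assumes "finite A" "A \<noteq> {}" "0 \<notin> A"
  shows "value_of (\<lambda>q. int (ideal_mult_at (ideal.span A) q)) p = Min ((\<lambda>f. value_at f p) ` A)"
proof -
  have nz: "\<exists>f\<in>A. f \<noteq> 0" using assms(2,3) by (metis all_not_in_conv)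
  let ?T = "(\<lambda>f. total_transform f p) ` A"
  have "\<exists>f\<in>?T. f \<noteq> 0" using nz by auto
  then obtain t where t: "t \<in> ?T" "multiplicity_O t = ideal_mult_O ?T"
    by (rule ideal_mult_O_attained)
  from t(1) obtain f where "f \<in> A" "t = total_transform f p" by (rule imageE)
  with t(2) have f: "f \<in> A" "multiplicity_O (total_transform f p) = ideal_mult_O ?T" by simp_all
  have "Min ((\<lambda>f. value_at f p) ` A) = value_at f p"
  proof (rule Min_eqI)
    show "value_at f p \<le> y" if "y \<in> (\<lambda>f. value_at f p) ` A" for y
    proof -
      from that obtain g where g: "g \<in> A" "y = value_at g p" by blast
      have "f \<noteq> 0" "g \<noteq> 0" using f g assms(3) by auto
      moreover have "ideal_mult_O ?T \<le> multiplicity_O (total_transform g p)"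
        using g \<open>g \<noteq> 0\<close> by (intro ideal_mult_O_le) auto
      ultimately show ?thesis using f(2) g(2) by (simp add: value_at_conv_total_transform)
    qed
  qed (use assms f in auto)
  also have "\<dots> = int (ideal_mult_O ?T)"
    using f assms(3) by (subst value_at_conv_total_transform) auto
  finally show ?thesis
    by (simp add: ideal_value_conv_total_transform[OF nz] flip: int_nat_value)
qed

section \<open>Colength\<close>

text \<open>
  Every strictly increasing chain of ideals that begins with \<open>I\<close> has at most \<open>n\<close> steps. For
  ideals of finite colength this number is the dimension of the quotient ring; chains of ideals
  are easier to transport along a blow-up than bases.
\<close>

primrec colength_le :: "nat \<Rightarrow> cps set \<Rightarrow> bool" where
  "colength_le 0 I \<longleftrightarrow> I = UNIV"
| "colength_le (Suc n) I \<longleftrightarrow> (\<forall>J. ideal.subspace J \<longrightarrow> I \<subset> J \<longrightarrow> colength_le n J)"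

lemma colength_le_mono: "colength_le n I \<Longrightarrow> I \<subseteq> J \<Longrightarrow> colength_le n J"
  by (cases n) auto

text \<open>For an ideal of finite colength, the colength is the sum over \<open>k\<close> of these orders.\<close>

definition layer_order :: "nat \<Rightarrow> cps set \<Rightarrow> nat" where
  "layer_order k J = (LEAST n. \<exists>h. cps_X ^ k * h \<in> J \<and> at_x0 h \<noteq> 0 \<and> subdegree (at_x0 h) = n)"

lemma layer_order_le: "cps_X ^ k * h \<in> J \<Longrightarrow> at_x0 h \<noteq> 0 \<Longrightarrow> layer_order k J \<le> subdegree (at_x0 h)"
  unfolding layer_order_def by (rule Least_le) blast

lemma layer_order_attained:
  assumes "cps_X ^ k * f \<in> J" "at_x0 f \<noteq> 0"
  obtains h where "cps_X ^ k * h \<in> J" "at_x0 h \<noteq> 0" "subdegree (at_x0 h) = layer_order k J"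
  using LeastI_ex[of "\<lambda>n. \<exists>h. cps_X ^ k * h \<in> J \<and> at_x0 h \<noteq> 0 \<and> subdegree (at_x0 h) = n"] assms
  unfolding layer_order_def by blast

text \<open>
  An element \<open>x^k w\<close> of \<open>K\<close> can be reduced by one of \<open>J\<close> to an element divisible by \<open>x^(k + 1)\<close>;
  the reduction ends with \<open>x^N\<close>.
\<close>

lemma ideal_eqI_layer_order:
  assumes J: "ideal.subspace J" and K: "ideal.subspace K" and "J \<subseteq> K"
    and f: "f \<in> J" "at_x0 f \<noteq> 0" and N: "cps_X ^ N \<in> J"
    and le: "\<And>k. k < N \<Longrightarrow> layer_order k J \<le> layer_order k K"
  shows "J = K"
proof -
  note J' = subspaceD[OF J] and K' = subspaceD[OF K]
  have "\<forall>w. cps_X ^ 0 * w \<in> K \<longrightarrow> cps_X ^ 0 * w \<in> J"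
  proof (rule inc_induct[of 0 N])
    show "\<forall>w. cps_X ^ N * w \<in> K \<longrightarrow> cps_X ^ N * w \<in> J" using J'(5)[OF N] by blast
    fix k assume "k < N" and IH: "\<forall>w. cps_X ^ Suc k * w \<in> K \<longrightarrow> cps_X ^ Suc k * w \<in> J"
    show "\<forall>w. cps_X ^ k * w \<in> K \<longrightarrow> cps_X ^ k * w \<in> J"
    proof (intro allI impI)
      fix w assume w: "cps_X ^ k * w \<in> K"
      obtain h where h: "cps_X ^ k * h \<in> J" "at_x0 h \<noteq> 0" "subdegree (at_x0 h) = layer_order k J"
        using layer_order_attained[of k f J] J'(4)[OF f(1)] f(2) by metis
      have "at_x0 w = 0 \<or> subdegree (at_x0 h) \<le> subdegree (at_x0 w)"
        using layer_order_le[OF w] le[OF \<open>k < N\<close>] h(3) by fastforce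
      then obtain q r where w_eq: "w = q * h + cps_X * r"
        using divide_by_order[OF h(2)] by metis
      have "cps_X ^ k * w = q * (cps_X ^ k * h) + cps_X ^ Suc k * r"
        unfolding w_eq by (simp add: algebra_simps)
      moreover have "q * (cps_X ^ k * h) \<in> J" using J'(4)[OF h(1)] .
      ultimately show "cps_X ^ k * w \<in> J"
        using w IH J'(2) K'(3)[OF w, of "q * (cps_X ^ k * h)"] \<open>J \<subseteq> K\<close>
        by (metis add_diff_cancel_left' subsetD)
    qed
  qed simp
  then show ?thesis using \<open>J \<subseteq> K\<close> by auto
qed

text \<open>
  The sum of the layer orders drops along every strict inclusion of ideals, by the preceding
  lemma. It is finite because \<open>I\<close> contains a power of \<open>x\<close> and a series that is not divisible by
  \<open>x\<close>.
\<close>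

lemma colength_finite:
  assumes "ideal.subspace I" "no_common_factor I"
  obtains n where "colength_le n I"
proof -
  obtain N where N: "cps_X ^ N \<in> I" using no_common_factor_X_power[OF assms] .
  obtain f where f: "f \<in> I" "at_x0 f \<noteq> 0"
    using assms(2) not_is_unit_X unfolding no_common_factor_def X_dvd_iff[symmetric] by blast
  define \<mu> where "\<mu> = (\<lambda>J. \<Sum>k<N. layer_order k J)"
  have less: "\<mu> K < \<mu> J" if JK: "ideal.subspace J" "ideal.subspace K" "I \<subseteq> J" "J \<subset> K" for J K
  proof -
    have fJ: "f \<in> J" "cps_X ^ N \<in> J" using JK f N by auto
    have le: "layer_order k K \<le> layer_order k J" for k
    proof -
      obtain h where h: "cps_X ^ k * h \<in> J" "at_x0 h \<noteq> 0" "subdegree (at_x0 h) = layer_order k J"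
        using layer_order_attained[of k f J] subspaceD(4)[OF JK(1) fJ(1)] f(2) by metis
      then show ?thesis using layer_order_le[of k h K] JK(4) by auto
    qed
    have "\<exists>k<N. layer_order k K < layer_order k J"
    proof (rule ccontr)
      assume "\<not> ?thesis"
      then have "layer_order k J \<le> layer_order k K" if "k < N" for k using that by (meson not_le)
      then have "J = K"
        using JK(4) by (intro ideal_eqI_layer_order[OF JK(1,2) _ fJ(1) f(2) fJ(2)]) auto
      with JK(4) show False by blast
    qed
    then show ?thesis unfolding \<mu>_def using le by (intro sum_strict_mono_ex1) auto
  qed
  have "colength_le n J" if "ideal.subspace J" "I \<subseteq> J" "\<mu> J \<le> n" for n J
    using that
  proof (induction n arbitrary: J)
    case 0
    then show ?case using less[of J UNIV] by fastforce
  next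
    case (Suc n)
    show ?case unfolding colength_le.simps
    proof (intro allI impI)
      fix K assume K: "ideal.subspace K" "J \<subset> K"
      then have "\<mu> K \<le> n" using less[OF Suc.prems(1) K(1) Suc.prems(2) K(2)] Suc.prems(3) by simp
      then show "colength_le n K" using Suc.IH[of K] K Suc.prems by blast
    qed
  qed
  from this[OF assms(1) order_refl order_refl] that show thesis by blast
qed

text \<open>
  The map \<open>\<Phi>\<close> turns a chain above \<open>I\<close> into a chain of the same length that stops short of the
  whole ring, so that one more step can be appended.
\<close>

lemma colength_le_transfer:
  assumes \<Phi>: "\<And>J. ideal.subspace J \<Longrightarrow> I \<subseteq> J \<Longrightarrow> ideal.subspace (\<Phi> J) \<and> \<Phi> J \<noteq> UNIV"
    and less: "\<And>J K. ideal.subspace J \<Longrightarrow> ideal.subspace K \<Longrightarrow> I \<subseteq> J \<Longrightarrow> J \<subset> K \<Longrightarrow> \<Phi> J \<subset> \<Phi> K"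
    and "ideal.subspace J" "I \<subseteq> J" "colength_le (Suc n) (\<Phi> J)"
  shows "colength_le n J"
  using assms(3-)
proof (induction n arbitrary: J)
  case 0
  show ?case
  proof (rule ccontr)
    assume "\<not> colength_le 0 J"
    then have "J \<subset> UNIV" by auto
    then have "\<Phi> J \<subset> \<Phi> UNIV" using less[of J UNIV] 0 by simp
    then show False using 0(3) \<Phi>[of UNIV] by auto
  qed
next
  case (Suc n)
  show ?case unfolding colength_le.simps(2)[of n]
  proof (intro allI impI)
    fix K assume K: "ideal.subspace K" "J \<subset> K"
    have IK: "I \<subseteq> K" using K(2) Suc.prems(2) by auto
    have "colength_le (Suc n) (\<Phi> K)"
      using Suc.prems(3)[unfolded colength_le.simps(2)[of "Suc n"], rule_format, of "\<Phi> K"]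
        \<Phi>[OF K(1) IK] less[OF Suc.prems(1) K(1) Suc.prems(2) K(2)] by fast
    then show "colength_le n K" by (rule Suc.IH[OF K(1) IK])
  qed
qed

section \<open>Transform of an ideal\<close>

definition blow_up_ideal :: "direction \<Rightarrow> cps set \<Rightarrow> cps set" where
  "blow_up_ideal d I = ideal.span (divided_transform d (ideal_mult_O I) ` I)"

lemma ideal_mult_at_Cons: "ideal_mult_at I (d # p) = ideal_mult_at (blow_up_ideal d I) p"
  by (simp add: ideal_mult_at_def ideal_transform_Cons blow_up_ideal_def del: ideal_transform.simps)

lemma subspace_blow_up_ideal: "ideal.subspace (blow_up_ideal d I)"
  by (simp add: blow_up_ideal_def)

lemma divided_transform_in_blow_up_ideal:
  "f \<in> I \<Longrightarrow> divided_transform d (ideal_mult_O I) f \<in> blow_up_ideal d I"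
  unfolding blow_up_ideal_def by (intro ideal.span_base imageI)

lemma pullback_sum: "pullback d (sum f A) = (\<Sum>a\<in>A. pullback d (f a))"
  by (induction A rule: infinite_finite_induct) auto

lemma pullback_Slope_const [simp]: "pullback (Slope c) (cps_const a) = cps_const a"
proof -
  have F: "forms (cps_const a) $ m = (if m = 0 then [:a:] else 0)" for m
    by (rule poly_eqI) (auto simp: coeff_forms cps_coeff.rep_eq cps_const.rep_eq coeff_pCons split: nat.splits)
  show ?thesis
    unfolding series_of_inject[symmetric]
    by (rule fps_ext) (simp add: F series_of_pullback_Slope cps_const.rep_eq affine_part_def fps_of_poly_const)
qed

lemma order_ge_scale: "order_ge e f \<Longrightarrow> order_ge e (h * f)"
  using order_ge_mult[of 0 h e f] by simp

lemma order_ge_power: "order_ge 1 f \<Longrightarrow> order_ge n (f ^ n)"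
  using order_ge_mult[of 1 f] by (induction n) auto

text \<open>
  The transformed ideal contains a power of \<open>x\<close>, and the strict transform \<open>g\<close> of an element \<open>f\<close>
  of least multiplicity \<open>e\<close>, where \<open>g(0, y)\<close> has order at most \<open>e\<close>. So modulo this ideal every
  series reduces to a polynomial in \<open>x\<close> and \<open>y\<close> of degree less than \<open>e\<close> in \<open>y\<close>; and these are
  transforms of polynomials of order at least \<open>e\<close>.
\<close>

lemma blow_up_ideal_Slope:
  assumes I: "ideal.subspace I" "no_common_factor I"
  shows "no_common_factor (blow_up_ideal (Slope c) I)"
    and "\<exists>h. order_ge (ideal_mult_O I) h
      \<and> divided_transform (Slope c) (ideal_mult_O I) h - u \<in> blow_up_ideal (Slope c) I"
proof -
  define e where "e = ideal_mult_O I"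
  define t where "t = divided_transform (Slope c) e"
  let ?I = "blow_up_ideal (Slope c) I"
  note I' = subspaceD[OF subspace_blow_up_ideal[of "Slope c" I]]
  obtain N where N: "cps_X ^ N \<in> I" using no_common_factor_X_power[OF I] .
  have "e \<le> N" using ideal_mult_O_le[OF N] by (simp add: e_def multiplicity_O_power)
  then have "t (cps_X ^ N) = cps_X ^ (N - e)"
    unfolding t_def
    by (intro divided_transformI) (simp add: pullback_Slope_coordinates flip: power_add)
  then have XN: "cps_X ^ (N - e) \<in> ?I"
    using divided_transform_in_blow_up_ideal[OF N, of "Slope c"] by (simp add: t_def e_def)
  obtain f where f: "f \<in> I" "f \<noteq> 0" "multiplicity_O f = e"
    unfolding e_def using ideal_mult_O_attained no_common_factor_nonzero[OF I(2)] by blast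
  define g where "g = t f"
  have "g = strict_transform f [Slope c]" by (simp add: g_def t_def strict_transform_Cons f(3))
  then have g: "at_x0 g \<noteq> 0" "subdegree (at_x0 g) \<le> e"
    using subdegree_at_x0_strict_transform[OF f(2), of c] f(3) by simp_all
  have gI: "g \<in> ?I"
    using divided_transform_in_blow_up_ideal[OF f(1), of "Slope c"] by (simp add: g_def t_def e_def)
  show "no_common_factor ?I"
    unfolding no_common_factor_def
  proof (intro allI impI)
    fix d assume d: "\<forall>a\<in>?I. d dvd a"
    have "\<not> cps_X dvd d"
      using d gI g(1) unfolding X_dvd_iff[symmetric] by (meson dvd_trans)
    moreover have "d dvd cps_X ^ (N - e) * 1" using d XN by simp
    ultimately show "is_unit d" using X_power_cancel by blast
  qed
  have "\<exists>h r. order_ge e h \<and> t h - u - cps_X ^ K * r \<in> ?I" for K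
  proof (induction K)
    case 0
    show ?case using I'(1) by (intro exI[of _ 0] exI[of _ "- u"]) (simp add: t_def)
  next
    case (Suc K)
    then obtain h r where h: "order_ge e h" and r: "t h - u - cps_X ^ K * r \<in> ?I" by blast
    define n where "n = subdegree (at_x0 g)"
    define a where "a = (\<lambda>j. cps_const (at_x0 r $ j))"
    define P where "P = (\<Sum>j<n. a j * cps_Y ^ j)"
    have P: "at_x0 P $ k = at_x0 r $ k" if "k < n" for k
      using that
      by (simp add: P_def a_def at_x0_sum fps_sum_nth fps_X_power_nth if_distrib[of "(*) _"] cong: if_cong)
    then have "at_x0 (r - P) = 0 \<or> subdegree (at_x0 g) \<le> subdegree (at_x0 (r - P))"
      using subdegree_geI[of "at_x0 (r - P)" n] by (auto simp: n_def)
    then obtain q s where qs: "r - P = q * g + cps_X * s" using divide_by_order[OF g(1)] by metis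
    \<comment> \<open>The polynomial \<open>x^K P(y)\<close> of degree less than \<open>e\<close> in \<open>y\<close> is itself a transform.\<close>
    define l where "l = cps_Y - cps_const c * cps_X"
    define h' where "h' = (\<Sum>j<n. a j * (cps_X ^ K * (cps_X ^ (e - j) * l ^ j)))"
    have l: "pullback (Slope c) l = cps_X * cps_Y"
      by (simp add: l_def pullback_Slope_coordinates algebra_simps)
    have "pullback (Slope c) (a j * (cps_X ^ K * (cps_X ^ (e - j) * l ^ j)))
        = cps_X ^ e * (cps_X ^ K * (a j * cps_Y ^ j))" if "j < n" for j
    proof -
      have "pullback (Slope c) (a j * (cps_X ^ K * (cps_X ^ (e - j) * l ^ j)))
          = a j * (cps_X ^ K * (cps_X ^ (e - j) * (cps_X ^ j * cps_Y ^ j)))"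
        by (simp only: a_def pullback_hom pullback_power pullback_Slope_const
            pullback_Slope_coordinates l power_mult_distrib)
      also have "cps_X ^ (e - j) * (cps_X ^ j * cps_Y ^ j) = cps_X ^ e * cps_Y ^ j"
        using that g(2) by (simp add: n_def flip: power_add mult.assoc)
      finally show ?thesis by (simp only: ac_simps)
    qed
    then have "pullback (Slope c) h' = exceptional (Slope c) ^ e * (cps_X ^ K * P)"
      by (simp add: h'_def P_def pullback_sum sum_distrib_left)
    then have th': "t h' = cps_X ^ K * P" unfolding t_def by (rule divided_transformI)
    have "order_ge 1 l" "order_ge 1 cps_X"
      by (auto simp: order_ge_def l_def cps_coeff_X cps_coeff_Y cps_coeff_mult)
    then have o: "order_ge e (cps_X ^ (e - j) * l ^ j)" if "j < n" for j
      using that g(2) order_ge_mult[OF order_ge_power[of cps_X "e - j"] order_ge_power[of l j]]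
      by (simp add: n_def)
    have oe: "order_ge e h'"
    proof -
      have "h' \<in> {f. order_ge e f}"
        unfolding h'_def
        using o order_ge_scale by (intro ideal.subspace_sum[OF subspace_order_ge]) simp
      then show ?thesis by simp
    qed
    have "order_ge e (h - h')"
      using subspaceD(3)[OF subspace_order_ge[of e], of h h'] h oe by simp
    moreover have "t (h - h') - u - cps_X ^ Suc K * s \<in> ?I"
    proof -
      have "t (h - h') - u - cps_X ^ Suc K * s = (t h - u - cps_X ^ K * r) + (cps_X ^ K * q) * g"
      proof -
        have "r = P + (q * g + cps_X * s)" using qs by (simp add: algebra_simps)
        then show ?thesis
          using divided_transform_diff[OF h oe, of "Slope c"] th'
          by (simp add: t_def algebra_simps)
      qed
      also have "\<dots> \<in> ?I" using r I'(2) I'(4)[OF gI] by blast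
      finally show ?thesis .
    qed
    ultimately show ?case by blast
  qed
  then obtain h r where h: "order_ge e h" "t h - u - cps_X ^ (N - e) * r \<in> ?I" by blast
  have "t h - u = (t h - u - cps_X ^ (N - e) * r) + cps_X ^ (N - e) * r" by simp
  also have "\<dots> \<in> ?I" using h(2) I'(2) I'(5)[OF XN] by blast
  finally show "\<exists>h. order_ge (ideal_mult_O I) h \<and> divided_transform (Slope c) (ideal_mult_O I) h - u \<in> ?I"
    using h(1) by (auto simp: t_def e_def)
qed

lemma subspace_flip:
  assumes "ideal.subspace I"
  shows "ideal.subspace (flip d ` I)"
proof -
  note I' = subspaceD[OF assms]
  have *: "f \<in> flip d ` I \<longleftrightarrow> flip d f \<in> I" for f by (metis flip_simps(1) imageE imageI)
  show ?thesis unfolding ideal.subspace_def * using I' by simp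
qed

lemma flip_span_subset: "f \<in> ideal.span A \<Longrightarrow> flip d f \<in> ideal.span (flip d ` A)"
proof (induction rule: ideal.span_induct_alt)
  case (step c x y)
  then show ?case by (simp add: ideal.span_add ideal.span_scale ideal.span_base)
qed (simp add: ideal.span_zero)

lemma no_common_factor_flip: "no_common_factor I \<Longrightarrow> no_common_factor (flip d ` I)"
  unfolding no_common_factor_def by (metis flip_dvd_iff flip_simps(1,3) imageI)

lemma ideal_mult_O_flip [simp]: "ideal_mult_O (flip d ` I) = ideal_mult_O I"
proof -
  have "flip d ` I - {0} = flip d ` (I - {0})" by auto
  then show ?thesis by (simp add: ideal_mult_O_def image_image)
qed

lemma flip_blow_up_ideal:
  assumes "f \<in> blow_up_ideal (Slope (slope_of d)) (flip d ` I)"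
  shows "flip d f \<in> blow_up_ideal d I"
proof -
  have "flip d ` divided_transform (Slope (slope_of d)) (ideal_mult_O I) ` flip d ` I
      = divided_transform d (ideal_mult_O I) ` I"
    unfolding image_image
    by (intro image_cong refl) (simp add: divided_transform_conv_flip[OF order_ge_ideal_mult_O, of _ _ d])
  then show ?thesis
    using flip_span_subset[OF assms[unfolded blow_up_ideal_def], of d] by (simp add: blow_up_ideal_def)
qed

lemma blow_up_ideal_no_common_factor:
  assumes "ideal.subspace I" "no_common_factor I"
  shows "no_common_factor (blow_up_ideal d I)"
  using blow_up_ideal_Slope(1)[OF subspace_flip[OF assms(1), of d] no_common_factor_flip[OF assms(2), of d],
      where c = "slope_of d"]
    flip_blow_up_ideal[of _ d I]
  unfolding no_common_factor_def by (metis flip_dvd_iff flip_simps(1,3))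

lemma blow_up_ideal_surj:
  assumes "ideal.subspace I" "no_common_factor I"
  obtains h where "order_ge (ideal_mult_O I) h"
    "divided_transform d (ideal_mult_O I) h - u \<in> blow_up_ideal d I"
proof -
  let ?S = "Slope (slope_of d)"
  obtain h where h: "order_ge (ideal_mult_O I) h"
      "divided_transform ?S (ideal_mult_O I) h - flip d u \<in> blow_up_ideal ?S (flip d ` I)"
    using blow_up_ideal_Slope(2)[OF subspace_flip[OF assms(1), of d] no_common_factor_flip[OF assms(2), of d],
        where u = "flip d u" and c = "slope_of d"] by auto
  show thesis
  proof
    show o: "order_ge (ideal_mult_O I) (flip d h)" using h(1) by simp
    show "divided_transform d (ideal_mult_O I) (flip d h) - u \<in> blow_up_ideal d I"
      using flip_blow_up_ideal[OF h(2)] by (simp add: divided_transform_conv_flip[OF o])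
  qed
qed

text \<open>
  The preimages of ideals under division of pull-backs consist of elements of positive order,
  hence do not contain \<open>1\<close>; surjectivity modulo the transform of \<open>I\<close> keeps inclusions of
  preimages strict.
\<close>

lemma blow_up_ideal_colength:
  assumes I: "ideal.subspace I" "no_common_factor I" and e: "ideal_mult_O I > 0"
    and n: "colength_le (Suc n) I"
  shows "colength_le n (blow_up_ideal d I)"
proof -
  define t where "t = divided_transform d (ideal_mult_O I)"
  define \<Phi> where "\<Phi> = (\<lambda>J. {h. order_ge (ideal_mult_O I) h \<and> t h \<in> J})"
  note o = subspaceD[OF subspace_order_ge[of "ideal_mult_O I"], simplified]
  show ?thesis
  proof (rule colength_le_transfer[of "blow_up_ideal d I" \<Phi>])
    fix J assume J: "ideal.subspace J" "blow_up_ideal d I \<subseteq> J"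
    note J' = subspaceD[OF J(1)]
    have "ideal.subspace (\<Phi> J)"
      unfolding ideal.subspace_def \<Phi>_def using o J'
      by (auto simp: t_def divided_transform_add divided_transform_scale)
    moreover have "1 \<notin> \<Phi> J" using e by (auto simp: \<Phi>_def order_ge_iff)
    ultimately show "ideal.subspace (\<Phi> J) \<and> \<Phi> J \<noteq> UNIV" by blast
    fix K assume K: "ideal.subspace K" "J \<subset> K"
    then obtain u where u: "u \<in> K" "u \<notin> J" by blast
    obtain h where h: "order_ge (ideal_mult_O I) h" "t h - u \<in> blow_up_ideal d I"
      unfolding t_def using blow_up_ideal_surj[OF I] by metis
    then have hu: "t h - u \<in> J" "t h - u \<in> K" using J K by auto
    have "t h = u + (t h - u)" "u = t h - (t h - u)" by simp_all
    then have "t h \<in> K" "t h \<notin> J" using hu u J'(3) subspaceD(2)[OF K(1)] by metis+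
    then show "\<Phi> J \<subset> \<Phi> K" using h(1) K(2) unfolding \<Phi>_def by blast
  next
    have "I \<subseteq> \<Phi> (blow_up_ideal d I)"
      by (auto simp: \<Phi>_def t_def order_ge_ideal_mult_O divided_transform_in_blow_up_ideal)
    then show "colength_le (Suc n) (\<Phi> (blow_up_ideal d I))" using n colength_le_mono by blast
  qed (simp_all add: subspace_blow_up_ideal)
qed

section \<open>Finiteness of the set of base points\<close>

lemma is_unit_pullback: "is_unit f \<Longrightarrow> is_unit (pullback d f)"
  by (metis dvdE dvdI pullback_hom(2,5))

lemma generator_transform_mult_0:
  assumes "\<exists>f\<in>A. f \<noteq> 0" "ideal_mult_O A = 0"
  shows "ideal_mult_O (generator_transform A p) = 0"
  using assms
proof (induction p arbitrary: A)
  case (Cons d p)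
  obtain f where f: "f \<in> A" "f \<noteq> 0" "multiplicity_O f = 0"
    using ideal_mult_O_attained[OF Cons.prems(1)] Cons.prems(2) by metis
  then have "is_unit (divided_transform d 0 f)"
    by (simp add: divided_transform_def is_unit_iff_multiplicity is_unit_pullback[unfolded is_unit_iff_multiplicity])
  then have "ideal_mult_O (divided_transform d (ideal_mult_O A) ` A) \<le> 0"
    using ideal_mult_O_le[of "divided_transform d 0 f" "divided_transform d (ideal_mult_O A) ` A"] f(1) Cons.prems(2)
    by (auto simp: is_unit_iff_multiplicity)
  then show ?case
    using Cons.IH[OF divided_transform_nonzero_image[OF Cons.prems(1)]] by simp
qed simp

lemma ideal_mult_at_append_pos:
  assumes "\<exists>f\<in>A. f \<noteq> 0" "ideal_mult_at (ideal.span A) (p @ q) > 0"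
  shows "ideal_mult_at (ideal.span A) p > 0"
  using assms generator_transform_mult_0[OF generator_transform_nonzero[OF assms(1)], of p q]
  by (auto simp: ideal_mult_at_span generator_transform_append)

text \<open>
  Each step of the induction passes to one of the finitely many tangent directions of an element
  of least multiplicity.
\<close>

lemma finite_base_points_aux:
  "ideal.subspace I \<Longrightarrow> no_common_factor I \<Longrightarrow> colength_le n I \<Longrightarrow> finite {p. ideal_mult_at I p > 0}"
proof (induction n arbitrary: I)
  case 0
  have "ideal_mult_O I \<le> 0" using ideal_mult_O_le[of 1 I] 0 by simp
  moreover have span: "ideal.span I = I" using 0(1) by (rule ideal.span_eq_iff[THEN iffD2])
  ultimately have "ideal_mult_at I p = 0" for p
    using ideal_mult_at_append_pos[of I "[]" p, unfolded span] no_common_factor_nonzero[OF 0(2)]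
    by (auto simp: ideal_mult_at_def)
  then show ?case by simp
next
  case (Suc n)
  have nz: "\<exists>f\<in>I. f \<noteq> 0" using no_common_factor_nonzero[OF Suc.prems(2)] .
  have pos: "ideal_mult_O J > 0" if "ideal.subspace J" "\<exists>f\<in>J. f \<noteq> 0" "ideal_mult_at J p > 0" for J p
    using ideal_mult_at_append_pos[of J "[]" p, unfolded ideal.span_eq_iff[THEN iffD2, OF that(1)]] that
    by (simp add: ideal_mult_at_def)
  obtain f where f: "f \<in> I" "f \<noteq> 0" "multiplicity_O f = ideal_mult_O I"
    using ideal_mult_O_attained[OF nz] .
  let ?D = "{d. multiplicity_O (strict_transform f [d]) > 0}"
  let ?B = "\<lambda>d. {p. ideal_mult_at (blow_up_ideal d I) p > 0}"
  show ?case
  proof (cases "ideal_mult_O I > 0")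
    case True
    have "{p. ideal_mult_at I p > 0} \<subseteq> insert [] (\<Union>d\<in>?D. (#) d ` ?B d)"
    proof
      fix p assume p: "p \<in> {p. ideal_mult_at I p > 0}"
      show "p \<in> insert [] (\<Union>d\<in>?D. (#) d ` ?B d)"
      proof (cases p)
        case (Cons d q)
        then have q: "q \<in> ?B d" using p by (simp add: ideal_mult_at_Cons)
        have st: "strict_transform f [d] \<in> blow_up_ideal d I"
          using divided_transform_in_blow_up_ideal[OF f(1), of d] by (simp add: strict_transform_Cons f(3))
        have "ideal_mult_O (blow_up_ideal d I) > 0"
          using pos[OF subspace_blow_up_ideal] q st f(2) by (metis mem_Collect_eq strict_transform_nonzero)
        then have "d \<in> ?D" using ideal_mult_O_le[OF st] f(2) by simp
        with q Cons show ?thesis by blast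
      qed simp
    qed
    moreover have "finite (insert [] (\<Union>d\<in>?D. (#) d ` ?B d))"
      using finite_tangent_directions[OF f(2)]
        Suc.IH[OF subspace_blow_up_ideal blow_up_ideal_no_common_factor[OF Suc.prems(1,2)]
          blow_up_ideal_colength[OF Suc.prems(1,2) True Suc.prems(3)]]
      by (intro finite.insertI finite_UN_I finite_imageI) auto
    ultimately show ?thesis by (rule finite_subset)
  next
    case False
    then have "{p. ideal_mult_at I p > 0} = {}" using pos[OF Suc.prems(1) nz] by auto
    then show ?thesis by simp
  qed
qed

lemma no_common_factor_span: "no_common_factor A \<Longrightarrow> no_common_factor (ideal.span A)"
  by (erule no_common_factor_mono) (auto intro: ideal.span_base)

theorem finite_base_points:
  assumes "no_common_factor A"
  shows "finite {p. ideal_mult_at (ideal.span A) p > 0}"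
proof -
  have *: "ideal.subspace (ideal.span A)" "no_common_factor (ideal.span A)"
    using assms by (simp_all add: no_common_factor_span)
  obtain n where "colength_le n (ideal.span A)" using colength_finite[OF *] .
  with * show ?thesis by (rule finite_base_points_aux)
qed

text \<open>
  The multiplicity of the ideal is the excess of its value over the sum of its values at the points
  to which \<open>p\<close> is proximate.
\<close>

lemma ideal_mult_at_pos_iff:
  assumes "finite A" "A \<noteq> {}" "0 \<notin> A"
  shows "ideal_mult_at (ideal.span A) p > 0 \<longleftrightarrow>
    (\<forall>f\<in>A. value_at f p > (\<Sum>q\<in>{q. proximate p q}. Min ((\<lambda>f. value_at f q) ` A)))"
proof -
  have "Min ((\<lambda>f. value_at f p) ` A)
      = int (ideal_mult_at (ideal.span A) p) + (\<Sum>q\<in>{q. proximate p q}. Min ((\<lambda>f. value_at f q) ` A))"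
    unfolding ideal_value[OF assms, symmetric] by (rule value_of.simps)
  then have "ideal_mult_at (ideal.span A) p > 0 \<longleftrightarrow>
      (\<Sum>q\<in>{q. proximate p q}. Min ((\<lambda>f. value_at f q) ` A)) < Min ((\<lambda>f. value_at f p) ` A)"
    by linarith
  then show ?thesis using assms by simp
qed

text \<open>A common point is a base point of the ideal \<open>(f, g)\<close>.\<close>

lemma finite_common_points:
  assumes "f \<noteq> 0" "g \<noteq> 0" "no_common_factor {f, g}"
  shows "finite {p. mult_at f p > 0 \<and> mult_at g p > 0}"
proof (rule finite_subset[OF _ finite_base_points[OF assms(3)]])
  show "{p. mult_at f p > 0 \<and> mult_at g p > 0} \<subseteq> {p. ideal_mult_at (ideal.span {f, g}) p > 0}"
  proof (clarify)
    fix p assume p: "mult_at f p > 0" "mult_at g p > 0"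
    have "value_at h p > (\<Sum>q\<in>{q. proximate p q}. Min ((\<lambda>h. value_at h q) ` {f, g}))"
      if "h \<in> {f, g}" for h
    proof -
      have "(\<Sum>q\<in>{q. proximate p q}. Min ((\<lambda>h. value_at h q) ` {f, g}))
          \<le> (\<Sum>q\<in>{q. proximate p q}. value_at h q)"
        using that by (intro sum_mono Min_le) auto
      also have "\<dots> < value_at h p" using that p by (subst (2) value_of.simps) auto
      finally show ?thesis .
    qed
    then show "ideal_mult_at (ideal.span {f, g}) p > 0"
      using assms by (subst ideal_mult_at_pos_iff) auto
  qed
qed

section \<open>Reduced equations\<close>

lemma reduced_equation_exists:
  assumes "f \<noteq> 0"
  shows "\<exists>h. squarefree h \<and> (\<forall>p. irreducible p \<longrightarrow> (p dvd h \<longleftrightarrow> p dvd (f :: cps)))"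
proof (intro exI conjI allI impI)
  let ?M = "mset_set (prime_factors f)"
  let ?h = "prod_mset ?M"
  have primes: "prime p" if "p \<in># ?M" for p using that by (simp add: in_prime_factors_iff)
  have fac: "prime_factorization ?h = ?M" by (rule prime_factorization_prod_mset_primes[OF primes])
  have "?h \<noteq> 0" using primes by (auto simp: prod_mset_zero_iff)
  have "multiplicity p ?h \<le> 1" if "prime p" for p
  proof -
    have "multiplicity p ?h = count ?M p" using that fac by (metis count_prime_factorization_prime)
    then show ?thesis by (simp add: count_mset_set')
  qed
  then show "squarefree ?h" using \<open>?h \<noteq> 0\<close> by (simp add: squarefree_factorial_semiring'')
  fix p :: cps assume p: "irreducible p"
  then have pn: "prime (normalize p)" by (simp add: irreducible_imp_prime_elem_cps)
  then have "normalize p dvd ?h \<longleftrightarrow> normalize p \<in># ?M"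
    by (rule prime_dvd_prod_mset_primes_iff[OF _ primes])
  also have "\<dots> \<longleftrightarrow> normalize p dvd f" using assms pn by (simp add: in_prime_factors_iff)
  finally show "p dvd ?h \<longleftrightarrow> p dvd f" by simp
qed

lemma reduced_equation:
  assumes "f \<noteq> 0"
  shows "squarefree (reduced_equation f)" "irreducible p \<Longrightarrow> p dvd reduced_equation f \<longleftrightarrow> p dvd f"
  using someI_ex[OF reduced_equation_exists[OF assms]] unfolding reduced_equation_def by blast+

lemma reduced_equation_nonzero: "f \<noteq> 0 \<Longrightarrow> reduced_equation f \<noteq> 0"
  using reduced_equation(1)[of f] by auto

lemma squarefree_dvdI:
  fixes a b :: cps
  assumes "squarefree a" "b \<noteq> 0" "\<And>p. irreducible p \<Longrightarrow> p dvd a \<Longrightarrow> p dvd b"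
  shows "a dvd b"
proof (rule multiplicity_le_imp_dvd)
  show "a \<noteq> 0" using assms(1) by auto
  fix p :: cps assume p: "prime p"
  show "multiplicity p a \<le> multiplicity p b"
  proof (cases "p dvd a")
    case True
    then have "p dvd b" using assms(3) p by (simp add: prime_elem_imp_irreducible)
    then have "multiplicity p b > 0" using p assms(2) by (simp add: prime_multiplicity_gt_zero_iff)
    moreover have "multiplicity p a \<le> 1"
      using assms(1) \<open>a \<noteq> 0\<close> p by (simp add: squarefree_factorial_semiring'')
    ultimately show ?thesis by linarith
  qed (simp add: not_dvd_imp_multiplicity_0)
qed

lemma reduced_equation_dvd: "f \<noteq> 0 \<Longrightarrow> reduced_equation f dvd f"
  by (rule squarefree_dvdI[OF reduced_equation(1)]) (simp_all add: reduced_equation(2))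

lemma reduced_equation_dvd_mono:
  assumes "f dvd g" "g \<noteq> 0"
  shows "reduced_equation f dvd reduced_equation g"
proof -
  have "f \<noteq> 0" using assms by auto
  show ?thesis
  proof (rule squarefree_dvdI[OF reduced_equation(1)[OF \<open>f \<noteq> 0\<close>] reduced_equation_nonzero[OF assms(2)]])
    fix p assume p: "irreducible p" "p dvd reduced_equation f"
    then have "p dvd f" using reduced_equation(2)[OF \<open>f \<noteq> 0\<close>] by simp
    then have "p dvd g" using assms(1) by (rule dvd_trans)
    then show "p dvd reduced_equation g" using reduced_equation(2)[OF assms(2) p(1)] by simp
  qed
qed

lemma dvd_reduced_equation_power:
  assumes "f \<noteq> 0"
  obtains n where "f dvd reduced_equation f ^ n"
proof
  let ?h = "reduced_equation f" and ?n = "size (prime_factorization f)"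
  show "f dvd ?h ^ ?n"
  proof (rule multiplicity_le_imp_dvd[OF assms])
    fix p :: cps assume p: "prime p"
    show "multiplicity p f \<le> multiplicity p (?h ^ ?n)"
    proof (cases "p dvd f")
      case True
      then have "p dvd ?h" using reduced_equation(2)[OF assms] p by (simp add: prime_elem_imp_irreducible)
      then have "multiplicity p ?h \<ge> 1"
        using p reduced_equation_nonzero[OF assms]
        by (simp add: prime_multiplicity_gt_zero_iff Suc_le_eq)
      have "multiplicity p f \<le> ?n"
        using p by (metis count_prime_factorization_prime count_le_size)
      also have "?n \<le> ?n * multiplicity p ?h" using \<open>multiplicity p ?h \<ge> 1\<close> by simp
      also have "\<dots> = multiplicity p (?h ^ ?n)"
        using p reduced_equation_nonzero[OF assms]
        by (simp add: prime_elem_multiplicity_power_distrib)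
      finally show ?thesis .
    qed (simp add: not_dvd_imp_multiplicity_0)
  qed
qed

lemma mult_at_reduced_equation_pos_iff:
  assumes "f \<noteq> 0"
  shows "mult_at (reduced_equation f) p > 0 \<longleftrightarrow> mult_at f p > 0"
proof
  show "mult_at (reduced_equation f) p > 0 \<Longrightarrow> mult_at f p > 0"
    using mult_at_dvd_le[OF reduced_equation_dvd[OF assms] assms, of p] by simp
  obtain n where "f dvd reduced_equation f ^ n" using dvd_reduced_equation_power[OF assms] .
  from mult_at_dvd_le[OF this, of p]
  show "mult_at f p > 0 \<Longrightarrow> mult_at (reduced_equation f) p > 0"
    using reduced_equation_nonzero[OF assms] by (auto simp: mult_at_power intro: gr0I)
qed

section \<open>The Jacobian ideal\<close>

lift_definition cps_dx :: "cps \<Rightarrow> cps" is fps_deriv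
proof -
  fix F :: "complex fps fps" assume "convergent_series F"
  then obtain C R where 1: "C \<ge> 0" "R \<ge> 1" "\<And>i j. norm (F $ i $ j) \<le> C * R ^ (i + j)"
    using convergent_seriesE by metis
  show "convergent_series (fps_deriv F)"
  proof (rule convergent_seriesI[of "2 * R" _ "C * R"])
    fix i j
    have "fps_deriv F $ i $ j = of_nat (Suc i) * F $ Suc i $ j"
      by (simp add: fps_of_nat[symmetric] del: of_nat_Suc)
    then have "norm (fps_deriv F $ i $ j) = real (Suc i) * norm (F $ Suc i $ j)"
      by (simp only: norm_mult norm_of_nat)
    also have "\<dots> \<le> 2 ^ i * (C * R ^ (Suc i + j))"
      using 1(1,2) 1(3)[of "Suc i" j] Suc_le_power2 by (intro mult_mono) auto
    also have "\<dots> \<le> 2 ^ (i + j) * (C * R ^ (Suc i + j))"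
      using 1 by (intro mult_right_mono power_increasing) auto
    finally show "norm (fps_deriv F $ i $ j) \<le> C * R * (2 * R) ^ (i + j)"
      by (simp add: power_mult_distrib ac_simps)
  qed (use 1 in auto)
qed

definition cps_dy :: "cps \<Rightarrow> cps" where
  "cps_dy f = swap_xy (cps_dx (swap_xy f))"

lemma cps_coeff_dx: "cps_coeff (cps_dx f) i j = of_nat (Suc i) * cps_coeff f (Suc i) j"
  by transfer (simp add: fps_of_nat[symmetric] del: of_nat_Suc)

lemma cps_coeff_dy: "cps_coeff (cps_dy f) i j = of_nat (Suc j) * cps_coeff f i (Suc j)"
  by (simp add: cps_dy_def cps_coeff_dx)

lemma cps_dx_mult: "cps_dx (f * g) = f * cps_dx g + cps_dx f * g"
  by transfer simp

lemma cps_dy_mult: "cps_dy (f * g) = f * cps_dy g + cps_dy f * g"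
  by (simp add: cps_dy_def cps_dx_mult)

lemma cps_d_X: "cps_dx cps_X = 1" "cps_dy cps_X = 0"
  by (auto intro!: cps_eqI simp: cps_coeff_dx cps_coeff_dy cps_coeff_X cps_coeff_1)

lemma cps_d_X_power: "cps_dx (cps_X ^ Suc n) = of_nat (Suc n) * cps_X ^ n" "cps_dy (cps_X ^ n) = 0"
proof -
  have "cps_dx 1 = 0" "cps_dy 1 = 0"
    by (auto intro!: cps_eqI simp: cps_coeff_dx cps_coeff_dy cps_coeff_1)
  then show "cps_dy (cps_X ^ n) = 0" "cps_dx (cps_X ^ Suc n) = of_nat (Suc n) * cps_X ^ n"
    by (induction n) (auto simp: cps_dx_mult cps_dy_mult cps_d_X algebra_simps)
qed

lemma forms_dy: "forms (cps_dy f) $ m = pderiv (forms f $ Suc m)"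
  by (rule poly_eqI) (simp add: coeff_forms coeff_pderiv cps_coeff_dy)

text \<open>Euler's relation, in the variable \<open>t = y / x\<close>.\<close>

lemma forms_dx:
  "forms (cps_dx f) $ m + monom 1 1 * forms (cps_dy f) $ m = of_nat (Suc m) * forms f $ Suc m"
proof (rule poly_eqI)
  fix j
  have "coeff (monom 1 1 * forms (cps_dy f) $ m) j = of_nat j * coeff (forms f $ Suc m) j"
    by (cases j) (simp_all add: coeff_monom_mult forms_dy coeff_pderiv)
  moreover have "coeff (forms (cps_dx f) $ m) j = of_nat (Suc m - j) * coeff (forms f $ Suc m) j"
    by (auto simp: coeff_forms cps_coeff_dx Suc_diff_le not_le le_Suc_eq)
  moreover have "coeff (of_nat (Suc m) * forms f $ Suc m) j = of_nat (Suc m) * coeff (forms f $ Suc m) j"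
    by (simp add: of_nat_poly del: of_nat_Suc)
  moreover have "of_nat (Suc m - j) * coeff (forms f $ Suc m) j + of_nat j * coeff (forms f $ Suc m) j
      = of_nat (Suc m) * coeff (forms f $ Suc m) j"
    by (cases "j \<le> Suc m") (auto simp: coeff_forms simp flip: distrib_right of_nat_add)
  ultimately show "coeff (forms (cps_dx f) $ m + monom 1 1 * forms (cps_dy f) $ m) j
      = coeff (of_nat (Suc m) * forms f $ Suc m) j" by simp
qed

lemma affine_part_pderiv: "affine_part c (pderiv p) = fps_deriv (affine_part c p)"
  by (simp add: affine_part_def pderiv_pcompose pderiv_pCons flip: fps_of_poly_pderiv)

lemma series_of_dy: "series_of (cps_dy f) $ m = fps_deriv (series_of f $ m)"
  by (rule fps_ext)
     (use cps_coeff_dy[of f m] in \<open>simp add: cps_coeff.rep_eq\<close>)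

lemma pullback_dy: "cps_dy (pullback (Slope c) f) = cps_X * pullback (Slope c) (cps_dy f)"
  unfolding series_of_inject[symmetric]
proof (rule fps_ext)
  fix m
  show "series_of (cps_dy (pullback (Slope c) f)) $ m = series_of (cps_X * pullback (Slope c) (cps_dy f)) $ m"
  proof (cases m)
    case 0
    have "degree (forms f $ 0) = 0" using degree_forms_le[of f 0] by simp
    then have "pderiv (forms f $ 0) = 0" by (simp add: pderiv_eq_0_iff)
    then show ?thesis by (simp add: 0 series_of_dy series_of_pullback_Slope flip: affine_part_pderiv)
  next
    case (Suc k)
    then show ?thesis by (simp add: series_of_dy series_of_pullback_Slope forms_dy affine_part_pderiv)
  qed
qed

lemma pullback_dx:
  "cps_dx (pullback (Slope c) f)
     = pullback (Slope c) (cps_dx f) + (cps_Y + cps_const c) * pullback (Slope c) (cps_dy f)"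
  unfolding series_of_inject[symmetric]
proof (rule fps_ext)
  fix m
  have nat: "affine_part c (of_nat n * p) = of_nat n * affine_part c p" for n p
    by (induction n) (simp_all add: distrib_right)
  have "series_of (cps_dx (pullback (Slope c) f)) $ m = of_nat (Suc m) * affine_part c (forms f $ Suc m)"
    by (simp add: cps_dx.rep_eq series_of_pullback_Slope)
  also have "\<dots> = affine_part c (forms (cps_dx f) $ m + monom 1 1 * forms (cps_dy f) $ m)"
    unfolding forms_dx nat ..
  also have "\<dots> = affine_part c (forms (cps_dx f) $ m)
      + (fps_X + fps_const c) * affine_part c (forms (cps_dy f) $ m)"
    by (simp add: affine_part_monom)
  also have "\<dots> = series_of (pullback (Slope c) (cps_dx f)
      + (cps_Y + cps_const c) * pullback (Slope c) (cps_dy f)) $ m"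
    by (simp add: series_of_pullback_Slope cps_const.rep_eq distrib_right)
  finally show "series_of (cps_dx (pullback (Slope c) f)) $ m = series_of (pullback (Slope c) (cps_dx f)
      + (cps_Y + cps_const c) * pullback (Slope c) (cps_dy f)) $ m" .
qed

definition jacobian_gens :: "cps \<Rightarrow> cps set" where
  "jacobian_gens f = {f, cps_dx f, cps_dy f}"

definition jacobian_ideal :: "cps \<Rightarrow> cps set" where
  "jacobian_ideal f = ideal.span (jacobian_gens f)"

lemma jacobian_gens_flip: "jacobian_gens (flip d f) = flip d ` jacobian_gens f"
  by (cases d) (auto simp: jacobian_gens_def cps_dy_def)

lemma subspace_jacobian_ideal: "ideal.subspace (jacobian_ideal f)"
  by (simp add: jacobian_ideal_def)

lemma jacobian_gens_subset: "jacobian_gens f \<subseteq> jacobian_ideal f"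
  unfolding jacobian_ideal_def by (auto intro: ideal.span_base)

lemma order_ge_jacobian_gens:
  assumes "order_ge (Suc e) f" "g \<in> jacobian_gens f"
  shows "order_ge e g"
  using assms by (auto simp: jacobian_gens_def order_ge_def cps_coeff_dx cps_coeff_dy)

text \<open>In characteristic zero, a derivative of the initial form is nonzero.\<close>

lemma jacobian_gens_multiplicity:
  assumes "f \<noteq> 0" "multiplicity_O f = Suc e"
  obtains g where "g = cps_dx f \<or> g = cps_dy f" "g \<noteq> 0" "multiplicity_O g \<le> e"
proof -
  have "forms f $ Suc e \<noteq> 0" using initial_form_nonzero[OF assms(1)] assms(2) by simp
  then obtain i j where ij: "i + j = Suc e" "cps_coeff f i j \<noteq> 0" by (auto simp: forms_nth_eq_0_iff)
  then consider k where "i = Suc k" | k where "j = Suc k" by (metis add_is_0 nat.distinct(1) not0_implies_Suc)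
  then have "\<exists>g k l. (g = cps_dx f \<or> g = cps_dy f) \<and> cps_coeff g k l \<noteq> 0 \<and> k + l = e"
  proof cases
    case 1
    then show ?thesis using ij
      by (intro exI[of _ "cps_dx f"] exI[of _ k] exI[of _ j]) (simp add: cps_coeff_dx del: of_nat_Suc)
  next
    case 2
    then show ?thesis using ij
      by (intro exI[of _ "cps_dy f"] exI[of _ i] exI[of _ k]) (simp add: cps_coeff_dy del: of_nat_Suc)
  qed
  then obtain g k l where g: "g = cps_dx f \<or> g = cps_dy f" "cps_coeff g k l \<noteq> 0" "k + l = e" by blast
  then have "g \<noteq> 0" by auto
  moreover have "multiplicity_O g \<le> e"
    unfolding multiplicity_O_def using g by (intro Least_le) blast
  ultimately show thesis using that g(1) by blast
qed

text \<open>
  A prime factor \<open>p\<close> of \<open>f = p k\<close> that divides both derivatives of \<open>f\<close> would divide those of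
  \<open>p\<close>, one of which has a smaller multiplicity than \<open>p\<close>.
\<close>

lemma no_common_factor_jacobian:
  assumes "squarefree f"
  shows "no_common_factor (jacobian_gens f)"
  unfolding no_common_factor_def
proof (intro allI impI)
  fix d assume d: "\<forall>a\<in>jacobian_gens f. d dvd a"
  show "is_unit d"
  proof (rule ccontr)
    assume "\<not> is_unit d"
    moreover have "f \<noteq> 0" "d \<noteq> 0" using assms d by (auto simp: jacobian_gens_def)
    ultimately obtain p where p: "prime p" "p dvd d" using prime_divisor_exists by blast
    then have pf: "p dvd f" "p dvd cps_dx f" "p dvd cps_dy f"
      using d by (auto simp: jacobian_gens_def intro: dvd_trans)
    obtain k where k: "f = p * k" using pf(1) by (auto elim: dvdE)
    have "\<not> p dvd k"
    proof
      assume "p dvd k"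
      then have "p ^ 2 dvd f" unfolding k power2_eq_square by (rule mult_dvd_mono[OF dvd_refl])
      then show False using squarefreeD[OF assms] p(1) not_prime_unit by blast
    qed
    then have "p dvd cps_dx p" "p dvd cps_dy p"
      using pf p(1) unfolding k
      by (auto simp: cps_dx_mult cps_dy_mult dvd_add_right_iff prime_elem_dvd_mult_iff)
    moreover have "p \<noteq> 0" "multiplicity_O p \<noteq> 0"
      using p(1) is_unit_iff_multiplicity[of p] by auto
    then obtain e where "multiplicity_O p = Suc e" "p \<noteq> 0" using not0_implies_Suc by blast
    then obtain g where "g = cps_dx p \<or> g = cps_dy p" "g \<noteq> 0" "multiplicity_O g < multiplicity_O p"
      using jacobian_gens_multiplicity[of p e] by (metis less_Suc_eq_le)
    ultimately show False using multiplicity_O_dvd_le[of p g] by auto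
  qed
qed

text \<open>The chain rule, applied to \<open>f(x, x (y + c)) = x^(e + 1) h\<close>, where \<open>h\<close> is the strict transform.\<close>

lemma pullback_jacobian_gens_Slope:
  assumes "multiplicity_O f = Suc e" and g: "g \<in> jacobian_gens f"
  shows "\<exists>w\<in>jacobian_ideal (strict_transform f [Slope c]). pullback (Slope c) g = cps_X ^ e * w"
proof -
  define h where "h = strict_transform f [Slope c]"
  have f: "pullback (Slope c) f = cps_X ^ Suc e * h"
    using pullback_conv_strict_transform[of "Slope c" f] assms(1) by (simp add: h_def)
  have J: "h \<in> jacobian_ideal h" "cps_dx h \<in> jacobian_ideal h" "cps_dy h \<in> jacobian_ideal h"
    using jacobian_gens_subset[of h] by (auto simp: jacobian_gens_def)
  note J' = subspaceD[OF subspace_jacobian_ideal[of h]]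
  have "cps_dy (cps_X ^ Suc e * h) = cps_X ^ Suc e * cps_dy h"
    unfolding cps_dy_mult cps_d_X_power by simp
  then have "cps_X * pullback (Slope c) (cps_dy f) = cps_X * (cps_X ^ e * cps_dy h)"
    unfolding pullback_dy[symmetric] f by (simp add: ac_simps)
  then have dy: "pullback (Slope c) (cps_dy f) = cps_X ^ e * cps_dy h" by simp
  have "pullback (Slope c) (cps_dx f)
      = cps_dx (cps_X ^ Suc e * h) - (cps_Y + cps_const c) * (cps_X ^ e * cps_dy h)"
    using pullback_dx[of c f] by (simp only: f dy) (simp add: algebra_simps)
  also have "\<dots> = cps_X ^ e * (of_nat (Suc e) * h + cps_X * cps_dx h - (cps_Y + cps_const c) * cps_dy h)"
    unfolding cps_dx_mult cps_d_X_power by (simp only: algebra_simps power_Suc)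
  finally have dx: "pullback (Slope c) (cps_dx f)
      = cps_X ^ e * (of_nat (Suc e) * h + cps_X * cps_dx h - (cps_Y + cps_const c) * cps_dy h)" .
  have ff: "pullback (Slope c) f = cps_X ^ e * (cps_X * h)" by (simp add: f ac_simps)
  from g consider "g = f" | "g = cps_dx f" | "g = cps_dy f" unfolding jacobian_gens_def by blast
  then show ?thesis
  proof cases
    case 1
    then show ?thesis using ff J'(4)[OF J(1)] unfolding h_def[symmetric] by metis
  next
    case 2
    then show ?thesis using dx J'(3)[OF J'(2)[OF J'(4)[OF J(1)] J'(4)[OF J(2)]] J'(4)[OF J(3)]] unfolding h_def[symmetric] by metis
  next
    case 3
    then show ?thesis using dy J(3) unfolding h_def[symmetric] by metis
  qed
qed

lemma pullback_jacobian_gens: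
  assumes "multiplicity_O f = Suc e" and g: "g \<in> jacobian_gens f"
  obtains w where "w \<in> jacobian_ideal (strict_transform f [d])" "pullback d g = exceptional d ^ e * w"
proof -
  let ?S = "Slope (slope_of d)"
  have "flip d g \<in> jacobian_gens (flip d f)" using g by (simp add: jacobian_gens_flip)
  then obtain w where w: "w \<in> jacobian_ideal (strict_transform (flip d f) [?S])"
      "pullback ?S (flip d g) = cps_X ^ e * w"
    using pullback_jacobian_gens_Slope[of "flip d f" e "flip d g"] assms(1) by auto
  have "flip d w \<in> jacobian_ideal (strict_transform f [d])"
    using flip_span_subset[OF w(1)[unfolded jacobian_ideal_def], of d]
    by (simp add: jacobian_ideal_def strict_transform_conv_flip[of f d] jacobian_gens_flip)
  moreover have "pullback d g = exceptional d ^ e * flip d w"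
    unfolding pullback_conv_flip[of d g] w(2) exceptional_conv_flip by simp
  ultimately show thesis using that by blast
qed

text \<open>
  The transform divides by \<open>E^k\<close>, where \<open>k\<close> is the multiplicity of the Jacobian ideal; it is at
  most the exponent \<open>e\<close> with which the pull-backs of all generators are divisible.
\<close>

lemma blow_up_jacobian_ideal_subset:
  assumes "f \<noteq> 0" "multiplicity_O f = Suc e"
  shows "blow_up_ideal d (jacobian_ideal f) \<subseteq> jacobian_ideal (strict_transform f [d])"
proof -
  let ?J = "jacobian_ideal (strict_transform f [d])"
  define k where "k = ideal_mult_O (jacobian_gens f)"
  have nz: "\<exists>g\<in>jacobian_gens f. g \<noteq> 0" using assms(1) by (auto simp: jacobian_gens_def)
  obtain g where "g \<in> jacobian_gens f" "g \<noteq> 0" "multiplicity_O g \<le> e"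
    using jacobian_gens_multiplicity[OF assms] by (metis insertCI jacobian_gens_def)
  then have "k \<le> e" using ideal_mult_O_le[of g "jacobian_gens f"] by (simp add: k_def)
  have "divided_transform d k g \<in> ?J" if g: "g \<in> jacobian_gens f" for g
  proof -
    obtain w where w: "w \<in> ?J" "pullback d g = exceptional d ^ e * w"
      using pullback_jacobian_gens[OF assms(2) g] .
    then have "pullback d g = exceptional d ^ k * (exceptional d ^ (e - k) * w)"
      using \<open>k \<le> e\<close> by (simp flip: power_add mult.assoc)
    then show ?thesis
      using subspaceD(4)[OF subspace_jacobian_ideal w(1)] by (simp add: divided_transformI)
  qed
  then have "ideal.span (divided_transform d k ` jacobian_gens f) \<subseteq> ?J"
    by (intro ideal.span_minimal) (auto simp: subspace_jacobian_ideal)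
  then show ?thesis
    unfolding blow_up_ideal_def jacobian_ideal_def[of f] ideal_mult_O_span[OF nz]
    by (simp add: span_divided_transform_span order_ge_ideal_mult_O k_def)
qed

section \<open>Finiteness of the set of singular points\<close>

text \<open>
  At a point of multiplicity at least two, the Jacobian ideal has positive multiplicity; so its
  colength drops.
\<close>

lemma finite_multiple_points_aux:
  "f \<noteq> 0 \<Longrightarrow> no_common_factor (jacobian_ideal f) \<Longrightarrow> colength_le n (jacobian_ideal f) \<Longrightarrow>
     finite {p. mult_at f p > 1}"
proof (induction n arbitrary: f)
  case (0 f)
  have "multiplicity_O f \<le> 1"
  proof (rule ccontr)
    assume "\<not> ?thesis"
    then obtain e where e: "multiplicity_O f = Suc (Suc e)" by (metis One_nat_def not_le less_Suc_eq_0_disj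
        not0_implies_Suc le_zero_eq le_Suc_eq)
    have "jacobian_gens f \<subseteq> {g. order_ge (Suc e) g}"
      using order_ge_jacobian_gens order_ge_multiplicity[of f] e by auto
    then have "jacobian_ideal f \<subseteq> {g. order_ge (Suc e) g}"
      unfolding jacobian_ideal_def by (rule ideal.span_minimal[OF _ subspace_order_ge])
    then have "order_ge (Suc e) 1" using 0(3) by auto
    then show False by (simp add: order_ge_iff)
  qed
  then have "{p. mult_at f p > 1} = {}"
    using mult_at_append_le[OF 0(1), of "[]"] by (auto simp: not_less intro: order_trans)
  then show ?case by simp
next
  case (Suc n f)
  show ?case
  proof (cases "multiplicity_O f \<le> 1")
    case True
    then have "{p. mult_at f p > 1} = {}"
      using mult_at_append_le[OF Suc.prems(1), of "[]"] by (auto simp: not_less intro: order_trans)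
    then show ?thesis by simp
  next
    case False
    then obtain e where e: "multiplicity_O f = Suc (Suc e)" by (metis One_nat_def not_le less_Suc_eq_0_disj
        not0_implies_Suc le_zero_eq le_Suc_eq)
    have nz: "\<exists>g\<in>jacobian_gens f. g \<noteq> 0" using Suc.prems(1) by (auto simp: jacobian_gens_def)
    obtain g where g: "g \<in> jacobian_gens f" "g \<noteq> 0" "multiplicity_O g = ideal_mult_O (jacobian_gens f)"
      using ideal_mult_O_attained[OF nz] .
    have "order_ge (Suc e) g" using order_ge_jacobian_gens[OF _ g(1)] order_ge_multiplicity[of f] e by simp
    then have pos: "ideal_mult_O (jacobian_ideal f) > 0"
      using g unfolding jacobian_ideal_def ideal_mult_O_span[OF nz] by (simp add: order_ge_iff)
    let ?D = "{d. multiplicity_O (strict_transform f [d]) > 0}"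
    let ?M = "\<lambda>d. {p. mult_at (strict_transform f [d]) p > 1}"
    have "{p. mult_at f p > 1} \<subseteq> insert [] (\<Union>d\<in>?D. (#) d ` ?M d)"
    proof
      fix p assume p: "p \<in> {p. mult_at f p > 1}"
      show "p \<in> insert [] (\<Union>d\<in>?D. (#) d ` ?M d)"
      proof (cases p)
        case (Cons d q)
        then have "q \<in> ?M d" using p mult_at_append[of f "[d]" q] by simp
        moreover have "d \<in> ?D"
          using \<open>q \<in> ?M d\<close> mult_at_append_le[of "strict_transform f [d]" "[]" q] Suc.prems(1) by auto
        ultimately show ?thesis using Cons by blast
      qed simp
    qed
    moreover have "finite (?M d)" for d
    proof (rule Suc.IH)
      show "strict_transform f [d] \<noteq> 0" using Suc.prems(1) by simp
      note sub = blow_up_jacobian_ideal_subset[OF Suc.prems(1) e, of d]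
      show "no_common_factor (jacobian_ideal (strict_transform f [d]))"
        using blow_up_ideal_no_common_factor[OF subspace_jacobian_ideal Suc.prems(2)] sub
        by (rule no_common_factor_mono)
      show "colength_le n (jacobian_ideal (strict_transform f [d]))"
        using blow_up_ideal_colength[OF subspace_jacobian_ideal Suc.prems(2) pos Suc.prems(3)] sub
        by (rule colength_le_mono)
    qed
    then have "finite (insert [] (\<Union>d\<in>?D. (#) d ` ?M d))"
      using finite_tangent_directions[OF Suc.prems(1)]
      by (intro finite.insertI finite_UN_I finite_imageI) auto
    ultimately show ?thesis by (rule finite_subset)
  qed
qed

lemma finite_multiple_points:
  assumes "squarefree f"
  shows "finite {p. mult_at f p > 1}"
proof -
  have "f \<noteq> 0" using assms by auto
  have ncf: "no_common_factor (jacobian_ideal f)"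
    unfolding jacobian_ideal_def using no_common_factor_jacobian[OF assms] by (rule no_common_factor_span)
  obtain n where "colength_le n (jacobian_ideal f)"
    using colength_finite[OF subspace_jacobian_ideal ncf] .
  with \<open>f \<noteq> 0\<close> ncf show ?thesis by (rule finite_multiple_points_aux)
qed

text \<open>
  The exceptional divisor is irreducible and does not divide the strict transform, so that they
  have finitely many common points.
\<close>

lemma finite_proximate_points_on:
  assumes "f \<noteq> 0"
  shows "finite {q. proximate q p \<and> mult_at f q > 0}"
proof (rule finite_subset)
  define g where "g = strict_transform f p"
  have "g \<noteq> 0" using assms by (simp add: g_def)
  let ?D = "{d. multiplicity_O (strict_transform g [d]) > 0}"
  let ?C = "\<lambda>d. {s. mult_at (exceptional d) s > 0 \<and> mult_at (strict_transform g [d]) s > 0}"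
  have "no_common_factor {exceptional d, strict_transform g [d]}" for d
    unfolding no_common_factor_def
  proof (intro allI impI)
    fix \<delta> assume "\<forall>a\<in>{exceptional d, strict_transform g [d]}. \<delta> dvd a"
    then have \<delta>: "\<delta> dvd exceptional d" "\<delta> dvd strict_transform g [d]" by auto
    then obtain u where u: "exceptional d = \<delta> * u" by (auto elim: dvdE)
    then have "\<delta> \<noteq> 0" "u \<noteq> 0" using exceptional_nonzero[of d] by auto
    moreover from this have "multiplicity_O \<delta> + multiplicity_O u = 1"
      using multiplicity_O_exceptional[of d] unfolding u by (simp add: multiplicity_O_mult)
    moreover have "\<not> is_unit u"
      using \<delta>(2) not_exceptional_dvd_strict_transform[OF \<open>g \<noteq> 0\<close>, of d]
      unfolding u by (auto simp: mult_unit_dvd_iff)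
    ultimately show "is_unit \<delta>" unfolding is_unit_iff_multiplicity by auto
  qed
  then have "finite (?C d)" for d using \<open>g \<noteq> 0\<close> by (intro finite_common_points) auto
  then show "finite (\<Union>d\<in>?D. (\<lambda>s. p @ d # s) ` ?C d)"
    using finite_tangent_directions[OF \<open>g \<noteq> 0\<close>] by (intro finite_UN_I finite_imageI) auto
  show "{q. proximate q p \<and> mult_at f q > 0} \<subseteq> (\<Union>d\<in>?D. (\<lambda>s. p @ d # s) ` ?C d)"
  proof clarify
    fix q assume "proximate q p" "mult_at f q > 0"
    then obtain d s where q: "q = p @ d # s" "mult_at (exceptional d) s > 0" "mult_at f (p @ d # s) > 0"
      by (auto simp: proximate_def)
    then have "mult_at (strict_transform g [d]) s > 0"
      using mult_at_append[of f "p @ [d]" s] by (simp add: g_def strict_transform_append)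
    moreover from this have "multiplicity_O (strict_transform g [d]) > 0"
      using mult_at_append_le[of "strict_transform g [d]" "[]" s] \<open>g \<noteq> 0\<close> by simp
    ultimately show "q \<in> (\<Union>d\<in>?D. (\<lambda>s. p @ d # s) ` ?C d)" using q(1,2) by auto
  qed
qed

text \<open>
  The strict transform of a smooth germ is transversal to the exceptional divisor, hence does
  not follow it.
\<close>

lemma is_unit_strict_transform_along_Slope:
  assumes "f \<noteq> 0" "multiplicity_O f = 1"
  shows "is_unit (strict_transform f [Slope c, Vertical])"
proof -
  define h where "h = strict_transform f [Slope c]"
  have h: "h \<noteq> 0" "multiplicity_O h \<le> 1"
    using multiplicity_O_strict_transform_le[OF assms(1), of "Slope c"] assms by (simp_all add: h_def)
  have eq: "strict_transform f [Slope c, Vertical] = strict_transform h [Vertical]"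
    using strict_transform_append[of f "[Slope c]" "[Vertical]"] by (simp add: h_def)
  show ?thesis
  proof (cases "multiplicity_O h = 0")
    case True
    then show ?thesis
      using h(1) multiplicity_O_strict_transform_le[OF h(1), of Vertical]
      by (simp add: eq is_unit_iff_multiplicity)
  next
    case False
    then have m: "multiplicity_O h = 1" using h(2) by simp
    then have "cps_coeff h 0 0 = 0" using multiplicity_O_eq_0_iff[OF h(1)] by simp
    moreover have "at_x0 h \<noteq> 0" "subdegree (at_x0 h) \<le> 1"
      using subdegree_at_x0_strict_transform[OF assms(1), of c] assms(2) by (simp_all add: h_def)
    then have "at_x0 h $ 0 \<noteq> 0 \<or> at_x0 h $ 1 \<noteq> 0"
      by (metis One_nat_def le_Suc_eq le_zero_eq nth_subdegree_nonzero)
    ultimately have "cps_coeff h 0 1 \<noteq> 0" by (simp add: at_x0_nth)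
    moreover have "cps_coeff (pullback Vertical h) 0 1 = cps_coeff h 0 1"
      by (simp add: cps_coeff.rep_eq pullback.rep_eq)
    moreover have "pullback Vertical h = cps_Y * strict_transform h [Vertical]"
      using pullback_conv_strict_transform[of Vertical h] m by simp
    moreover have "cps_coeff (cps_Y * s) 0 1 = cps_coeff s 0 0" for s
      by (simp add: cps_coeff.rep_eq)
    ultimately show ?thesis unfolding eq is_unit_iff_coeff by metis
  qed
qed

lemma is_unit_strict_transform_along:
  assumes "f \<noteq> 0" "multiplicity_O f = 1"
  shows "is_unit (strict_transform f [d, along d])"
proof (cases d)
  case (Slope c)
  then show ?thesis using is_unit_strict_transform_along_Slope[OF assms] by simp
next
  case Vertical
  let ?h = "strict_transform (swap_xy f) [Slope 0]"
  have "strict_transform (swap_xy f) [Slope 0, Vertical] = strict_transform ?h [Vertical]"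
    using strict_transform_append[of "swap_xy f" "[Slope 0]" "[Vertical]"] by simp
  also have "\<dots> = swap_xy (strict_transform (strict_transform f [Vertical]) [Slope 0])"
    by (simp add: strict_transform_conv_flip[of ?h Vertical] strict_transform_conv_flip[of f Vertical])
  also have "strict_transform (strict_transform f [Vertical]) [Slope 0] = strict_transform f [Vertical, Slope 0]"
    using strict_transform_append[of f "[Vertical]" "[Slope 0]"] by simp
  finally show ?thesis
    using is_unit_strict_transform_along_Slope[of "swap_xy f" 0] assms swap_xy_eq_iff[of f 0]
    by (simp add: Vertical is_unit_iff_coeff del: swap_xy_eq_iff)
qed

text \<open>
  The strict transform at the next point is smooth and leaves the exceptional divisor of \<open>p\<close>
  there.
\<close>

lemma proximate_to_simple_point:
  assumes "f \<noteq> 0" "mult_at f p = 1" "proximate q p" "mult_at f q > 0"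
  shows "p = butlast q"
proof -
  obtain d n where q: "q = p @ d # replicate n (along d)" using assms(3) by (auto simp: proximate_iff)
  show ?thesis
  proof (cases n)
    case (Suc m)
    have "is_unit (strict_transform (strict_transform f p) [d, along d])"
      using assms by (intro is_unit_strict_transform_along) (auto simp: mult_at_def)
    then have "mult_at f ((p @ [d, along d]) @ replicate m (along d)) = 0"
      unfolding mult_at_append[of f "p @ [d, along d]"] by (simp add: strict_transform_append mult_at_unit)
    then show ?thesis using assms(4) by (simp add: q Suc)
  qed (simp add: q)
qed

lemma satellite_pointE:
  assumes "satellite_point q"
  obtains p where "p \<noteq> butlast q" "q \<noteq> []" "{p. proximate q p} = {butlast q, p}"
proof -
  have "q \<noteq> []" using assms by (auto simp: satellite_point_def proximate_iff)
  then show thesis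
  proof (cases rule: proximate_set_cases)
    case 1
    then show ?thesis using assms by (simp add: satellite_point_def)
  next
    case (2 p)
    then show ?thesis using that \<open>q \<noteq> []\<close> by blast
  qed
qed

lemma satellite_or_free: "q \<noteq> [] \<Longrightarrow> satellite_point q \<or> free_point q \<and> {p. proximate q p} = {butlast q}"
  by (rule proximate_set_cases[of q]) (auto simp: satellite_point_def free_point_def)

text \<open>
  A satellite point on the germ is proximate to a point that it does not immediately follow,
  which has to be a multiple point by the previous lemmas.
\<close>

lemma finite_satellites_on:
  assumes "squarefree f"
  shows "finite {q. satellite_point q \<and> mult_at f q > 0}"
proof (rule finite_subset)
  have "f \<noteq> 0" using assms by auto
  show "finite (\<Union>p\<in>{p. mult_at f p > 1}. {q. proximate q p \<and> mult_at f q > 0})"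
    using finite_multiple_points[OF assms] finite_proximate_points_on[OF \<open>f \<noteq> 0\<close>] by blast
  show "{q. satellite_point q \<and> mult_at f q > 0}
      \<subseteq> (\<Union>p\<in>{p. mult_at f p > 1}. {q. proximate q p \<and> mult_at f q > 0})"
  proof clarify
    fix q assume q: "satellite_point q" "mult_at f q > 0"
    then obtain p where p: "p \<noteq> butlast q" "proximate q p" by (metis insertCI mem_Collect_eq satellite_pointE)
    have "mult_at f p \<ge> mult_at f q"
      using mult_at_prefix_le[OF \<open>f \<noteq> 0\<close>] proximate_imp_strict_prefix[OF p(2)] by simp
    then have "mult_at f p > 1"
      using proximate_to_simple_point[OF \<open>f \<noteq> 0\<close> _ p(2) q(2)] p(1) q(2)
      by (metis One_nat_def Suc_lessI less_le_trans)
    then show "q \<in> (\<Union>p\<in>{p. mult_at f p > 1}. {q. proximate q p \<and> mult_at f q > 0})"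
      using p(2) q(2) by blast
  qed
qed

theorem finite_singular_points:
  assumes "squarefree f"
  shows "finite (singular_points f)"
proof (rule finite_subset)
  let ?S = "{q. satellite_point q \<and> mult_at f q > 0}"
  show "finite ({p. mult_at f p > 1} \<union> (\<Union>q\<in>?S. set (prefixes q)))"
    using finite_multiple_points[OF assms] finite_satellites_on[OF assms] by blast
  show "singular_points f \<subseteq> {p. mult_at f p > 1} \<union> (\<Union>q\<in>?S. set (prefixes q))"
    by (auto simp: singular_points_def)
qed

lemma singular_points_mono:
  assumes "f dvd g" "g \<noteq> 0"
  shows "singular_points f \<subseteq> singular_points g"
proof
  have le: "mult_at g p \<ge> mult_at f p" for p using assms by (rule mult_at_dvd_le)
  fix p assume p: "p \<in> singular_points f"
  then consider "mult_at f p > 1" | "satellite_point p"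
    | q where "strict_prefix p q" "satellite_point q" "mult_at f q > 0"
    unfolding singular_points_def by blast
  then have "mult_at g p > 1 \<or> satellite_point p \<or>
      (\<exists>q. strict_prefix p q \<and> satellite_point q \<and> mult_at g q > 0)"
  proof cases
    case 1
    then show ?thesis using le[of p] by linarith
  next
    case (3 q)
    then show ?thesis using le[of q] by (metis less_le_trans)
  qed simp
  moreover have "mult_at g p > 0" using p le[of p] by (simp add: singular_points_def)
  ultimately show "p \<in> singular_points g" by (simp add: singular_points_def)
qed

lemma singular_points_prefix:
  assumes "f \<noteq> 0" "q \<in> singular_points f" "prefix p q"
  shows "p \<in> singular_points f"
proof (cases "p = q")
  case False
  then have pq: "strict_prefix p q" using assms(3) by auto
  have le: "mult_at f q \<le> mult_at f p" using mult_at_prefix_le[OF assms(1,3)] .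
  from assms(2) consider "mult_at f q > 1" | "satellite_point q"
    | q' where "strict_prefix q q'" "satellite_point q'" "mult_at f q' > 0"
    unfolding singular_points_def by blast
  moreover have pos: "mult_at f q > 0" using assms(2) by (simp add: singular_points_def)
  ultimately have "mult_at f p > 1 \<or> (\<exists>q. strict_prefix p q \<and> satellite_point q \<and> mult_at f q > 0)"
  proof cases
    case 1
    then show ?thesis using le by linarith
  next
    case 2
    then show ?thesis using pq pos by blast
  next
    case (3 q')
    then show ?thesis using prefix_order.less_trans[OF pq] by blast
  qed
  then show ?thesis using pos le by (auto simp: singular_points_def)
qed (use assms in simp)

section \<open>The procedure\<close>

lemma value_at_rec: "value_at f p = int (mult_at f p) + (\<Sum>q\<in>{q. proximate p q}. value_at f q)"
  by (rule value_of.simps)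

lemma gcd_of_span: "gcd_of (ideal.span A) = gcd_of A"
proof -
  have "(\<forall>a\<in>ideal.span A. d dvd a) \<longleftrightarrow> (\<forall>a\<in>A. d dvd a)" for d
    using dvd_span[of A d] ideal.span_base by blast
  then show ?thesis by (simp add: gcd_of_def)
qed

locale nonzero_generators =
  fixes as :: "cps list"
  assumes nonempty: "as \<noteq> []" and nonzero: "0 \<notin> set as"
begin

abbreviation "gcf \<equiv> common_factor as"
abbreviation "F \<equiv> set (cofactors as)"
abbreviation "V \<equiv> min_value (cofactors as)"
abbreviation "e \<equiv> ideal_mult_at (ideal.span F)"

definition product :: cps where
  "product = gcf * prod_list (cofactors as)"

lemma gcf_nonzero: "gcf \<noteq> 0"
  using gcd_of_dvd[of "hd as" "set as"] nonempty nonzero unfolding common_factor_def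
  by (metis dvd_0_left_iff list.set_sel(1))

lemma set_as: "set as = (*) gcf ` F"
proof -
  have "gcf * (a div gcf) = a" if "a \<in> set as" for a
    using gcd_of_dvd[OF that] by (simp add: common_factor_def)
  then show ?thesis by (simp add: cofactors_def image_image)
qed

lemma F: "finite F" "F \<noteq> {}" "0 \<notin> F" "\<exists>f\<in>F. f \<noteq> 0"
proof -
  show "finite F" "F \<noteq> {}" using nonempty by (auto simp: cofactors_def)
  show "0 \<notin> F"
  proof
    assume "0 \<in> F"
    then have "gcf * 0 \<in> set as" unfolding set_as by (rule imageI)
    then show False using nonzero by simp
  qed
  then show "\<exists>f\<in>F. f \<noteq> 0" using \<open>F \<noteq> {}\<close> by (metis all_not_in_conv)
qed

lemma no_common_factor_F: "no_common_factor F"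
  unfolding no_common_factor_def
proof (intro allI impI)
  fix d assume d: "\<forall>f\<in>F. d dvd f"
  have "gcf * d dvd a" if a: "a \<in> set as" for a
  proof -
    obtain f where "f \<in> F" "a = gcf * f" using a unfolding set_as by (rule imageE)
    then show ?thesis using d by (simp add: mult_dvd_mono)
  qed
  then have "gcf * d dvd gcf" unfolding common_factor_def by (rule dvd_gcd_of)
  then show "is_unit d" using gcf_nonzero by (metis dvd_times_left_cancel_iff mult.right_neutral)
qed

lemma V_eq_Min: "V p = Min ((\<lambda>f. value_at f p) ` F)"
  by (simp add: min_value_def)

lemma V_le: "f \<in> F \<Longrightarrow> V p \<le> value_at f p"
  using F by (simp add: V_eq_Min)

lemma V_attained: obtains f where "f \<in> F" "value_at f p = V p"
proof -
  have "V p \<in> (\<lambda>f. value_at f p) ` F"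
    unfolding V_eq_Min by (rule Min_in) (use F in auto)
  then show thesis using that by auto
qed

lemma V_eq_value_of: "V p = value_of (\<lambda>q. int (e q)) p"
  using ideal_value[OF F(1-3)] by (simp add: V_eq_Min)

lemma e_eq: "int (e p) = V p - (\<Sum>q\<in>{q. proximate p q}. V q)"
  unfolding V_eq_value_of by (subst (1) value_of.simps) simp

lemma e_pos_iff: "e q > 0 \<longleftrightarrow> (\<forall>f\<in>F. value_at f q > (\<Sum>p\<in>{p. proximate q p}. V p))"
  using ideal_mult_at_pos_iff[OF F(1-3)] by (simp add: V_eq_Min)

lemma e_prefix: "e q > 0 \<Longrightarrow> prefix p q \<Longrightarrow> e p > 0"
  using ideal_mult_at_append_pos[OF F(4)] by (auto simp: prefix_def)

lemma procedure_value_eq: "procedure_value as p = BP_value (ideal.span (set as)) p"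
proof -
  obtain f where f: "f \<in> F" "value_at f p = V p" using V_attained .
  have v: "value_at (gcf * h) p = value_at gcf p + value_at h p" if "h \<in> F" for h
    using that F(3) gcf_nonzero by (intro value_at_mult) auto
  have "Min ((\<lambda>a. value_at a p) ` set as) = V p + value_at gcf p"
  proof (rule Min_eqI)
    show "V p + value_at gcf p \<le> y" if "y \<in> (\<lambda>a. value_at a p) ` set as" for y
      using that V_le[of _ p] by (auto simp: set_as v)
    show "V p + value_at gcf p \<in> (\<lambda>a. value_at a p) ` set as"
      using f v[OF f(1)] unfolding set_as image_image by (intro image_eqI[of _ _ f]) auto
  qed auto
  then show ?thesis
    using ideal_value[of "set as" p] nonempty nonzero by (simp add: procedure_value_def BP_value_def)
qed

lemma ideal_mult_at_as: "ideal_mult_at (ideal.span (set as)) p = mult_at gcf p + e p"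
proof -
  let ?v = "value_of (\<lambda>q. int (ideal_mult_at (ideal.span (set as)) q))"
  have v: "?v p = V p + value_at gcf p" for p
    using procedure_value_eq by (simp add: procedure_value_def BP_value_def)
  have "int (ideal_mult_at (ideal.span (set as)) p) = ?v p - (\<Sum>q\<in>{q. proximate p q}. ?v q)"
    by (subst (1) value_of.simps) simp
  also have "\<dots> = int (mult_at gcf p + e p)"
    unfolding v using value_at_rec[of gcf p] by (simp add: e_eq sum.distrib)
  finally show ?thesis by linarith
qed

text \<open>
  Multiplicities add up, so \<open>p\<close> has a multiplicity different from that of \<open>g\<close> exactly if it is a
  base point of the cofactors.
\<close>

lemma BP_points_eq:
  "BP_points (ideal.span (set as)) = {p. e p > 0} \<union> singular_points (reduced_equation gcf)"
  unfolding BP_points_def gcd_of_span ideal_mult_at_as common_factor_def by auto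

lemma step5_points_eq: "step5_points as = {p \<in> step4_points as. e p > 0}"
  unfolding step5_points_def e_eq[symmetric] by simp

lemma product_nonzero: "product \<noteq> 0"
  using F(3) gcf_nonzero by (simp add: product_def prod_list_zero_iff)

lemma F_dvd_product: "f \<in> F \<Longrightarrow> f dvd product"
  unfolding product_def by (intro dvd_mult prod_list_dvd)

lemma step2_points_eq: "step2_points as = singular_points (reduced_equation product)"
  by (simp add: step2_points_def product_def)

lemma mult_at_reduced_product_pos:
  assumes "f \<in> F" "mult_at f p > 0"
  shows "mult_at (reduced_equation product) p > 0"
  using assms mult_at_dvd_le[OF F_dvd_product product_nonzero, of f p]
  by (simp add: mult_at_reduced_equation_pos_iff product_nonzero)

lemma step7_points_eq: "step7_points as = singular_points (reduced_equation gcf)"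
proof -
  have "singular_points (reduced_equation gcf) \<subseteq> step2_points as"
    unfolding step2_points_eq
    using product_nonzero
    by (intro singular_points_mono reduced_equation_dvd_mono reduced_equation_nonzero) (simp_all add: product_def)
  then show ?thesis by (auto simp: step7_points_def)
qed

lemma step2_subset_step3: "step2_points as \<subseteq> step3_points as"
  by (auto simp: step3_points_def intro: adjoin_free.old)

lemma step3_subset_step4: "step3_points as \<subseteq> step4_points as"
  by (auto simp: step4_points_def intro: adjoin_satellite.old)

text \<open>
  At a free point \<open>q\<close> the value of \<open>f\<close> increases by its multiplicity; so the generators with the
  least value at \<open>p\<close> are the only ones that could keep this value at \<open>q\<close>.
\<close>

lemma adjoined_free_is_base_point:
  assumes "free_point q" "proximate q p"
    "\<And>f. f \<in> F \<Longrightarrow> value_at f p = V p \<Longrightarrow> mult_at f q > 0"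
  shows "e q > 0"
proof -
  obtain r where "{r. proximate q r} = {r}"
    using assms(1) unfolding free_point_def by (rule card_1_singletonE)
  then have pr: "{r. proximate q r} = {p}" using assms(2) by (metis mem_Collect_eq singletonD)
  have "value_at f q > V p" if "f \<in> F" for f
    using assms(3)[OF that] V_le[OF that, of p] value_at_rec[of f q] by (cases "value_at f p = V p") (auto simp: pr)
  then show ?thesis by (simp add: e_pos_iff pr)
qed

lemma adjoined_satellite_is_base_point:
  assumes "satellite_point q" "proximate q p" "proximate q p'" "p \<noteq> p'"
    "\<And>f. f \<in> F \<Longrightarrow> value_at f p > V p \<or> value_at f p' > V p'"
  shows "e q > 0"
proof -
  have "finite {r. proximate q r}" "card {r. proximate q r} \<le> card {p, p'}"
    using assms(1,4) by (auto simp: satellite_point_def finite_proximate)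
  then have pr: "{r. proximate q r} = {p, p'}"
    using assms(2,3) card_seteq[of "{r. proximate q r}" "{p, p'}"] by auto
  have "value_at f q > V p + V p'" if "f \<in> F" for f
    using assms(5)[OF that] V_le[OF that, of p] V_le[OF that, of p'] value_at_rec[of f q] assms(4) by (auto simp: pr)
  then show ?thesis using assms(4) by (simp add: e_pos_iff pr)
qed

lemma step3_points_subset: "step3_points as \<subseteq> step2_points as \<union> {q. e q > 0}"
proof
  fix q assume "q \<in> step3_points as"
  then show "q \<in> step2_points as \<union> {q. e q > 0}" unfolding step3_points_def
  proof (induction rule: adjoin_free.induct)
    case (new p q)
    then show ?case using adjoined_free_is_base_point[of q p] by blast
  qed simp
qed

lemma step4_points_subset: "step4_points as \<subseteq> step2_points as \<union> {q. e q > 0}"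
proof
  fix q assume "q \<in> step4_points as"
  then show "q \<in> step2_points as \<union> {q. e q > 0}" unfolding step4_points_def
  proof (induction rule: adjoin_satellite.induct)
    case (old p)
    then show ?case using step3_points_subset by blast
  next
    case (new p p' q)
    then show ?case using adjoined_satellite_is_base_point[of q p p'] by blast
  qed
qed

lemma finite_step4_points: "finite (step4_points as)"
proof (rule finite_subset[OF step4_points_subset])
  show "finite (step2_points as \<union> {q. e q > 0})"
    unfolding step2_points_eq
    using finite_singular_points[OF reduced_equation(1)[OF product_nonzero]]
      finite_base_points[OF no_common_factor_F] by simp
qed

text \<open>
  Otherwise the reduced product would be smooth at \<open>O\<close>, hence associated to each of its prime
  factors, and would divide every \<open>f\<^sub>i\<close>.
\<close>

lemma origin_singular:
  assumes "e [] > 0"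
  shows "[] \<in> step2_points as"
proof -
  let ?h = "reduced_equation product"
  have h0: "?h \<noteq> 0" using reduced_equation_nonzero[OF product_nonzero] .
  have no_prox: "{p. proximate [] p} = {}" by (auto simp: proximate_iff)
  have pos: "multiplicity_O f > 0" if "f \<in> F" for f
  proof -
    have "value_at f [] > 0" using assms that by (simp add: e_pos_iff no_prox)
    then show ?thesis using value_at_rec[of f "[]"] by (simp add: no_prox)
  qed
  have "multiplicity_O ?h > 1"
  proof (rule ccontr)
    assume *: "\<not> multiplicity_O ?h > 1"
    have "?h dvd f" if f: "f \<in> F" for f
    proof -
      have "f \<noteq> 0" "\<not> is_unit f" using f F(3) pos[OF f] by (auto simp: is_unit_iff_multiplicity)
      then obtain p where p: "p dvd f" "prime p" using prime_divisor_exists by blast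
      then have "irreducible p" by (simp add: prime_elem_imp_irreducible)
      moreover have "p dvd product" using p(1) F_dvd_product[OF f] by (rule dvd_trans)
      ultimately have "p dvd ?h" using reduced_equation(2)[OF product_nonzero] by blast
      then obtain u where u: "?h = p * u" by (auto elim: dvdE)
      have "p \<noteq> 0" "multiplicity_O p \<noteq> 0"
        using p(2) is_unit_iff_multiplicity[of p] by auto
      moreover have "u \<noteq> 0" using h0 u by auto
      ultimately have "multiplicity_O u = 0" using * unfolding u by (simp add: multiplicity_O_mult)
      then have "is_unit u" using \<open>u \<noteq> 0\<close> by (simp add: is_unit_iff_multiplicity)
      then show ?thesis using p(1) unfolding u by (simp add: mult_unit_dvd_iff)
    qed
    then have "is_unit ?h" using no_common_factor_F by (simp add: no_common_factor_def)
    moreover obtain f where "f \<in> F" using F(4) by blast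
    then have "mult_at ?h [] > 0" using pos by (intro mult_at_reduced_product_pos) auto
    ultimately show False by (simp add: is_unit_iff_multiplicity)
  qed
  then show ?thesis by (simp add: step2_points_eq singular_points_def)
qed

text \<open>
  The criterion for base points matches the rules of adjunction, up to the two cases in which
  the point lies on some \<open>f\<^sub>i = 0\<close> already, or follows a satellite point off all of them.
\<close>

lemma base_point_in_step4: "e q > 0 \<Longrightarrow> q \<in> step4_points as"
proof (induction "length q" arbitrary: q rule: less_induct)
  case less
  show ?case
  proof (cases "q = []")
    case True
    then show ?thesis
      using origin_singular less.prems step2_subset_step3 step3_subset_step4 by blast
  next
    case False
    have before: "p \<in> step4_points as" if "proximate q p" for p
      using less.hyps[of p] e_prefix[OF less.prems, of p] proximate_imp_strict_prefix[OF that]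
      by (simp add: prefix_length_less)
    from satellite_or_free[OF False] show ?thesis
    proof
      assume "free_point q \<and> {p. proximate q p} = {butlast q}"
      define p where "p = butlast q"
      have free: "free_point q" and pr: "{p. proximate q p} = {p}"
        using \<open>free_point q \<and> _\<close> by (auto simp: p_def)
      then have pq: "proximate q p" by blast
      have v: "value_at f q = int (mult_at f q) + value_at f p" for f
        using value_at_rec[of f q] by (simp add: pr)
      have gt: "value_at f q > V p" if "f \<in> F" for f
        using less.prems that by (simp add: e_pos_iff pr)
      have "p \<in> step3_points as"
      proof (rule ccontr)
        assume p3: "p \<notin> step3_points as"
        \<comment> \<open>Then \<open>p\<close> is a satellite point on none of the germs \<open>f = 0\<close>, so that all values stay
            the same from \<open>p\<close> to \<open>q\<close>.\<close>
        have "satellite_point p"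
          using before[OF pq] p3 unfolding step4_points_def by (auto elim: adjoin_satellite.cases)
        moreover have "p \<notin> step2_points as" using p3 step2_subset_step3 by blast
        ultimately have "mult_at (reduced_equation product) p = 0"
          by (auto simp: step2_points_eq singular_points_def)
        then have p0: "mult_at f p = 0" if "f \<in> F" for f
          using mult_at_reduced_product_pos[OF that, of p] by (metis less_irrefl neq0_conv)
        obtain f where f: "f \<in> F" "value_at f p = V p" using V_attained .
        have "mult_at f q \<le> mult_at f p"
          using f(1) F(3) proximate_imp_strict_prefix[OF pq] by (intro mult_at_prefix_le) auto
        then show False using p0[OF f(1)] gt[OF f(1)] v[of f] f(2) by simp
      qed
      then have "q \<in> step3_points as"
        unfolding step3_points_def
      proof (rule adjoin_free.new[OF _ free pq])
        show "mult_at f q > 0" if "f \<in> F" "value_at f p = V p" for f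
          using gt[OF that(1)] v[of f] that(2) by simp
      qed
      then show ?thesis using step3_subset_step4 by blast
    next
      assume sat: "satellite_point q"
      then obtain p p' where pr: "p \<noteq> p'" "{p. proximate q p} = {p', p}" by (metis satellite_pointE)
      then have pq: "proximate q p" "proximate q p'" by blast+
      have v: "value_at f q = int (mult_at f q) + value_at f p + value_at f p'" for f
        using value_at_rec[of f q] pr by simp
      show ?thesis
      proof (cases "\<forall>f\<in>F. value_at f p > V p \<or> value_at f p' > V p'")
        case True
        show ?thesis
          using before[OF pq(1)] before[OF pq(2)] unfolding step4_points_def
          by (rule adjoin_satellite.new[OF _ _ pr(1) sat pq]) (use True in blast)
      next
        case False
        then obtain f where f: "f \<in> F" "value_at f p = V p" "value_at f p' = V p'"
          using V_le by (metis order_le_less)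
        have "value_at f q > V p + V p'" using less.prems f(1) pr by (simp add: e_pos_iff add.commute)
        then have "mult_at f q > 0" using v[of f] f by simp
        then have "q \<in> step2_points as"
          using mult_at_reduced_product_pos[OF f(1)] sat by (auto simp: step2_points_eq singular_points_def)
        then show ?thesis using step2_subset_step3 step3_subset_step4 by blast
      qed
    qed
  qed
qed

lemma procedure_points_eq: "procedure_points as = {p. e p > 0} \<union> singular_points (reduced_equation gcf)"
  unfolding procedure_points_def step5_points_eq step7_points_eq
  using base_point_in_step4 by blast

lemma is_cluster_procedure_points: "is_cluster (procedure_points as)"
proof -
  have "finite (procedure_points as)"
    unfolding procedure_points_eq
    using finite_base_points[OF no_common_factor_F]
      finite_singular_points[OF reduced_equation(1)[OF gcf_nonzero]] by simp
  then show ?thesis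
    unfolding is_cluster_def procedure_points_eq
    using e_prefix singular_points_prefix[OF reduced_equation_nonzero[OF gcf_nonzero]] by blast
qed

end

theorem theorem4p7:
  fixes as :: "cps list"
  assumes "as \<noteq> []" and "0 \<notin> set as"
  shows "finite (step4_points as)
    \<and> is_cluster (procedure_points as)
    \<and> procedure_points as = BP_points (ideal.span (set as))
    \<and> (\<forall>p\<in>procedure_points as. procedure_value as p = BP_value (ideal.span (set as)) p)"
proof -
  interpret nonzero_generators as using assms by unfold_locales
  show ?thesis
    using finite_step4_points is_cluster_procedure_points procedure_value_eq
    by (simp add: BP_points_eq procedure_points_eq)
qed

end
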